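(* Let $\mathbb F\in\{\mathbb R,\mathbb C\}$, let $\Omega\subseteq\mathbb F^n$ with $\mu_n(\Omega)>0$, and let $\mathbf A(\mathbf z)\in\mathbb C^{K\times R}$, $\mathbf B(\mathbf z)=[\mathbf b(\boldsymbol\zeta_1)\ \dots\ \mathbf b(\boldsymbol\zeta_R)]\in\mathbb C^{N\times R}$, $\mathbf z\in\Omega$, be as described in the context, where $\mathbf b$ is built from polynomials $p_1,\dots,p_N,q_1,\dots,q_N$ in $l$ variables and from $\mathbf f=(f_1,\dots,f_l)$, and $\mathbf r(\mathbf x)=\left[\frac{p_1(\mathbf x)}{q_1(\mathbf x)}\ \dots\ \frac{p_N(\mathbf x)}{q_N(\mathbf x)}\right]^T$. Let $\widehat N$ and $\widehat l$ be integers. Assume that: 1) $\mathbf A(\mathbf z)$ has full column rank for a generic choice of $\mathbf z\in\Omega$, that is, $\mu_n\{\mathbf z\in\Omega:\ \operatorname{rank}\mathbf A(\mathbf z)<R\}=0$; 2) the coordinate functions of $\mathbf f$ can be represented as $f_j(\boldsymbol\zeta)=\frac{f_{j,num}(\boldsymbol\zeta)}{f_{j,den}(\boldsymbol\zeta)}$, $j=1,\dots,l$, where the functions $f_{1,num},f_{1,den},\dots,f_{l,num},f_{l,den}$ are analytic on $\mathbb C^l$; 3) there exists $\boldsymbol\zeta^0\in\mathbb C^l$ such that $\det\mathbf J(\mathbf f,\boldsymbol\zeta^0)\neq 0$; 4) $\dim\operatorname{span}\{\mathbf r(\mathbf x):\ q_1(\mathbf x)\cdots q_N(\mathbf x)\neq0,\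 \mathbf x\in\mathbb C^l\}\geq\widehat N$; 5) $\operatorname{rank}\mathbf J(\mathbf r,\mathbf x)\leq\widehat l$ for a generic choice of $\mathbf x\in\mathbb C^l$; 6) $R\leq\widehat N-\widehat l$ if the set $\operatorname{Range}(\mathbf r)$ is invariant under scaling, and $R\leq\widehat N-\widehat l-1$ if it is not. Then the decomposition $$\mathbf Y=\mathbf A(\mathbf z)\mathbf B(\mathbf z)^T=\sum_{r=1}^R\mathbf a_r(\mathbf z)\mathbf b(\boldsymbol\zeta_r)^T,\qquad \mathbf z\in\Omega,$$ is generically unique, that is, $\mu_n\{\mathbf z\in\Omega:\ \text{the decomposition of }\mathbf Y=\mathbf A(\mathbf z)\mathbf B(\mathbf z)^T\text{ is not unique}\}=0$.
   Context: Setting. $\mathbb F$ is $\mathbb R$ or $\mathbb C$; $K,N,R,l,n$ are positive integers with $Rl\le n$; $\mu_n$ is a measure that is absolutely continuous with respect to the Lebesgue measure on $\mathbb F^n$. "Generic" means: outside a set of measure zero (for $\mathbf x\in\mathbb C^l$: outside a set of Lebesgue measure zero). A $K\times R$ matrix has full column rank if its rank is $R$. Structured factorization. For $\mathbf z=[z_1\ \dots\ z_n]^T\in\Omega$, the matrix $\mathbf A(\mathbf z)$ is a known $K\times R$ matrix-valued function defined on $\Omega$, depending on some $m\ge0$ of the entries of $\mathbf z$ (not necessarily the first or last ones, possibly overlapping with those on which $\mathbf B$ depends), with no restriction on the form of dependence; its columns are $\mathbf a_1(\mathbf z),\dots,\mathbf a_R(\mathbf z)$. The matrix $\mathbf B(\mathbf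 z)$ depends on the last $s=Rl$ entries of $\mathbf z$: these entries are, up to an index permutation, $[\boldsymbol\zeta_1^T\ \dots\ \boldsymbol\zeta_R^T]^T$ with $\boldsymbol\zeta_1,\dots,\boldsymbol\zeta_R\in\mathbb F^l$, and $\mathbf B(\mathbf z)=[\mathbf b(\boldsymbol\zeta_1)\ \dots\ \mathbf b(\boldsymbol\zeta_R)]$, where $$\mathbf b(\boldsymbol\zeta)=\left[\frac{p_1(\mathbf f(\boldsymbol\zeta))}{q_1(\mathbf f(\boldsymbol\zeta))}\ \dots\ \frac{p_N(\mathbf f(\boldsymbol\zeta))}{q_N(\mathbf f(\boldsymbol\zeta))}\right]^T,\quad\boldsymbol\zeta\in\mathbb F^l .$$ Here $p_1,\dots,p_N,q_1,\dots,q_N$ are known polynomials in $l$ variables with complex coefficients, the $q_i$ being nonzero, and $\mathbf f(\boldsymbol\zeta)=(f_1(\boldsymbol\zeta),\dots,f_l(\boldsymbol\zeta))\in\mathbb F^l$ with $f_1,\dots,f_l$ known scalar functions of $l$ variables. $\mathbf A$ and $\mathbf B$ are defined on $\Omega$; in particular, for $\mathbf z\in\Omega$, $\mathbf f$ is defined at each $\boldsymbol\zeta_r$ and $q_1(\mathbf f(\boldsymbol\zeta_r))\cdots q_N(\mathbf f(\boldsymbol\zeta_r))\ne0$. When $f_j=f_{j,num}/f_{j,den}$ with $f_{j,num},f_{j,den}$ analytic on $\mathbb C^l$, the function $f_{j,den}$ is not identically zero and $f_j$ is considered at points of $\mathbb C^l$ where $f_{j,den}\ne 0$. Uniqueness.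 For $\mathbf z\in\Omega$ the decomposition of $\mathbf Y=\mathbf A(\mathbf z)\mathbf B(\mathbf z)^T$ is unique if it is only subject to permutation of the rank-1 terms: whenever $\tilde{\mathbf z}\in\Omega$ (with corresponding $\tilde{\boldsymbol\zeta}_1,\dots,\tilde{\boldsymbol\zeta}_R$) satisfies $\mathbf A(\tilde{\mathbf z})\mathbf B(\tilde{\mathbf z})^T=\mathbf Y$, there is a permutation $\sigma$ of $\{1,\dots,R\}$ with $\mathbf a_r(\tilde{\mathbf z})\mathbf b(\tilde{\boldsymbol\zeta}_r)^T=\mathbf a_{\sigma(r)}(\mathbf z)\mathbf b(\boldsymbol\zeta_{\sigma(r)})^T$ for all $r$. Jacobians and range. $(\mathbf J(\mathbf r,\mathbf x))_{ij}=\partial\frac{p_i}{q_i}/\partial x_j$ (an $N\times l$ matrix), $(\mathbf J(\mathbf f,\boldsymbol\zeta))_{ij}=\partial f_i/\partial\zeta_j$ (an $l\times l$ matrix). $\operatorname{Range}(\mathbf r)=\{\mathbf r(\mathbf x):\ q_1(\mathbf x)\cdots q_N(\mathbf x)\ne0,\ \mathbf x\in\mathbb C^l\}\subset\mathbb C^N$. It is invariant under scaling if $\operatorname{Range}(\mathbf r)\supseteq\lambda\cdot\operatorname{Range}(\mathbf r)$ for all $\lambda\in\mathbb C$. A function $\mathbb C^l\to\mathbb C$ is analytic if it is analytic (entire) in each variable separately. *)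

theory Defs
  imports "HOL-Analysis.Analysis" "HOL-Library.Poly_Mapping"
begin

text \<open>
  The scalar field is the real or the complex field. The axioms make \<open>to_complex\<close> an isometric
  isomorphism of real algebras from the type onto the set of real numbers or onto the set of
  all complex numbers, so up to isomorphism the class has no instances besides the two below.
\<close>

class real_or_complex = real_normed_field + euclidean_space +
  fixes to_complex :: "'a \<Rightarrow> complex"
  assumes to_complex_add: "to_complex (x + y) = to_complex x + to_complex y"
    and to_complex_mult: "to_complex (x * y) = to_complex x * to_complex y"
    and to_complex_scaleR: "to_complex (c *\<^sub>R x) = c *\<^sub>R to_complex x"
    and norm_to_complex: "norm (to_complex x) = norm x"
    and range_to_complex: "to_complex ` UNIV = \<real> \<or> to_complex ` UNIV = UNIV"

instantiation real :: real_or_complex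
begin
definition to_complex_real :: "real \<Rightarrow> complex" where "to_complex_real = complex_of_real"
instance by standard (auto simp: to_complex_real_def Reals_def scaleR_conv_of_real)
end

instantiation complex :: real_or_complex
begin
definition to_complex_complex :: "complex \<Rightarrow> complex" where "to_complex_complex = id"
instance by standard (auto simp: to_complex_complex_def)
end

definition cvec :: "'a::real_or_complex ^ 'l \<Rightarrow> complex ^ 'l" where
  "cvec x = (\<chi> i. to_complex (x $ i))"

text \<open>
  Polynomials in variables indexed by \<^typ>\<open>'l\<close> are finitely supported families of coefficients
  indexed by exponent vectors.
\<close>

type_synonym 'l cpoly = "('l \<Rightarrow>\<^sub>0 nat) \<Rightarrow>\<^sub>0 complex"

definition cpoly_eval :: "'l::finite cpoly \<Rightarrow> complex ^ 'l \<Rightarrow> complex" where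
  "cpoly_eval P x =
     (\<Sum>m\<in>Poly_Mapping.keys P.
        Poly_Mapping.lookup P m * (\<Prod>j\<in>UNIV. (x $ j) ^ Poly_Mapping.lookup m j))"

definition rat_map ::
  "('N \<Rightarrow> 'l::finite cpoly) \<Rightarrow> ('N \<Rightarrow> 'l cpoly) \<Rightarrow> complex ^ 'l \<Rightarrow> complex ^ 'N" where
  "rat_map p q x = (\<chi> i. cpoly_eval (p i) x / cpoly_eval (q i) x)"

definition rat_range ::
  "('N \<Rightarrow> 'l::finite cpoly) \<Rightarrow> ('N \<Rightarrow> 'l cpoly) \<Rightarrow> (complex ^ 'N) set" where
  "rat_range p q = {rat_map p q x |x. \<forall>i. cpoly_eval (q i) x \<noteq> 0}"

definition scale_invariant :: "(complex ^ 'N) set \<Rightarrow> bool" where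
  "scale_invariant S \<longleftrightarrow> (\<forall>c. (\<lambda>v. c *s v) ` S \<subseteq> S)"

definition vec_upd :: "'a ^ 'l \<Rightarrow> 'l \<Rightarrow> 'a \<Rightarrow> 'a ^ 'l" where
  "vec_upd x j t = (\<chi> k. if k = j then t else x $ k)"

text \<open>Analyticity is required in each variable separately; joint continuity is not assumed.\<close>

definition sep_entire :: "(complex ^ 'l \<Rightarrow> complex) \<Rightarrow> bool" where
  "sep_entire g \<longleftrightarrow> (\<forall>x j. (\<lambda>t. g (vec_upd x j t)) holomorphic_on UNIV)"

definition cjacobian ::
  "(complex ^ 'l \<Rightarrow> complex ^ 'm) \<Rightarrow> complex ^ 'l \<Rightarrow> complex ^ 'l ^ 'm" where
  "cjacobian g x = (\<chi> i j. deriv (\<lambda>t. g (vec_upd x j t) $ i) (x $ j))"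

text \<open>
  The index map \<open>loc\<close> tells which entry of \<open>z\<close> is the \<open>k\<close>-th entry of the \<open>r\<close>-th subvector.
\<close>

definition subvec :: "('R \<Rightarrow> 'l \<Rightarrow> 'n) \<Rightarrow> 'a ^ 'n \<Rightarrow> 'R \<Rightarrow> 'a ^ 'l" where
  "subvec loc z r = (\<chi> k. z $ loc r k)"

definition B_matrix ::
  "('N \<Rightarrow> 'l::finite cpoly) \<Rightarrow> ('N \<Rightarrow> 'l cpoly) \<Rightarrow> ('a ^ 'l \<Rightarrow> 'a ^ 'l) \<Rightarrow>
   ('R \<Rightarrow> 'l \<Rightarrow> 'n) \<Rightarrow> 'a::real_or_complex ^ 'n \<Rightarrow> complex ^ 'R ^ 'N" where
  "B_matrix p q f loc z = (\<chi> i r. rat_map p q (cvec (f (subvec loc z r))) $ i)"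

definition outer :: "complex ^ 'K \<Rightarrow> complex ^ 'N \<Rightarrow> complex ^ 'N ^ 'K" where
  "outer a b = (\<chi> i j. a $ i * b $ j)"

definition unique_decomposition ::
  "'z set \<Rightarrow> ('z \<Rightarrow> complex ^ 'R ^ 'K) \<Rightarrow> ('z \<Rightarrow> complex ^ 'R ^ 'N) \<Rightarrow> 'z \<Rightarrow> bool" where
  "unique_decomposition \<Omega> A B z \<longleftrightarrow>
     (\<forall>z'\<in>\<Omega>. A z' ** transpose (B z') = A z ** transpose (B z) \<longrightarrow>
        (\<exists>\<sigma>. bij \<sigma> \<and>
           (\<forall>r. outer (column r (A z')) (column r (B z')) =
                outer (column (\<sigma> r) (A z)) (column (\<sigma> r) (B z)))))"

end

theory Submission
  imports Defs "HOL-Complex_Analysis.Great_Picard"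
begin

text \<open>
  Call a point generic if its coordinates are algebraically independent over the countable ring
  generated by the coefficients of \<open>p\<close> and \<open>q\<close>. Almost every \<open>z\<close> yields a generic tuple
  \<open>x\<^sub>1, \<dots>, x\<^sub>R\<close> of arguments of the rational map: a nonzero polynomial of least degree vanishing on the
  range of \<open>f\<close> would have a nonzero derivative vanishing there too, since the Jacobian of \<open>f\<close> is
  generically invertible, and zero sets of nonzero separately entire functions are null, on real points
  as well as on complex ones. The Jacobian is separately entire because of Hartogs' theorem.

  It remains to see that the span of the \<open>r(x\<^sub>i)\<close> contains no further points of the range of \<open>r\<close>, up
  to scaling; then full column rank of \<open>A(z)\<close> gives uniqueness. This generalized trisecant lemma is proved
  without algebraic geometry. Let \<open>r(x) = \<Sum>c\<^sub>i r(x\<^sub>i)\<close> with \<open>c\<^sub>i\<close> nonzero for \<open>i \<in> I\<close>. By algebraic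
  independence, \<open>\<partial>/\<partial>x\<^sub>i\<^sub>j\<close> extends to a derivation of the complex numbers that kills the coefficients.
  Applied to the relation it shows that the tangent spaces at all the \<open>x\<^sub>i\<close> lie in the tangent space
  at \<open>x\<close> plus the span of the \<open>r(x\<^sub>i)\<close>, of dimension at most \<open>e + |I| - 1\<close> if tangent spaces
  (taken together with the point) have dimension at most \<open>e\<close>. By genericity each new tangent space
  raises the dimension of the sum, so if \<open>|I| \<ge> 2\<close>, then the tangent vectors at one \<open>x\<^sub>i\<close> are multiples of
  \<open>r(x\<^sub>i)\<close> modulo the other tangent spaces. Then \<open>r\<close> is constant up to scaling modulo this
  subspace, which contradicts the dimension of its span.
\<close>

section \<open>Derivations\<close>

text \<open>Nothing is known about how \<open>x\<close> and the coefficients \<open>c i\<close> of a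
  secant relation vary with the generic points, so the relation cannot be differentiated along a
  curve. A derivation of the whole field differentiates a single identity between numbers; the
  unknown values \<open>D (x $ j)\<close> and \<open>D (c i)\<close> then only contribute tangent
  vectors at \<open>x\<close> and multiples of the points, which lie in the subspace under study
  anyway. Since the coefficients form a countable set, a generic point has to avoid only countably
  many zero sets.

  Points matter only up to scaling, so the rational map is replaced by a polynomial map proportional
  to it, and tangent spaces are those of the cone over the image. This explains the two bounds on
  \<open>R\<close>: a Jacobian of rank at most \<open>lhat\<close> leaves dimension at most
  \<open>lhat + 1\<close> once the point itself is added, and invariance under scaling saves this
  extra dimension. With \<open>e\<close> the largest dimension of a tangent space, both cases give
  \<open>CARD('R) + e \<le> Nhat\<close>.\<close>

datatype 'a dual = Dual (re: 'a) (ep: 'a)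

instantiation dual :: (comm_ring_1) comm_ring_1
begin
definition zero_dual :: "'a dual" where "0 = Dual 0 0"
definition one_dual :: "'a dual" where "1 = Dual 1 0"
definition plus_dual :: "'a dual \<Rightarrow> 'a dual \<Rightarrow> 'a dual"
  where "x + y = Dual (re x + re y) (ep x + ep y)"
definition minus_dual :: "'a dual \<Rightarrow> 'a dual \<Rightarrow> 'a dual"
  where "x - y = Dual (re x - re y) (ep x - ep y)"
definition uminus_dual :: "'a dual \<Rightarrow> 'a dual"
  where "- x = Dual (- re x) (- ep x)"
definition times_dual :: "'a dual \<Rightarrow> 'a dual \<Rightarrow> 'a dual"
  where "x * y = Dual (re x * re y) (re x * ep y + ep x * re y)"
instance
  by standard
    (auto simp: zero_dual_def one_dual_def plus_dual_def minus_dual_def uminus_dual_def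
      times_dual_def algebra_simps)
end

lemma dual_sel [simp]:
  "re (0 :: 'a :: comm_ring_1 dual) = 0" "ep (0 :: 'a dual) = 0"
  "re (1 :: 'a dual) = 1" "ep (1 :: 'a dual) = 0"
  "re (x + y :: 'a dual) = re x + re y" "ep (x + y) = ep x + ep y"
  "re (x - y :: 'a dual) = re x - re y" "ep (x - y) = ep x - ep y"
  "re (- x :: 'a dual) = - re x" "ep (- x) = - ep x"
  "re (x * y :: 'a dual) = re x * re y" "ep (x * y) = re x * ep y + ep x * re y"
  by (auto simp: zero_dual_def one_dual_def plus_dual_def minus_dual_def uminus_dual_def
      times_dual_def)

text \<open>A map \<open>D\<close> is a derivation exactly when
  \<open>x \<mapsto> Dual x (D x)\<close> is a ring homomorphism. Partial derivations thus become
  subrings of the dual numbers, and extending one becomes inclusion.\<close>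

definition dual_subring :: "'a::comm_ring_1 dual set \<Rightarrow> bool" where
  "dual_subring G \<longleftrightarrow> 1 \<in> G \<and> (\<forall>x\<in>G. \<forall>y\<in>G. x - y \<in> G \<and> x * y \<in> G)"

text \<open>A functional subring is the graph of a derivation from a subring of \<^typ>\<open>'a\<close> to \<^typ>\<open>'a\<close>.\<close>

definition derivation_graph :: "'a::comm_ring_1 dual set \<Rightarrow> bool" where
  "derivation_graph G \<longleftrightarrow> dual_subring G \<and> (\<forall>x\<in>G. re x = 0 \<longrightarrow> ep x = 0)"

lemma dual_subringD:
  assumes "dual_subring G"
  shows "1 \<in> G" "0 \<in> G" "\<And>x y. x \<in> G \<Longrightarrow> y \<in> G \<Longrightarrow> x - y \<in> G"
    "\<And>x. x \<in> G \<Longrightarrow> - x \<in> G"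
    "\<And>x y. x \<in> G \<Longrightarrow> y \<in> G \<Longrightarrow> x + y \<in> G"
    "\<And>x y. x \<in> G \<Longrightarrow> y \<in> G \<Longrightarrow> x * y \<in> G"
proof -
  show one: "1 \<in> G" using assms by (auto simp: dual_subring_def)
  show minus: "\<And>x y. x \<in> G \<Longrightarrow> y \<in> G \<Longrightarrow> x - y \<in> G"
    using assms by (auto simp: dual_subring_def)
  show zero: "0 \<in> G" using minus[OF one one] by simp
  show uminus: "\<And>x. x \<in> G \<Longrightarrow> - x \<in> G" using minus[OF zero] by simp
  show "\<And>x y. x \<in> G \<Longrightarrow> y \<in> G \<Longrightarrow> x + y \<in> G"
    using minus uminus by (metis diff_minus_eq_add)
  show "\<And>x y. x \<in> G \<Longrightarrow> y \<in> G \<Longrightarrow> x * y \<in> G"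
    using assms by (auto simp: dual_subring_def)
qed

lemma dual_subring_sum:
  "dual_subring G \<Longrightarrow> (\<And>i. i \<in> I \<Longrightarrow> f i \<in> G) \<Longrightarrow> sum f I \<in> G"
  by (induction I rule: infinite_finite_induct) (auto intro: dual_subringD)

lemma dual_subring_of_nat: "dual_subring G \<Longrightarrow> of_nat n \<in> G"
  by (induction n) (auto intro: dual_subringD)

definition polys_over :: "'a::zero set \<Rightarrow> 'a poly set" where
  "polys_over G = {P. \<forall>i. coeff P i \<in> G}"

text \<open>Dual numbers have zero divisors, while \<open>pderiv\<close> is typed for rings without
  them.\<close>

definition dual_pderiv :: "'a::comm_ring_1 dual poly \<Rightarrow> 'a dual poly" where
  "dual_pderiv P = Poly (map (\<lambda>n. of_nat (Suc n) * coeff P (Suc n)) [0..<degree P])"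

lemma coeff_dual_pderiv: "coeff (dual_pderiv P) n = of_nat (Suc n) * coeff P (Suc n)"
  by (auto simp: dual_pderiv_def nth_default_def coeff_eq_0 simp del: of_nat_Suc)

lemma re_of_nat [simp]: "re (of_nat n) = of_nat n"
  by (induction n) auto

lemma polys_over_ring:
  assumes "dual_subring G" "P \<in> polys_over G" "Q \<in> polys_over G"
  shows "P - Q \<in> polys_over G" "P * Q \<in> polys_over G" "dual_pderiv P \<in> polys_over G"
  using assms
  by (auto simp: polys_over_def coeff_mult coeff_dual_pderiv
      intro!: dual_subringD dual_subring_sum dual_subring_of_nat
      simp del: of_nat_Suc)

lemma polys_over_const:
  assumes "dual_subring G" "c \<in> G"
  shows "[:c:] \<in> polys_over G" "monom c n \<in> polys_over G"
  using assms dual_subringD(2)[OF assms(1)]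
  by (auto simp: polys_over_def coeff_pCons split: nat.split)

definition adjoin :: "'a::comm_ring_1 dual set \<Rightarrow> 'a dual \<Rightarrow> 'a dual set" where
  "adjoin G t = (\<lambda>P. poly P t) ` polys_over G"

lemma dual_subring_adjoin:
  assumes G: "dual_subring G"
  shows "dual_subring (adjoin G t)"
  unfolding dual_subring_def
proof (intro conjI ballI)
  show "1 \<in> adjoin G t"
    unfolding adjoin_def
    by (rule image_eqI[of _ _ "[:1:]"]) (auto intro!: polys_over_const G dual_subringD)
next
  fix x y assume "x \<in> adjoin G t" "y \<in> adjoin G t"
  then obtain P Q where PQ: "P \<in> polys_over G" "Q \<in> polys_over G" "x = poly P t" "y = poly Q t"
    by (auto simp: adjoin_def)
  then show "x - y \<in> adjoin G t"
    unfolding adjoin_def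
    by (intro image_eqI[of _ _ "P - Q"]) (auto intro: polys_over_ring G)
  show "x * y \<in> adjoin G t"
    unfolding adjoin_def using PQ
    by (intro image_eqI[of _ _ "P * Q"]) (auto intro: polys_over_ring G)
qed

lemma subset_adjoin: "dual_subring G \<Longrightarrow> G \<subseteq> adjoin G t"
  unfolding adjoin_def
  by (rule subsetI, rule_tac x = "[:x:]" in image_eqI) (auto intro!: polys_over_const)

lemma mem_adjoin:
  assumes G: "dual_subring G"
  shows "t \<in> adjoin G t"
  unfolding adjoin_def
  by (rule image_eqI[of _ _ "[:0,1:]"])
    (auto simp: polys_over_def coeff_pCons dual_subringD(1,2)[OF G] split: nat.split)

lemma re_poly: "re (poly P t) = poly (map_poly re P) (re t)"
  by (induction P) (auto simp: map_poly_pCons)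

text \<open>The value is affine in \<open>ep t\<close>, so the \<open>ep\<close> part of a
  polynomial can be made to vanish by a choice of \<open>ep t\<close> wherever the derivative is
  nonzero.\<close>

lemma ep_poly:
  "ep (poly P t) = poly (map_poly ep P) (re t) + poly (pderiv (map_poly re P)) (re t) * ep t"
proof (induction P)
  case (pCons a P)
  then show ?case
    by (auto simp: map_poly_pCons pderiv_pCons re_poly algebra_simps)
qed simp

lemma derivation_graph_re_eq_0:
  "derivation_graph G \<Longrightarrow> x \<in> G \<Longrightarrow> re x = 0 \<Longrightarrow> x = 0"
  by (cases x) (auto simp: derivation_graph_def zero_dual_def)

lemma dual_mult_eq_0:
  fixes c x :: "'a::idom dual"
  assumes "c * x = 0" "re x = 0" "re c \<noteq> 0"
  shows "x = 0"
proof (rule dual.expand)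
  have "re c * ep x = 0" using arg_cong[OF assms(1), of ep] assms(2) by simp
  then show "re x = re 0 \<and> ep x = ep 0" using assms by simp
qed

text \<open>If \<open>t\<close> satisfies no polynomial relation over \<open>G\<close>, its
  derivative may be chosen freely. Otherwise a relation of least degree dictates the derivative, and
  every other relation follows from that one by division.\<close>

lemma derivation_graph_adjoin:
  fixes G :: "'a::field_char_0 dual set" and t :: 'a
  assumes G: "derivation_graph G"
  shows "\<exists>s. derivation_graph (adjoin G (Dual t s))"
proof -
  have sub: "dual_subring G" using G by (simp add: derivation_graph_def)
  \<comment> \<open>Only \<open>re\<close> parts enter, so the condition does not depend on the
    \<open>ep\<close> part attached to \<open>t\<close>; the 0 is a placeholder.\<close>
  let ?root = "\<lambda>P. P \<in> polys_over G \<and> re (poly P (Dual t 0)) = 0"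
  have re_s: "re (poly P (Dual t s)) = re (poly P (Dual t 0))" for P s
    by (simp add: re_poly)
  have zero: "P = 0" if "P \<in> polys_over G" "map_poly re P = 0" for P
  proof (rule poly_eqI)
    fix n
    have "re (coeff P n) = 0"
      using arg_cong[OF that(2), of "\<lambda>p. coeff p n"] by (simp add: coeff_map_poly)
    then show "coeff P n = coeff 0 n"
      using derivation_graph_re_eq_0[OF G] that(1) by (auto simp: polys_over_def)
  qed
  show ?thesis
  proof (cases "\<exists>P. ?root P \<and> P \<noteq> 0")
    case False
    have "derivation_graph (adjoin G (Dual t 0))"
      unfolding derivation_graph_def
      using False dual_subring_adjoin[OF sub] by (auto simp: adjoin_def)
    then show ?thesis by blast
  next
    case True
    then obtain P0 where P0: "?root P0 \<and> P0 \<noteq> 0" by blast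
    obtain P where P: "?root P" "P \<noteq> 0"
      and min: "\<And>Q. ?root Q \<Longrightarrow> Q \<noteq> 0 \<Longrightarrow> degree P \<le> degree Q"
      using ex_has_least_nat[of "\<lambda>P. ?root P \<and> P \<noteq> 0", OF P0, of degree] by blast
    \<comment> \<open>Characteristic 0: otherwise \<open>dual_pderiv P\<close> satisfies
      \<open>?root\<close> with smaller degree, hence is zero, and \<open>map_poly re P\<close> is a
      constant with value 0 at \<open>t\<close>.\<close>
    have d: "poly (pderiv (map_poly re P)) t \<noteq> 0"
    proof
      assume 0: "poly (pderiv (map_poly re P)) t = 0"
      have pd: "pderiv (map_poly re P) = map_poly re (dual_pderiv P)"
        by (rule poly_eqI) (simp add: coeff_pderiv coeff_dual_pderiv coeff_map_poly del: of_nat_Suc)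
      have "?root (dual_pderiv P)"
        using 0 P(1) polys_over_ring(3)[OF sub] by (auto simp: re_poly pd)
      moreover have "degree (dual_pderiv P) < degree P" if "dual_pderiv P \<noteq> 0"
      proof -
        have "degree (dual_pderiv P) \<le> degree P - 1" by (rule degree_le)
            (auto simp: coeff_dual_pderiv coeff_eq_0)
        moreover have "degree P \<noteq> 0"
          using that by (cases "degree P = 0") (simp_all add: dual_pderiv_def)
        ultimately show ?thesis by simp
      qed
      ultimately have "dual_pderiv P = 0" using min by (meson not_less)
      then have "pderiv (map_poly re P) = 0" by (simp add: pd)
      then have "degree (map_poly re P) = 0" by (simp add: pderiv_eq_0_iff)
      then obtain c where c: "map_poly re P = [:c:]" by (auto elim: degree_eq_zeroE)
      with P(1) have "c = 0" by (simp add: re_poly)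
      with c have "P = 0" using zero P(1) by auto
      with P(2) show False by simp
    qed
    define s where "s = - poly (map_poly ep P) t / poly (pderiv (map_poly re P)) t"
    let ?t = "Dual t s"
    have Pt: "poly P ?t = 0"
      using P(1) d by (auto simp: zero_dual_def s_def re_poly ep_poly intro!: dual.expand)
    have Q: "poly Q ?t = 0" if "?root Q" for Q
      using that
    proof (induction "degree Q" arbitrary: Q rule: less_induct)
      case less
      show ?case
      proof (cases "Q = 0 \<or> degree Q < degree P")
        case True
        then show ?thesis using min less.prems by force
      next
        case False
        define c where "c = lead_coeff P"
        define M where "M = monom (lead_coeff Q) (degree Q - degree P)"
        \<comment> \<open>Pseudo-division: inverses need not lie in \<open>G\<close>, so
          \<open>Q\<close> is multiplied by the leading coefficient of \<open>P\<close> before the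
          leading terms are cancelled. \<open>dual_mult_eq_0\<close> removes this factor
          afterwards.\<close>
        define Q' where "Q' = [:c:] * Q - M * P"
        have cG: "c \<in> G" and MG: "M \<in> polys_over G"
          using P(1) less.prems
          by (auto simp: c_def M_def polys_over_def dual_subringD(2)[OF sub])
        have Q'G: "Q' \<in> polys_over G"
          unfolding Q'_def using P(1) less.prems cG MG
          by (intro polys_over_ring sub polys_over_const) auto
        have "re (poly Q' (Dual t 0)) = 0"
          using P(1) less.prems by (simp add: Q'_def)
        with Q'G have root: "?root Q'" by simp
        have "degree Q' < degree Q" if "Q' \<noteq> 0"
        proof -
          have 1: "degree Q' \<le> degree Q"
            unfolding Q'_def
          proof (rule degree_diff_le)
            show "degree ([:c:] * Q) \<le> degree Q" by (rule order_trans[OF degree_mult_le]) simp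
            have "degree (M * P) \<le> degree M + degree P" by (rule degree_mult_le)
            also have "\<dots> \<le> degree Q"
              using degree_monom_le[of "lead_coeff Q" "degree Q - degree P"] False
              by (auto simp: M_def)
            finally show "degree (M * P) \<le> degree Q" .
          qed
          have e1: "coeff ([:c:] * Q) (degree Q) = c * lead_coeff Q" by simp
          have e2: "coeff (M * P) (degree Q) = lead_coeff Q * c"
            using False by (simp add: M_def c_def coeff_monom_mult)
          have 2: "coeff Q' (degree Q) = 0"
            unfolding Q'_def coeff_diff e1 e2 by (simp add: mult.commute)
          show ?thesis
            using 1 2 that by (metis le_neq_implies_less leading_coeff_0_iff)
        qed
        then have "poly Q' ?t = 0" using less.hyps root by (cases "Q' = 0") auto
        then have "c * poly Q ?t = 0" by (simp add: Q'_def Pt)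
        moreover have "re (poly Q ?t) = 0" using less.prems re_s[of Q s] by argo
        moreover have "re c \<noteq> 0"
          using derivation_graph_re_eq_0[OF G cG] P(2) by (auto simp: c_def)
        ultimately show ?thesis
          by (rule dual_mult_eq_0)
      qed
    qed
    have "derivation_graph (adjoin G ?t)"
      unfolding derivation_graph_def
    proof (intro conjI ballI impI dual_subring_adjoin sub)
      fix x assume "x \<in> adjoin G ?t" "re x = 0"
      then obtain P where P: "P \<in> polys_over G" "x = poly P ?t" by (auto simp: adjoin_def)
      with \<open>re x = 0\<close> re_s[of P s] have "?root P" by argo
      then show "ep x = 0" using Q P by simp
    qed
    then show ?thesis by blast
  qed
qed

definition derivation :: "('a::comm_ring_1 \<Rightarrow> 'a) \<Rightarrow> bool" where
  "derivation D \<longleftrightarrow> (\<forall>x y. D (x + y) = D x + D y \<and> D (x * y) = x * D y + D x * y)"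

text \<open>Unions of chains of graphs are graphs, so Zorn's lemma yields a maximal one. It is
  defined at every \<open>t\<close>, since \<open>derivation_graph_adjoin\<close> would enlarge it
  otherwise.\<close>

theorem extend_derivation:
  fixes G :: "'a::field_char_0 dual set"
  assumes G: "derivation_graph G"
  obtains D where "derivation D" "\<And>x. x \<in> G \<Longrightarrow> D (re x) = ep x"
proof -
  let ?A = "{H. derivation_graph H \<and> G \<subseteq> H}"
  have "\<exists>M\<in>?A. \<forall>X\<in>?A. M \<subseteq> X \<longrightarrow> X = M"
  proof (rule subset_Zorn_nonempty)
    show "?A \<noteq> {}" using G by auto
    fix C assume C: "C \<noteq> {}" "subset.chain ?A C"
    have chain: "H \<subseteq> H' \<or> H' \<subseteq> H" if "H \<in> C" "H' \<in> C" for H H'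
      using C(2) that unfolding subset_chain_def by blast
    have mem: "derivation_graph H" "G \<subseteq> H" if "H \<in> C" for H
      using C(2) that by (auto simp: subset.chain_def)
    have "dual_subring (\<Union>C)"
      unfolding dual_subring_def
    proof (intro conjI ballI)
      show "1 \<in> \<Union>C"
        using C(1) mem(1) by (fastforce simp: derivation_graph_def dual_subring_def)
      fix x y assume "x \<in> \<Union>C" "y \<in> \<Union>C"
      then obtain H where H: "H \<in> C" "x \<in> H" "y \<in> H" using chain by blast
      then show "x - y \<in> \<Union>C" "x * y \<in> \<Union>C"
        using mem(1)[OF H(1)] by (auto simp: derivation_graph_def dual_subring_def)
    qed
    then show "\<Union>C \<in> ?A"
      using mem C(1) by (fastforce simp: derivation_graph_def)
  qed
  then obtain M where M: "derivation_graph M" "G \<subseteq> M"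
    and max: "\<And>X. derivation_graph X \<Longrightarrow> M \<subseteq> X \<Longrightarrow> X = M"
    by (metis (mono_tags, lifting) mem_Collect_eq order_trans)
  have sub: "dual_subring M" using M by (simp add: derivation_graph_def)
  have ex: "\<exists>s. Dual t s \<in> M" for t
    using derivation_graph_adjoin[OF M(1), of t] max subset_adjoin[OF sub] mem_adjoin[OF sub]
    by metis
  define D where "D t = (SOME s. Dual t s \<in> M)" for t
  have D: "Dual t (D t) \<in> M" for t unfolding D_def using someI_ex[OF ex] .
  have D_eq: "D (re x) = ep x" if "x \<in> M" for x
  proof -
    have "Dual (re x) (D (re x)) - x \<in> M" using D that dual_subringD[OF sub] by blast
    then have "Dual (re x) (D (re x)) - x = 0"
      by (intro derivation_graph_re_eq_0[OF M(1)]) auto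
    then show ?thesis by (metis dual.sel(2) eq_iff_diff_eq_0)
  qed
  have "derivation D"
    unfolding derivation_def
  proof (intro allI conjI)
    fix x y
    show "D (x + y) = D x + D y"
      using D_eq[OF dual_subringD(5)[OF sub D[of x] D[of y]]] by simp
    show "D (x * y) = x * D y + D x * y"
      using D_eq[OF dual_subringD(6)[OF sub D[of x] D[of y]]] by simp
  qed
  then show ?thesis using that D_eq M(2) by blast
qed

section \<open>Separately entire functions\<close>

text \<open>Montel's theorem turns the bound into a subsequence with a holomorphic limit, and
  pointwise convergence identifies this limit with \<open>g\<close>.\<close>

lemma bounded_pointwise_limit_holomorphic:
  fixes f :: "nat \<Rightarrow> complex \<Rightarrow> complex"
  assumes S: "open S"
    and hol: "\<And>n. f n holomorphic_on S"
    and bd: "\<And>n z. z \<in> S \<Longrightarrow> norm (f n z) \<le> B"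
    and lim: "\<And>z. z \<in> S \<Longrightarrow> (\<lambda>n. f n z) \<longlonglongrightarrow> g z"
  shows "g holomorphic_on S"
proof -
  obtain h r where h: "h holomorphic_on S" and r: "strict_mono (r :: nat \<Rightarrow> nat)"
    and lim': "\<And>x. x \<in> S \<Longrightarrow> (\<lambda>n. f (r n) x) \<longlonglongrightarrow> h x"
  proof (rule Montel[of S "range f" f])
    show "\<exists>B. \<forall>h\<in>range f. \<forall>z\<in>K. norm (h z) \<le> B" if "compact K" "K \<subseteq> S" for K
      using bd that by (intro exI[of _ B]) auto
  qed (use S hol in auto)
  have "h x = g x" if "x \<in> S" for x
    using LIMSEQ_unique[OF lim'[OF that]] LIMSEQ_subseq_LIMSEQ[OF lim[OF that] r]
    by (auto simp: o_def)
  then show ?thesis using h by (simp cong: holomorphic_cong)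
qed

text \<open>The derivative in \<open>y\<close> is a bounded pointwise limit of difference quotients
  holomorphic in \<open>x\<close>. The radii leave room: \<open>y\<close> is within
  \<open>d/2\<close> of \<open>y0\<close>, increments are at most \<open>d/4\<close>, and circles of
  radius \<open>d/8\<close> about points within \<open>3*d/4\<close> stay where \<open>h\<close> is
  bounded; the radius \<open>d/8\<close> also gives the constant 8.\<close>

lemma bounded_deriv_holomorphic:
  fixes h :: "complex \<Rightarrow> complex \<Rightarrow> complex"
  assumes S: "open S" and d: "0 < d"
    and bd: "\<And>x y. x \<in> S \<Longrightarrow> y \<in> ball y0 d \<Longrightarrow> norm (h x y) \<le> M"
    and holx: "\<And>y. y \<in> ball y0 d \<Longrightarrow> (\<lambda>x. h x y) holomorphic_on S"
    and holy: "\<And>x. x \<in> S \<Longrightarrow> h x holomorphic_on ball y0 d"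
    and y: "y \<in> ball y0 (d/2)"
  shows "(\<lambda>x. deriv (h x) y) holomorphic_on S"
    and "x \<in> S \<Longrightarrow> norm (deriv (h x) y) \<le> 8 * M / d"
proof -
  have deriv_bd: "norm (deriv (h x) z) \<le> 8 * M / d" if x: "x \<in> S" and z: "z \<in> ball y0 (3*d/4)" for x z
  proof -
    have sub: "cball z (d/8) \<subseteq> ball y0 d"
    proof
      fix u assume "u \<in> cball z (d/8)"
      then show "u \<in> ball y0 d" using z d dist_triangle[of y0 u z] by auto
    qed
    have "norm ((deriv ^^ 1) (h x) z) \<le> fact 1 * M / (d/8)^1"
    proof (rule Cauchy_inequality)
      show "h x holomorphic_on ball z (d/8)"
        using holy[OF x] sub ball_subset_cball by (blast intro: holomorphic_on_subset)
      show "continuous_on (cball z (d/8)) (h x)"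
        using holy[OF x] sub by (blast intro: holomorphic_on_imp_continuous_on holomorphic_on_subset)
      show "norm (h x u) \<le> M" if "norm (z - u) = d/8" for u
        using bd[OF x] sub that by (auto simp: dist_norm subset_iff)
    qed (use d in auto)
    then show ?thesis by (simp add: field_simps)
  qed
  show "x \<in> S \<Longrightarrow> norm (deriv (h x) y) \<le> 8 * M / d"
    using deriv_bd y d by auto
  define s where "s k = complex_of_real (d / (4 * (real k + 1)))" for k
  have s0: "s k \<noteq> 0" for k
    using d by (simp add: s_def del: of_real_divide)
  have s_norm: "norm (s k) \<le> d/4" for k
  proof -
    have "norm (s k) = d / (4 * (real k + 1))" using d by (simp add: s_def del: of_real_divide)
    also have "\<dots> \<le> d / 4" using d by (simp add: field_simps)
    finally show ?thesis .
  qed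
  have ys: "y + s k \<in> ball y0 (3*d/4)" for k
    using y s_norm[of k] dist_triangle[of y0 "y + s k" y] by (auto simp: dist_norm)
  have yin: "y \<in> ball y0 (3*d/4)" using y d by auto
  have s_lim: "s \<longlonglongrightarrow> 0"
  proof -
    have "(\<lambda>k. d / 4 * inverse (real (Suc k))) \<longlonglongrightarrow> d / 4 * 0"
      by (intro tendsto_intros LIMSEQ_inverse_real_of_nat)
    then have "(\<lambda>k. d / (4 * (real k + 1))) \<longlonglongrightarrow> 0"
      by (simp add: field_simps)
    then show ?thesis unfolding s_def
      using tendsto_of_real[where 'a = complex] by fastforce
  qed
  have sub34: "ball y0 (3*d/4) \<subseteq> ball y0 d" using d by auto
  show "(\<lambda>x. deriv (h x) y) holomorphic_on S"
  proof (rule bounded_pointwise_limit_holomorphic[OF S])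
    fix n
    show "(\<lambda>x. (h x (y + s n) - h x y) / s n) holomorphic_on S"
    proof (intro holomorphic_intros holx s0)
      show "y + s n \<in> ball y0 d" "y \<in> ball y0 d" using ys[of n] yin sub34 by blast+
    qed
  next
    fix n x assume x: "x \<in> S"
    have "norm (h x (y + s n) - h x y) \<le> (8 * M / d) * norm (y + s n - y)"
    proof (rule field_differentiable_bound[of "ball y0 (3*d/4)"])
      fix z assume z: "z \<in> ball y0 (3*d/4)"
      show "(h x has_field_derivative deriv (h x) z) (at z within ball y0 (3*d/4))"
        using holy[OF x] z sub34 holomorphic_derivI[of "h x" "ball y0 d" z] by auto
    qed (use deriv_bd x ys yin in auto)
    then show "norm ((h x (y + s n) - h x y) / s n) \<le> 8 * M / d"
      using s0[of n] by (simp add: norm_divide divide_le_eq)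
  next
    fix x assume x: "x \<in> S"
    have "(h x has_field_derivative deriv (h x) y) (at y)"
      using holy[OF x] yin sub34 holomorphic_derivI[of "h x" "ball y0 d" y] by auto
    then have "((\<lambda>e. (h x (y + e) - h x y) / e) \<longlongrightarrow> deriv (h x) y) (at 0)"
      by (simp add: DERIV_def)
    then show "(\<lambda>n. (h x (y + s n) - h x y) / s n) \<longlonglongrightarrow> deriv (h x) y"
      by (rule filterlim_compose) (use s_lim s0 in \<open>auto intro!: filterlim_atI\<close>)
  qed
qed

lemma bounded_higher_deriv_holomorphic:
  fixes h :: "complex \<Rightarrow> complex \<Rightarrow> complex"
  assumes S: "open S" and d: "0 < d"
    and bd: "\<And>x y. x \<in> S \<Longrightarrow> y \<in> ball y0 d \<Longrightarrow> norm (h x y) \<le> M"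
    and holx: "\<And>y. y \<in> ball y0 d \<Longrightarrow> (\<lambda>x. h x y) holomorphic_on S"
    and holy: "\<And>x. x \<in> S \<Longrightarrow> h x holomorphic_on ball y0 d"
  shows "(\<lambda>x. (deriv ^^ n) (h x) y0) holomorphic_on S"
  using d bd holx holy
proof (induction n arbitrary: h d M)
  case 0
  then show ?case by simp
next
  case (Suc n)
  have "(\<lambda>x. (deriv ^^ n) (deriv (h x)) y0) holomorphic_on S"
  proof (rule Suc.IH[of "d/2" "\<lambda>x. deriv (h x)" "8 * M / d"])
    show "\<And>x y. x \<in> S \<Longrightarrow> y \<in> ball y0 (d/2) \<Longrightarrow> norm (deriv (h x) y) \<le> 8 * M / d"
      by (rule bounded_deriv_holomorphic(2)[OF S Suc.prems])
    show "\<And>y. y \<in> ball y0 (d/2) \<Longrightarrow> (\<lambda>x. deriv (h x) y) holomorphic_on S"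
      by (rule bounded_deriv_holomorphic(1)[OF S Suc.prems])
    show "deriv (h x) holomorphic_on ball y0 (d/2)" if "x \<in> S" for x
      using Suc.prems(4)[OF that] Suc.prems(1)
      by (intro holomorphic_deriv[OF holomorphic_on_subset]) auto
  qed (use Suc.prems in auto)
  then show ?case by (simp add: funpow_Suc_right del: funpow.simps)
qed

text \<open>The difference of the squares factors as
  \<open>(r\<^sup>2 - |w|\<^sup>2) (r\<^sup>2 - |z|\<^sup>2)\<close>. These are the bounds for a
  Blaschke factor: at most 1 on the disc, unimodular on the circle.\<close>

lemma blaschke_norm:
  fixes w z :: complex
  assumes "norm z \<le> r" "norm w < r"
  shows "r * norm (z - w) \<le> norm (of_real (r\<^sup>2) - cnj w * z)"
    and "norm z = r \<Longrightarrow> r * norm (z - w) = norm (of_real (r\<^sup>2) - cnj w * z)"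
proof -
  have r: "r > 0" using assms norm_ge_zero[of w] by linarith
  have id: "(norm (of_real (r\<^sup>2) - cnj w * z))\<^sup>2 - (r * norm (z - w))\<^sup>2
      = (r\<^sup>2 - (norm w)\<^sup>2) * (r\<^sup>2 - (norm z)\<^sup>2)"
    unfolding power_mult_distrib cmod_power2 by (simp add: power2_eq_square algebra_simps)
  have "(norm w)\<^sup>2 \<le> r\<^sup>2" "(norm z)\<^sup>2 \<le> r\<^sup>2" using assms by (auto intro!: power_mono)
  then have "(r * norm (z - w))\<^sup>2 \<le> (norm (of_real (r\<^sup>2) - cnj w * z))\<^sup>2"
    using id mult_nonneg_nonneg[of "r\<^sup>2 - (norm w)\<^sup>2" "r\<^sup>2 - (norm z)\<^sup>2"] by linarith
  then show "r * norm (z - w) \<le> norm (of_real (r\<^sup>2) - cnj w * z)"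
    by (rule power2_le_imp_le) simp
  show "r * norm (z - w) = norm (of_real (r\<^sup>2) - cnj w * z)" if "norm z = r"
  proof (rule power2_eq_imp_eq)
    have "(norm (of_real (r\<^sup>2) - cnj w * z))\<^sup>2 - (r * norm (z - w))\<^sup>2 = 0"
      unfolding id that by (simp only: diff_self mult_zero_right)
    then show "(r * norm (z - w))\<^sup>2 = (norm (of_real (r\<^sup>2) - cnj w * z))\<^sup>2" by linarith
  qed (use r in \<open>auto intro: mult_nonneg_nonneg less_imp_le\<close>)
qed

text \<open>Dividing by a Blaschke factor removes a zero, keeps the modulus on the circle and does
  not decrease it inside. Each step removes a zero with its full multiplicity \<open>n\<close>, so
  the number of distinct zeros drops.\<close>

lemma remove_zeros:
  fixes a :: "complex \<Rightarrow> complex"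
  assumes r: "0 < r" "r < r'"
    and hol: "a holomorphic_on ball 0 r'"
    and nz: "\<And>z. norm z = r \<Longrightarrow> a z \<noteq> 0"
  shows "\<exists>H. H holomorphic_on ball 0 r' \<and> (\<forall>z. norm z \<le> r \<longrightarrow> H z \<noteq> 0 \<and> norm (a z) \<le> norm (H z)) \<and>
    (\<forall>z. norm z = r \<longrightarrow> norm (H z) = norm (a z))"
  using hol nz
proof (induction "card {z \<in> cball 0 r. a z = 0}" arbitrary: a rule: less_induct)
  case less
  let ?B = "ball (0::complex) r'"
  show ?case
  proof (cases "\<forall>z\<in>cball 0 r. a z \<noteq> 0")
    case True
    then show ?thesis using less.prems by (intro exI[of _ a]) auto
  next
    case False
    then obtain w where w: "norm w \<le> r" "a w = 0" by auto
    have wr: "norm w < r" using w less.prems(2)[of w] by (cases "norm w = r") auto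
    \<comment> \<open>Nonzero on the circle but zero at \<open>w\<close>, the function is not
      constant; this yields the factorization at \<open>w\<close> and the finiteness of the
      zeros.\<close>
    have "a (of_real r) \<noteq> 0" "of_real r \<in> ?B" "w \<in> ?B" using less.prems(2) r wr by auto
    with w have nc: "\<not> a constant_on ?B" unfolding constant_on_def by metis
    obtain g s n where n: "0 < n" "0 < s" "ball w s \<subseteq> ?B" "g holomorphic_on ball w s"
      and ag: "\<And>z. z \<in> ball w s \<Longrightarrow> a z = (z - w)^n * g z"
      and gnz: "\<And>z. z \<in> ball w s \<Longrightarrow> g z \<noteq> 0"
      using holomorphic_factor_zero_nonconstant[OF less.prems(1) open_ball connected_ball \<open>w \<in> ?B\<close> w(2) nc]
      by metis
    define b where "b z = (if z = w then g w else a z / (z - w)^n)" for z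
    have bg: "b z = g z" if "z \<in> ball w s" for z
      using ag[OF that] by (simp add: b_def)
    have "b holomorphic_on (ball w s \<union> (?B - {w}))"
    proof (rule holomorphic_on_Un)
      show "b holomorphic_on ball w s" by (rule holomorphic_transform[OF n(4)]) (simp add: bg)
      have "(\<lambda>z. a z / (z - w)^n) holomorphic_on (?B - {w})"
        using less.prems(1) by (intro holomorphic_intros) (auto intro: holomorphic_on_subset)
      then show "b holomorphic_on (?B - {w})"
        by (rule holomorphic_transform) (auto simp: b_def)
    qed auto
    moreover have "ball w s \<union> (?B - {w}) = ?B" using n \<open>w \<in> ?B\<close> by auto
    ultimately have bhol: "b holomorphic_on ?B" by simp
    have ab: "a z = (z - w)^n * b z" for z
      using w n(1) by (simp add: b_def)
    have bw: "b w \<noteq> 0" using bg gnz n(2) by simp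
    define c where "c z = b z * ((of_real (r\<^sup>2) - cnj w * z) / of_real r)^n" for z
    have chol: "c holomorphic_on ?B" unfolding c_def using bhol r by (intro holomorphic_intros) auto
    have norm_c: "norm (c z) = norm (b z) * (norm (of_real (r\<^sup>2) - cnj w * z) / r) ^ n" for z
      using r by (simp add: c_def norm_mult norm_power norm_divide)
    have norm_a: "norm (a z) = norm (b z) * norm (z - w) ^ n" for z
      by (simp add: ab norm_mult norm_power)
    have eq: "norm (c z) = norm (a z)" if "norm z = r" for z
    proof -
      have "norm (of_real (r\<^sup>2) - cnj w * z) / r = norm (z - w)"
        using blaschke_norm(2)[of z r w] that wr r by (metis order_refl nonzero_mult_div_cancel_left less_irrefl)
      then show ?thesis by (simp only: norm_a norm_c)
    qed
    have le: "norm (a z) \<le> norm (c z)" if "norm z \<le> r" for z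
      unfolding norm_a norm_c using blaschke_norm(1)[OF that wr] r
      by (intro mult_left_mono power_mono) (auto simp: field_simps)
    have fac: "of_real (r\<^sup>2) - cnj w * z \<noteq> 0" if "norm z \<le> r" for z
    proof
      assume "of_real (r\<^sup>2) - cnj w * z = 0"
      then have "norm (complex_of_real (r\<^sup>2)) = norm w * norm z"
        by (metis complex_mod_cnj eq_iff_diff_eq_0 norm_mult)
      then have "r * r = norm w * norm z" using r by (simp add: power2_eq_square norm_mult)
      also have "\<dots> \<le> norm w * r" using that by (intro mult_left_mono) auto
      also have "\<dots> < r * r" using wr r by simp
      finally show False by simp
    qed
    have zeros: "{z \<in> cball 0 r. c z = 0} \<subseteq> {z \<in> cball 0 r. a z = 0} - {w}"
      using fac bw r by (auto simp: c_def ab)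
    have fin: "finite {z \<in> cball 0 r. a z = 0}"
      by (rule holomorphic_compact_finite_zeros[OF less.prems(1)]) (use nc r in auto)
    have "card {z \<in> cball 0 r. c z = 0} < card {z \<in> cball 0 r. a z = 0}"
      using zeros w fin by (intro psubset_card_mono) auto
    from less.hyps[OF this chol] eq less.prems(2)
    obtain H where "H holomorphic_on ?B" "\<forall>z. norm z \<le> r \<longrightarrow> H z \<noteq> 0 \<and> norm (c z) \<le> norm (H z)"
      "\<forall>z. norm z = r \<longrightarrow> norm (H z) = norm (c z)"
      by (metis norm_eq_zero)
    then show ?thesis using le eq by (intro exI[of _ H]) (auto intro: order_trans)
  qed
qed

text \<open>After its zeros are removed, \<open>a\<close> has a \<open>p\<close>-th power, to which Cauchy's formula applies.\<close>

lemma powr_submean: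
  fixes a :: "complex \<Rightarrow> complex"
  assumes r: "0 < r" "r < r'"
    and hol: "a holomorphic_on ball 0 r'"
    and nz: "\<And>z. norm z = r \<Longrightarrow> a z \<noteq> 0"
    and x: "norm x \<le> r / 2" and p: "p > 0"
  shows "norm (a x) powr p \<le> 2 * integral {0..1} (\<lambda>t. norm (a (circlepath 0 r t)) powr p)"
proof -
  obtain H where H: "H holomorphic_on ball 0 r'" "\<And>z. norm z \<le> r \<Longrightarrow> H z \<noteq> 0"
    "\<And>z. norm z \<le> r \<Longrightarrow> norm (a z) \<le> norm (H z)" "\<And>z. norm z = r \<Longrightarrow> norm (H z) = norm (a z)"
    using remove_zeros[OF r hol nz] by blast
  let ?B = "ball (0::complex) r'"
  have op: "open {z \<in> ?B. H z \<noteq> 0}"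
    using continuous_open_preimage[OF holomorphic_on_imp_continuous_on[OF H(1)] open_ball, of "- {0}"]
      open_Compl[OF closed_singleton[of "0::complex"]]
    by (simp add: vimage_def Int_def)
  obtain e where e: "e > 0" "(\<Union>x\<in>cball 0 r. ball x e) \<subseteq> {z \<in> ?B. H z \<noteq> 0}"
    by (rule compact_subset_open_imp_ball_epsilon_subset[OF _ op, of "cball 0 r"]) (use r H(2) in auto)
  \<comment> \<open>A logarithm of \<open>H\<close> needs a zero-free open disc containing the
    closed disc of radius \<open>r\<close>. Points beyond radius \<open>r\<close> are within
    \<open>e\<close> of their radial projection to the circle.\<close>
  have sub: "ball 0 (r + e) \<subseteq> {z \<in> ?B. H z \<noteq> 0}"
  proof
    fix z :: complex assume z: "z \<in> ball 0 (r + e)"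
    have "\<exists>y\<in>cball 0 r. z \<in> ball y e"
    proof (cases "norm z \<le> r")
      case True
      then show ?thesis using e(1) by (intro bexI[of _ z]) auto
    next
      case False
      then have nz: "norm z > r" by simp
      have z0: "z \<noteq> 0" using nz r by auto
      let ?y = "of_real (r / norm z) * z"
      have "z - ?y = of_real (1 - r / norm z) * z" by (simp add: algebra_simps)
      then have "norm (z - ?y) = \<bar>1 - r / norm z\<bar> * norm z" by (metis norm_mult norm_of_real)
      also have "\<bar>1 - r / norm z\<bar> = 1 - r / norm z"
        using nz r by (intro abs_of_nonneg) (simp add: divide_le_eq)
      also have "(1 - r / norm z) * norm z = norm z - r" using z0 by (simp add: left_diff_distrib)
      finally have "dist ?y z < e" using z by (simp add: dist_norm norm_minus_commute)
      moreover have "norm ?y = r" using z0 r by (simp add: norm_mult norm_divide)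
      ultimately show ?thesis by (intro bexI[of _ ?y]) auto
    qed
    then show "z \<in> {z \<in> ?B. H z \<noteq> 0}" using e(2) by blast
  qed
  obtain g where g: "g holomorphic_on ball 0 (r + e)" "\<And>z. z \<in> ball 0 (r + e) \<Longrightarrow> H z = exp (g z)"
    by (rule contractible_imp_holomorphic_log[of H "ball 0 (r + e)"])
      (use holomorphic_on_subset[OF H(1)] sub convex_imp_contractible[OF convex_ball] in blast)+
  define G where "G z = exp (of_real p * g z)" for z
  have Ghol: "G holomorphic_on ball 0 (r + e)"
    unfolding G_def by (intro holomorphic_intros g(1))
  have G_norm: "norm (G z) = norm (H z) powr p" if "norm z \<le> r" for z
  proof -
    have "z \<in> ball 0 (r + e)" using that e(1) by auto
    then show ?thesis using g(2)[of z] by (simp add: G_def powr_def mult.commute)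
  qed
  have sphere: "norm (circlepath 0 r t) = r" for t
    using r by (simp add: circlepath norm_mult)
  have "continuous_on {0..1} (\<lambda>t. a (circlepath 0 r t))"
  proof (rule continuous_on_compose2[OF holomorphic_on_imp_continuous_on[OF hol]])
    show "continuous_on {0..1} (circlepath 0 r)"
      using valid_path_imp_path[OF valid_path_circlepath] by (simp add: path_def)
    show "circlepath 0 r ` {0..1} \<subseteq> ball 0 r'" using sphere r by auto
  qed
  then have cont: "continuous_on {0..1} (\<lambda>t. norm (a (circlepath 0 r t)) powr p)"
    by (intro continuous_on_powr continuous_on_norm continuous_on_const) (use nz sphere in simp_all)
  have Gball: "G holomorphic_on ball 0 r"
    by (rule holomorphic_on_subset[OF Ghol]) (use e(1) in auto)
  have Gcont: "continuous_on (cball 0 r) G"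
    by (rule holomorphic_on_imp_continuous_on, rule holomorphic_on_subset[OF Ghol]) (use e(1) in auto)
  have "((\<lambda>u. G u / (u - x)) has_contour_integral (2 * of_real pi * \<i> * G x)) (circlepath 0 r)"
    by (rule Cauchy_integral_circlepath[OF Gcont])
      (use Gball r(1) x in auto)
  then have I: "((\<lambda>t. G (circlepath 0 r t) / (circlepath 0 r t - x) * vector_derivative (circlepath 0 r) (at t))
      has_integral (2 * of_real pi * \<i> * G x)) {0..1}"
    by (simp add: has_contour_integral)
  have "norm (2 * of_real pi * \<i> * G x) \<le> integral {0..1} (\<lambda>t. 4 * pi * norm (a (circlepath 0 r t)) powr p)"
    unfolding integral_unique[OF I, symmetric]
  proof (rule integral_norm_bound_integral)
    fix t :: real assume "t \<in> {0..1}"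
    let ?u = "circlepath 0 r t"
    \<comment> \<open>Origin of the factor 2: as \<open>x\<close> stays within half the radius, the
      Cauchy kernel is at most \<open>2 / r\<close>.\<close>
    have **: "norm (?u - x) \<ge> r / 2"
      using norm_triangle_ineq2[of ?u x] x sphere[of t] by linarith
    have *: "norm (vector_derivative (circlepath 0 r) (at t)) = 2 * pi * r"
      using r by (simp add: vector_derivative_circlepath norm_mult)
    show "norm (G ?u / (?u - x) * vector_derivative (circlepath 0 r) (at t))
        \<le> 4 * pi * norm (a ?u) powr p"
    proof -
      have 1: "norm (G ?u / (?u - x) * vector_derivative (circlepath 0 r) (at t))
          = norm (a ?u) powr p * (2 * pi * r / norm (?u - x))"
        unfolding norm_mult norm_divide * using G_norm[of ?u] H(4)[of ?u] sphere[of t] by simp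
      have "pi * (2 * r) \<le> pi * (4 * norm (?u - x))" by (rule mult_left_mono) (use ** in auto)
      moreover have "norm (?u - x) > 0" using ** r(1) by linarith
      ultimately have "2 * pi * r / norm (?u - x) \<le> 4 * pi"
        by (simp add: divide_le_eq)
      then have "norm (a ?u) powr p * (2 * pi * r / norm (?u - x)) \<le> norm (a ?u) powr p * (4 * pi)"
        by (rule mult_left_mono) simp
      with 1 show ?thesis by (simp only: mult.commute)
    qed
  next
    show "(\<lambda>t. G (circlepath 0 r t) / (circlepath 0 r t - x) * vector_derivative (circlepath 0 r) (at t))
        integrable_on {0..1}"
      using I by (rule has_integral_integrable)
    show "(\<lambda>t. 4 * pi * norm (a (circlepath 0 r t)) powr p) integrable_on {0..1}"
      by (intro integrable_continuous_real continuous_on_mult_left cont)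
  qed
  then have "norm (G x) \<le> 2 * integral {0..1} (\<lambda>t. norm (a (circlepath 0 r t)) powr p)"
    by (simp add: norm_mult)
  moreover have "norm (a x) powr p \<le> norm (G x)"
    using G_norm[of x] H(3)[of x] x r p by (auto intro: powr_mono2)
  ultimately show ?thesis by linarith
qed

lemma fsigma_ball:
  fixes r :: real
  shows "fsigma (ball (x::'a::metric_space) r)"
proof -
  have "ball x r = (\<Union>n. cball x (r - 1 / real (Suc n)))"
  proof (intro equalityI subsetI)
    fix y assume "y \<in> ball x r"
    then have "0 < r - dist x y" by simp
    then obtain n where "1 / real (Suc n) < r - dist x y" using nat_approx_posE by blast
    then show "y \<in> (\<Union>n. cball x (r - 1 / real (Suc n)))" by (intro UN_I[of n]) auto
  next
    fix y assume "y \<in> (\<Union>n. cball x (r - 1 / real (Suc n)))"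
    then obtain n where n: "dist x y \<le> r - 1 / real (Suc n)" by auto
    have "0 < 1 / real (Suc n)" by simp
    with n have "dist x y < r" by linarith
    then show "y \<in> ball x r" by simp
  qed
  then show ?thesis by (simp only:) (rule fsigma.intros, rule closed_cball)
qed

text \<open>Hartogs' lemma: on a circle avoiding all zeros, dominated convergence turns pointwise decay of
  the \<open>n\<close>-th roots into decay of their means, and these bound the roots inside.\<close>

lemma coefficients_uniformly_small:
  fixes a :: "nat \<Rightarrow> complex \<Rightarrow> complex"
  assumes hol: "\<And>n. a n holomorphic_on ball 0 4"
    and bd: "\<And>n x. x \<in> ball 0 4 \<Longrightarrow> norm (a n x) \<le> M * C ^ n" and M: "M \<ge> 1" and C: "C \<ge> 0"
    and small: "\<And>x R. x \<in> ball 0 4 \<Longrightarrow> R > 0 \<Longrightarrow> eventually (\<lambda>n. norm (a n x) * R ^ n \<le> 1) sequentially"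
    and e: "e > 0"
  shows "eventually (\<lambda>n. \<forall>x. norm x \<le> 1 \<longrightarrow> norm (a n x) \<le> e ^ n) sequentially"
proof -
  let ?B = "ball (0::complex) 4"
  \<comment> \<open>These are the radii of circles meeting a zero of some nonconstant
    \<open>a n\<close>. They are countably many, so one radius between 2 and 3 avoids them for all
    \<open>n\<close>, and the unit disc lies within half of it, as \<open>powr_submean\<close>
    requires.\<close>
  let ?Z = "\<Union>n\<in>{n. \<not> a n constant_on ?B}. norm ` {z \<in> ?B. a n z = 0}"
  have "countable ?Z"
    using fsigma_ball by (intro countable_UN countableI_type countable_image holomorphic_countable_zeros hol) auto
  then have unc: "uncountable ({2<..<3} - ?Z)"
    by (intro uncountable_minus_countable) (simp_all add: uncountable_open_interval)
  have "{2<..<3} - ?Z \<noteq> {}"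
  proof
    assume "{2<..<3} - ?Z = {}"
    with unc show False by (simp only: countable_empty not_True_eq_False)
  qed
  then obtain r where "r \<in> {2<..<3}" and r3: "r \<notin> ?Z" by blast
  then have r: "2 < r" "r < 3" by auto
  have root: "a n z \<noteq> 0" if "norm z = r" "x \<in> ?B" "a n x \<noteq> 0" for n z x
  proof (cases "a n constant_on ?B")
    case True
    then obtain c where c: "\<And>y. y \<in> ?B \<Longrightarrow> a n y = c" unfolding constant_on_def by blast
    have "z \<in> ?B" using that(1) r by simp
    from c[OF this] c[OF that(2)] show ?thesis using that(3) by simp
  next
    case False
    have "z \<in> ?B" using that(1) r by simp
    then show ?thesis using False that(1) r3 by blast
  qed
  let ?c = "circlepath 0 r"
  have sphere: "norm (?c t) = r" for t
    using r by (simp add: circlepath norm_mult)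
  then have inB: "?c t \<in> ?B" for t using r by simp
  define f where "f n t = norm (a n (?c t)) powr (1 / real n)" for n t
  have cont: "continuous_on {0..1} (f n)" for n
  proof (cases "\<exists>x\<in>?B. a n x \<noteq> 0")
    case True
    have "continuous_on {0..1} (\<lambda>t. a n (?c t))"
    proof (rule continuous_on_compose2[OF holomorphic_on_imp_continuous_on[OF hol]])
      show "continuous_on {0..1} ?c"
        using valid_path_imp_path[OF valid_path_circlepath] by (simp add: path_def)
      show "?c ` {0..1} \<subseteq> ball 0 4" using inB by auto
    qed
    then show ?thesis unfolding f_def
      by (intro continuous_on_powr continuous_on_norm continuous_on_const) (use True root sphere in auto)
  next
    case False
    then show ?thesis using inB unfolding f_def by (intro continuous_on_eq[OF continuous_on_const[of _ 0]]) simp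
  qed
  have fnn: "f n t \<ge> 0" for n t by (simp add: f_def)
  have lim0: "(\<lambda>n. f n t) \<longlonglongrightarrow> 0" for t
  proof (rule LIMSEQ_I)
    fix d :: real assume d: "d > 0"
    from small[OF inB[of t], of "2 / d"] d
    have "eventually (\<lambda>n. norm (a n (?c t)) * (2 / d) ^ n \<le> 1) sequentially" by simp
    then have "eventually (\<lambda>n. norm (f n t - 0) < d) sequentially"
      using eventually_gt_at_top[of 0]
    proof eventually_elim
      case (elim n)
      have "norm (a n (?c t)) \<le> (d / 2) ^ n"
        using elim d by (simp add: field_simps)
      then have "f n t \<le> ((d / 2) ^ n) powr (1 / real n)"
        unfolding f_def by (intro powr_mono2) auto
      also have "\<dots> = d / 2"
        using elim d by (simp add: powr_powr flip: powr_realpow)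
      finally show ?case using d fnn[of n t] by simp
    qed
    then show "\<exists>no. \<forall>n\<ge>no. norm (f n t - 0) < d" by (simp add: eventually_sequentially)
  qed
  have fbd: "f n t \<le> M * (C + 1)" for n t
  proof (cases "n = 0")
    case True
    \<comment> \<open>Here the exponent \<open>1 / real 0\<close> is 0, so the value is 0 or
      1.\<close>
    then have "f n t \<le> 1" by (simp add: f_def)
    moreover have "1 * 1 \<le> M * (C + 1)" using M C by (intro mult_mono) auto
    ultimately show ?thesis by linarith
  next
    case False
    have "norm (a n (?c t)) \<le> M * C ^ n" using bd inB by blast
    also have "\<dots> \<le> M ^ n * (C + 1) ^ n"
      using M C False by (intro mult_mono power_mono self_le_power) auto
    also have "\<dots> = (M * (C + 1)) ^ n" by (simp add: power_mult_distrib)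
    finally have "f n t \<le> ((M * (C + 1)) ^ n) powr (1 / real n)"
      unfolding f_def by (intro powr_mono2) auto
    also have "\<dots> = M * (C + 1)"
      using False M C by (simp add: powr_powr flip: powr_realpow)
    finally show ?thesis .
  qed
  have "(\<lambda>n. integral {0..1} (f n)) \<longlonglongrightarrow> integral {0..1} (\<lambda>t::real. 0::real)"
    by (rule dominated_convergence(2)[where h = "\<lambda>_. M * (C + 1)"])
      (use fbd fnn lim0 in \<open>auto intro!: integrable_continuous_real cont\<close>)
  then have "eventually (\<lambda>n. norm (integral {0..1} (f n) - 0) < e / 2) sequentially"
    using e LIMSEQ_D[of "\<lambda>n. integral {0..1} (f n)" 0 "e / 2"]
    by (auto simp: eventually_sequentially)
  then show ?thesis
    using eventually_gt_at_top[of 0]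
  proof eventually_elim
    case (elim n)
    show ?case
    proof (intro allI impI)
      fix x :: complex assume x: "norm x \<le> 1"
      show "norm (a n x) \<le> e ^ n"
      proof (cases "a n x = 0")
        case False
        have "norm (a n x) powr (1 / real n) \<le> 2 * integral {0..1} (f n)"
          unfolding f_def
        proof (rule powr_submean[of r 4])
          show "\<And>z. norm z = r \<Longrightarrow> a n z \<noteq> 0" using root[of _ x n] False x by simp
        qed (use r x elim hol in auto)
        also have "\<dots> \<le> e" using elim by (auto simp: abs_if split: if_splits)
        finally have le: "norm (a n x) powr (1 / real n) \<le> e" .
        have "norm (a n x) = (norm (a n x) powr (1 / real n)) ^ n"
          using False elim by (simp add: powr_powr flip: powr_realpow)
        also have "\<dots> \<le> e ^ n" using le by (intro power_mono) auto
        finally show ?thesis .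
      qed (use e in simp)
    qed
  qed
qed

text \<open>By Baire's theorem \<open>g\<close> is bounded for \<open>x\<close> in a large disc and
  \<open>y\<close> in some disc about a point \<open>y0\<close>. The coefficients of its expansion
  in \<open>y - y0\<close> are then holomorphic in \<open>x\<close>, and for each fixed
  \<open>x\<close> they decay faster than any geometric sequence because the series converges for
  all \<open>y\<close>. Hartogs' lemma makes the decay uniform in \<open>x\<close>, which bounds the
  series for all \<open>y\<close> up to \<open>T\<close>.\<close>

lemma sep_entire2_locally_bounded_aux:
  fixes g :: "complex \<Rightarrow> complex \<Rightarrow> complex"
  assumes holx: "\<And>y. (\<lambda>x. g x y) holomorphic_on UNIV"
    and holy: "\<And>x. g x holomorphic_on UNIV"
  shows "\<exists>B. \<forall>x y. norm x \<le> 1 \<longrightarrow> norm y \<le> T \<longrightarrow> norm (g x y) \<le> B"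
proof -
  define F where "F M = {y. \<forall>x\<in>cball 0 4. norm (g x y) \<le> real M}" for M :: nat
  have closed: "closed (F M)" for M
  proof -
    have "F M = (\<Inter>x\<in>cball 0 4. {y. norm (g x y) \<le> real M})" by (auto simp: F_def)
    moreover have "closed {y. norm (g x y) \<le> real M}" for x
      by (intro closed_Collect_le continuous_on_norm continuous_on_const
          holomorphic_on_imp_continuous_on holy)
    ultimately show ?thesis by auto
  qed
  have cover: "\<exists>M. y \<in> F M" for y
  proof -
    have "compact ((\<lambda>x. g x y) ` cball 0 4)"
      by (intro compact_continuous_image compact_cball holomorphic_on_imp_continuous_on
          holomorphic_on_subset[OF holx]) auto
    from compact_imp_bounded[OF this]
    obtain B where "\<forall>v\<in>(\<lambda>x. g x y) ` cball 0 4. norm v \<le> B" unfolding bounded_iff by blast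
    then have B: "\<And>x. x \<in> cball 0 4 \<Longrightarrow> norm (g x y) \<le> B" by blast
    then have "norm (g x y) \<le> real (nat \<lceil>B\<rceil>)" if "x \<in> cball 0 4" for x
      using order_trans[OF _ real_nat_ceiling_ge] that by blast
    then show ?thesis unfolding F_def by blast
  qed
  have "\<exists>M. interior (F M) \<noteq> {}"
  proof (rule ccontr)
    assume no: "\<not> (\<exists>M. interior (F M) \<noteq> {})"
    have "(UNIV :: complex set) \<subseteq> closure (\<Inter> (range (\<lambda>M. - F M)))"
    proof (rule Baire)
      fix T assume "T \<in> range (\<lambda>M. - F M)"
      then obtain M where "T = - F M" by blast
      then show "openin (top_of_set UNIV) T \<and> UNIV \<subseteq> closure T"
        using no closed by (auto simp: closure_complement)
    qed auto
    moreover have "\<Inter> (range (\<lambda>M. - F M)) = {}" using cover by auto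
    ultimately show False by (metis UNIV_I closure_empty empty_iff subsetD)
  qed
  then obtain M y0 where "y0 \<in> interior (F M)" by blast
  then obtain d where d: "d > 0" "ball y0 d \<subseteq> F M" by (auto simp: mem_interior)
  let ?B = "ball (0::complex) 4"
  define a where "a n x = (deriv ^^ n) (g x) y0 / fact n" for n x
  have bdg: "norm (g x y) \<le> real M" if "x \<in> ?B" "y \<in> ball y0 d" for x y
    using that d by (auto simp: F_def subset_iff)
  have ahol: "a n holomorphic_on ?B" for n
    unfolding a_def
    by (intro holomorphic_intros bounded_higher_deriv_holomorphic[OF open_ball d(1) bdg])
      (auto intro: holomorphic_on_subset[OF holx] holomorphic_on_subset[OF holy])
  have abd: "norm (a n x) \<le> (real M + 1) * (2 / d) ^ n" if "x \<in> ?B" for n x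
  proof -
    have "norm ((deriv ^^ n) (g x) y0) \<le> fact n * real M / (d / 2) ^ n"
    proof (rule Cauchy_inequality)
      show "norm (g x u) \<le> real M" if "norm (y0 - u) = d / 2" for u
        using bdg[OF \<open>x \<in> ?B\<close>, of u] that d by (simp add: dist_norm)
    qed (use d in \<open>auto intro: holomorphic_on_subset[OF holy] holomorphic_on_imp_continuous_on\<close>)
    then have "norm (a n x) \<le> real M / (d / 2) ^ n"
      by (simp add: a_def norm_divide divide_le_eq mult.commute)
    also have "\<dots> = real M * (2 / d) ^ n" by (simp add: power_divide)
    also have "\<dots> \<le> (real M + 1) * (2 / d) ^ n" using d by (intro mult_right_mono) auto
    finally show ?thesis .
  qed
  have sums: "(\<lambda>n. a n x * (y - y0) ^ n) sums g x y" for x y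
    unfolding a_def
    using holomorphic_power_series[of "g x" y0 "norm (y - y0) + 1" y] holomorphic_on_subset[OF holy]
    by (simp add: dist_norm norm_minus_commute)
  have small: "eventually (\<lambda>n. norm (a n x) * R ^ n \<le> 1) sequentially" if "R > 0" for x R
  proof -
    have "(\<lambda>n. a n x * (of_real R) ^ n) \<longlonglongrightarrow> 0"
      using sums[of x "y0 + of_real R"] by (auto dest!: sums_summable summable_LIMSEQ_zero)
    then have "eventually (\<lambda>n. norm (a n x * (of_real R) ^ n) < 1) sequentially"
      by (auto simp: LIMSEQ_iff eventually_sequentially dest: spec[of _ 1])
    then show ?thesis
      by eventually_elim (use that in \<open>simp add: norm_mult norm_power\<close>)
  qed
  \<comment> \<open>\<open>T'\<close> dominates \<open>norm (y - y0)\<close> whenever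
    \<open>norm y \<le> T\<close>. Coefficients below \<open>(1 / (2 * T')) ^ n\<close> give a tail
    dominated by a geometric series of ratio 1/2; the finitely many earlier terms are bounded by
    \<open>K\<close>.\<close>
  define T' where "T' = \<bar>T\<bar> + norm y0 + 1"
  have T': "T' > 0" by (simp add: T'_def add_nonneg_pos)
  have "eventually (\<lambda>n. \<forall>x. norm x \<le> 1 \<longrightarrow> norm (a n x) \<le> (1 / (2 * T')) ^ n) sequentially"
    by (rule coefficients_uniformly_small[where C = "2 / d" and M = "real M + 1"])
      (use ahol abd small d T' in auto)
  then obtain N where N: "\<And>n x. n \<ge> N \<Longrightarrow> norm x \<le> 1 \<Longrightarrow> norm (a n x) \<le> (1 / (2 * T')) ^ n"
    by (auto simp: eventually_sequentially)
  define K where "K = (\<Sum>n<N. (real M + 1) * (2 / d) ^ n * T' ^ n)"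
  show ?thesis
  proof (intro exI allI impI)
    fix x y :: complex assume x: "norm x \<le> 1" and y: "norm y \<le> T"
    have yT: "norm (y - y0) \<le> T'"
      using norm_triangle_ineq4[of y y0] y by (simp add: T'_def)
    have xB: "x \<in> ?B" using x by simp
    have "norm (suminf (\<lambda>n. a (n + N) x * (y - y0) ^ (n + N))) \<le> suminf (\<lambda>n. (1/2) ^ n)"
    proof (rule norm_suminf_le)
      fix n
      have "norm (a (n + N) x * (y - y0) ^ (n + N)) \<le> (1 / (2 * T')) ^ (n + N) * T' ^ (n + N)"
        unfolding norm_mult norm_power
        by (intro mult_mono N power_mono x yT) (use T' in auto)
      also have "\<dots> = (1/2) ^ (n + N)" using T' by (simp add: power_divide power_mult_distrib)
      also have "\<dots> \<le> (1/2) ^ n" by (intro power_decreasing) auto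
      finally show "norm (a (n + N) x * (y - y0) ^ (n + N)) \<le> (1/2) ^ n" .
    qed (auto intro: summable_geometric)
    moreover have "suminf (\<lambda>n. (1/2::real) ^ n) = 2" by (subst suminf_geometric) auto
    moreover have "norm (\<Sum>n<N. a n x * (y - y0) ^ n) \<le> K"
      unfolding K_def
    proof (rule sum_norm_le)
      fix n assume "n \<in> {..<N}"
      show "norm (a n x * (y - y0) ^ n) \<le> (real M + 1) * (2 / d) ^ n * T' ^ n"
        unfolding norm_mult norm_power
        by (intro mult_mono abd power_mono yT xB) (use d in auto)
    qed
    moreover have eq: "g x y = suminf (\<lambda>n. a (n + N) x * (y - y0) ^ (n + N)) + (\<Sum>n<N. a n x * (y - y0) ^ n)"
      using suminf_split_initial_segment[OF sums_summable[OF sums[of x y]], of N] sums_unique[OF sums[of x y]]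
      by simp
    ultimately show "norm (g x y) \<le> 2 + K"
      unfolding eq
      using norm_triangle_ineq[of "suminf (\<lambda>n. a (n + N) x * (y - y0) ^ (n + N))" "\<Sum>n<N. a n x * (y - y0) ^ n"]
      by linarith
  qed
qed

text \<open>Holomorphy is local, and after a translation in \<open>x\<close> the previous lemma
  gives the bound that \<open>bounded_deriv_holomorphic\<close> needs near any point.\<close>

lemma sep_entire2_deriv_holomorphic:
  fixes g :: "complex \<Rightarrow> complex \<Rightarrow> complex"
  assumes holx: "\<And>y. (\<lambda>x. g x y) holomorphic_on UNIV"
    and holy: "\<And>x. g x holomorphic_on UNIV"
  shows "(\<lambda>x. deriv (g x) y) holomorphic_on UNIV"
proof -
  have "(\<lambda>x. deriv (g x) y) holomorphic_on ball x0 1" for x0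
  proof -
    have "(\<lambda>x. g (x0 + x) y) holomorphic_on UNIV" for y
    proof -
      have "(\<lambda>x. x0 + x) holomorphic_on UNIV" by (intro holomorphic_intros)
      from holomorphic_on_compose_gen[OF this holx[of y]] show ?thesis by (simp add: o_def)
    qed
    then obtain B where B: "\<And>x' y'. norm x' \<le> 1 \<Longrightarrow> norm y' \<le> norm y + 1 \<Longrightarrow> norm (g (x0 + x') y') \<le> B"
      using sep_entire2_locally_bounded_aux[of "\<lambda>x. g (x0 + x)" "norm y + 1"] holy by blast
    show ?thesis
    proof (rule bounded_deriv_holomorphic(1)[where d = 1 and y0 = y and M = B])
      fix x y' assume "x \<in> ball x0 1" "y' \<in> ball y 1"
      then show "norm (g x y') \<le> B"
        using B[of "x - x0" y'] norm_triangle_ineq2[of y' y]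
        by (auto simp: dist_norm norm_minus_commute)
    qed (auto intro: holomorphic_on_subset[OF holx] holomorphic_on_subset[OF holy])
  qed
  then have "(\<lambda>x. deriv (g x) y) field_differentiable at x" for x
    by (meson centre_in_ball holomorphic_on_imp_differentiable_at open_ball zero_less_one)
  then show ?thesis by (simp add: holomorphic_on_def field_differentiable_at_within)
qed

section \<open>Partial derivatives of separately entire functions\<close>

definition pderivative :: "'v \<Rightarrow> (complex ^ 'v \<Rightarrow> complex) \<Rightarrow> complex ^ 'v \<Rightarrow> complex" where
  "pderivative j h x = deriv (\<lambda>t. h (vec_upd x j t)) (x $ j)"

lemma vec_upd_nth: "vec_upd x j t $ k = (if k = j then t else x $ k)"
  by (simp add: vec_upd_def)

lemma vec_upd_self [simp]: "vec_upd x j (x $ j) = x"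
  by (simp add: vec_eq_iff vec_upd_nth)

lemma vec_upd_same [simp]: "vec_upd (vec_upd x j s) j t = vec_upd x j t"
  by (simp add: vec_eq_iff vec_upd_nth)

lemma vec_upd_commute: "j \<noteq> k \<Longrightarrow> vec_upd (vec_upd x j s) k t = vec_upd (vec_upd x k t) j s"
  by (simp add: vec_eq_iff vec_upd_nth)

text \<open>In the variable \<open>j\<close> itself this is one-variable calculus. For another
  variable all remaining coordinates are frozen and the two-variable result applies.\<close>

lemma sep_entire_pderivative:
  assumes "sep_entire g"
  shows "sep_entire (pderivative j g)"
  unfolding sep_entire_def
proof (intro allI)
  fix x k
  have hol: "(\<lambda>t. g (vec_upd x j t)) holomorphic_on UNIV" for x j
    using assms by (auto simp: sep_entire_def)
  show "(\<lambda>t. pderivative j g (vec_upd x k t)) holomorphic_on UNIV"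
  proof (cases "k = j")
    case True
    then show ?thesis
      using holomorphic_deriv[OF hol[of x j] open_UNIV] by (simp add: pderivative_def vec_upd_nth)
  next
    case False
    have "(\<lambda>t. deriv (\<lambda>s. g (vec_upd (vec_upd x k t) j s)) (x $ j)) holomorphic_on UNIV"
    proof (rule sep_entire2_deriv_holomorphic)
      show "(\<lambda>t. g (vec_upd (vec_upd x k t) j y)) holomorphic_on UNIV" for y
        using hol[of "vec_upd x j y" k] vec_upd_commute[OF False[symmetric], of x y] by simp
    qed (rule hol)
    then show ?thesis using False by (simp add: pderivative_def vec_upd_nth)
  qed
qed

section \<open>Polynomial functions and generic points\<close>

text \<open>Polynomials over the ring generated by \<open>S\<close>, taken as functions so that
  evaluation and substitution need no calculus of coefficients. The constant -1 gives closure under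
  subtraction.\<close>

inductive_set polyfun :: "complex set \<Rightarrow> (complex ^ 'v \<Rightarrow> complex) set" for S where
  const: "c \<in> S \<Longrightarrow> (\<lambda>_. c) \<in> polyfun S"
| minus_one: "(\<lambda>_. - 1) \<in> polyfun S"
| coord: "(\<lambda>x. x $ j) \<in> polyfun S"
| add: "h \<in> polyfun S \<Longrightarrow> k \<in> polyfun S \<Longrightarrow> (\<lambda>x. h x + k x) \<in> polyfun S"
| mult: "h \<in> polyfun S \<Longrightarrow> k \<in> polyfun S \<Longrightarrow> (\<lambda>x. h x * k x) \<in> polyfun S"

lemma polyfun_one: "(\<lambda>_. 1) \<in> polyfun S"
  using polyfun.mult[OF polyfun.minus_one polyfun.minus_one] by simp

lemma polyfun_zero: "(\<lambda>_. 0) \<in> polyfun S"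
  using polyfun.add[OF polyfun.minus_one polyfun_one] by simp

lemma polyfun_diff: "h \<in> polyfun S \<Longrightarrow> k \<in> polyfun S \<Longrightarrow> (\<lambda>x. h x - k x) \<in> polyfun S"
  using polyfun.add[OF _ polyfun.mult[OF polyfun.minus_one], of h S k] by simp

lemma polyfun_sum:
  "(\<And>i. i \<in> I \<Longrightarrow> h i \<in> polyfun S) \<Longrightarrow> (\<lambda>x. \<Sum>i\<in>I. h i x) \<in> polyfun S"
  by (induction I rule: infinite_finite_induct) (auto intro: polyfun_zero polyfun.add)

lemma polyfun_prod:
  "(\<And>i. i \<in> I \<Longrightarrow> h i \<in> polyfun S) \<Longrightarrow> (\<lambda>x. \<Prod>i\<in>I. h i x) \<in> polyfun S"
  by (induction I rule: infinite_finite_induct) (auto intro: polyfun_one polyfun.mult)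

lemma polyfun_power: "h \<in> polyfun S \<Longrightarrow> (\<lambda>x. h x ^ n) \<in> polyfun S"
  by (induction n) (auto intro: polyfun_one polyfun.mult)

lemma polyfun_mono:
  assumes "h \<in> polyfun S" "S \<subseteq> T"
  shows "h \<in> polyfun T"
  using assms(1)
  by induction (use assms(2) in \<open>auto intro: polyfun.intros\<close>)

lemma polyfun_compose:
  assumes "h \<in> polyfun S" and u: "\<And>j. (\<lambda>x. u x $ j) \<in> polyfun S"
  shows "(\<lambda>x. h (u x)) \<in> polyfun S"
  using assms(1) by induction (auto intro: polyfun.intros u)

text \<open>Syntax trees for polynomial functions, with constants named by their position in an
  enumeration of \<open>S\<close>; there are countably many.\<close>

datatype 'v pexp = PConst nat | PMinus | PVar 'v | PAdd "'v pexp" "'v pexp" | PMult "'v pexp" "'v pexp"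

instance pexp :: (countable) countable
  by countable_datatype

primrec peval :: "complex set \<Rightarrow> 'v pexp \<Rightarrow> complex ^ 'v \<Rightarrow> complex" where
  "peval S (PConst n) x = from_nat_into S n"
| "peval S PMinus x = - 1"
| "peval S (PVar j) x = x $ j"
| "peval S (PAdd a b) x = peval S a x + peval S b x"
| "peval S (PMult a b) x = peval S a x * peval S b x"

lemma countable_polyfun:
  assumes "countable S"
  shows "countable (polyfun S :: (complex ^ 'v::finite \<Rightarrow> complex) set)"
proof -
  have "h \<in> range (peval S)" if "h \<in> polyfun S" for h :: "complex ^ 'v \<Rightarrow> complex"
    using that
  proof induction
    case (const c)
    then have "from_nat_into S (to_nat_on S c) = c" using assms by simp
    then show ?case by (intro range_eqI[of _ _ "PConst (to_nat_on S c)"]) auto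
  next
    case minus_one
    show ?case by (intro range_eqI[of _ _ PMinus]) auto
  next
    case (coord j)
    show ?case by (intro range_eqI[of _ _ "PVar j"]) auto
  next
    case (add h k)
    then obtain a b where "h = peval S a" "k = peval S b" by blast
    then show ?case by (intro range_eqI[of _ _ "PAdd a b"]) auto
  next
    case (mult h k)
    then obtain a b where "h = peval S a" "k = peval S b" by blast
    then show ?case by (intro range_eqI[of _ _ "PMult a b"]) auto
  qed
  then have "polyfun S \<subseteq> range (peval S :: 'v pexp \<Rightarrow> _)" by blast
  then show ?thesis by (rule countable_subset) simp
qed

lemma sep_entire_const: "sep_entire (\<lambda>_. c)"
  and sep_entire_coord: "sep_entire (\<lambda>x :: complex ^ 'a. x $ j)"
  and sep_entire_add: "sep_entire g \<Longrightarrow> sep_entire h \<Longrightarrow> sep_entire (\<lambda>x. g x + h x)"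
  and sep_entire_diff: "sep_entire g \<Longrightarrow> sep_entire h \<Longrightarrow> sep_entire (\<lambda>x. g x - h x)"
  and sep_entire_mult: "sep_entire g \<Longrightarrow> sep_entire h \<Longrightarrow> sep_entire (\<lambda>x. g x * h x)"
proof -
  have "(\<lambda>t. vec_upd x k t $ j) holomorphic_on UNIV" for x :: "complex ^ 'a" and k
    by (cases "j = k") (auto simp: vec_upd_nth intro: holomorphic_intros)
  then show "sep_entire (\<lambda>x. x $ j)" by (simp add: sep_entire_def)
qed (auto simp: sep_entire_def intro!: holomorphic_intros)

lemma sep_entire_sum: "(\<And>i. i \<in> I \<Longrightarrow> sep_entire (g i)) \<Longrightarrow> sep_entire (\<lambda>x. \<Sum>i\<in>I. g i x)"
  by (induction I rule: infinite_finite_induct) (auto intro: sep_entire_const sep_entire_add)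

lemma sep_entire_prod: "(\<And>i. i \<in> I \<Longrightarrow> sep_entire (g i)) \<Longrightarrow> sep_entire (\<lambda>x. \<Prod>i\<in>I. g i x)"
  by (induction I rule: infinite_finite_induct) (auto intro: sep_entire_const sep_entire_mult)

lemma sep_entire_power: "sep_entire g \<Longrightarrow> sep_entire (\<lambda>x. g x ^ n)"
  by (induction n) (auto intro: sep_entire_const sep_entire_mult)

lemma polyfun_sep_entire: "h \<in> polyfun S \<Longrightarrow> sep_entire h"
  by (induction rule: polyfun.induct)
    (auto intro: sep_entire_const sep_entire_coord sep_entire_add sep_entire_mult)

lemma sep_entire_has_pderivative:
  assumes "sep_entire h"
  shows "((\<lambda>t. h (vec_upd x j t)) has_field_derivative pderivative j h x) (at (x $ j))"
  using assms unfolding sep_entire_def pderivative_def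
  by (metis UNIV_I holomorphic_derivI open_UNIV)

lemma pderivative_const: "pderivative j (\<lambda>_. c) x = 0"
  by (simp add: pderivative_def)

lemma pderivative_coord: "pderivative j (\<lambda>x. x $ k) x = (if k = j then 1 else 0)"
  by (simp add: pderivative_def vec_upd_nth)

lemma pderivative_add:
  "sep_entire g \<Longrightarrow> sep_entire h \<Longrightarrow>
    pderivative j (\<lambda>x. g x + h x) x = pderivative j g x + pderivative j h x"
  unfolding pderivative_def
  by (rule DERIV_imp_deriv) (auto intro!: derivative_eq_intros sep_entire_has_pderivative simp: pderivative_def[symmetric])

lemma pderivative_mult:
  "sep_entire g \<Longrightarrow> sep_entire h \<Longrightarrow>
    pderivative j (\<lambda>x. g x * h x) x = g x * pderivative j h x + pderivative j g x * h x"
  unfolding pderivative_def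
  by (rule DERIV_imp_deriv)
    (auto intro!: derivative_eq_intros sep_entire_has_pderivative simp: pderivative_def[symmetric])

lemma polyfun_pderivative: "h \<in> polyfun S \<Longrightarrow> pderivative j h \<in> polyfun S"
proof (induction rule: polyfun.induct)
  case (coord k)
  show ?case using polyfun_zero polyfun_one
    by (cases "k = j") (simp_all add: pderivative_coord[abs_def])
next
  case (add h k)
  then have "pderivative j (\<lambda>x. h x + k x) = (\<lambda>x. pderivative j h x + pderivative j k x)"
    by (auto simp: pderivative_add polyfun_sep_entire)
  with add show ?case by (auto intro: polyfun.add)
next
  case (mult h k)
  then have "pderivative j (\<lambda>x. h x * k x) = (\<lambda>x. h x * pderivative j k x + pderivative j h x * k x)"
    by (auto simp: pderivative_mult polyfun_sep_entire)
  with mult show ?case by (auto intro: polyfun.add polyfun.mult)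
qed (simp_all add: pderivative_const[abs_def] polyfun_zero)

section \<open>Derivations and generic points\<close>

lemma derivation_props:
  assumes "derivation D"
  shows "D 0 = (0::'a::field)" "D 1 = 0" "D (- 1) = 0"
    "D (x + y) = D x + D y" "D (x * y) = x * D y + D x * y" "D (- x) = - D x" "D (x - y) = D x - D y"
proof -
  show add: "D (x + y) = D x + D y" and mult: "D (x * y) = x * D y + D x * y" for x y
    using assms by (auto simp: derivation_def)
  show 0: "D 0 = 0" using add[of 0 0] by (metis add.right_neutral add_left_cancel)
  show 1: "D 1 = 0" using mult[of 1 1] by (metis add.right_neutral add_left_cancel mult_1 mult_1_right)
  show "D (- 1) = 0" using add[of 1 "- 1"] 0 1 by simp
  show neg: "D (- x) = - D x" for x using add[of x "- x"] 0 by (simp add: minus_unique)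
  show "D (x - y) = D x - D y" using add[of x "- y"] neg[of y] by simp
qed

lemma derivation_sum:
  assumes "derivation (D :: 'a::field \<Rightarrow> 'a)"
  shows "D (\<Sum>i\<in>I. f i) = (\<Sum>i\<in>I. D (f i))"
  by (induction I rule: infinite_finite_induct) (auto simp: derivation_props[OF assms])

lemma derivation_polyfun:
  fixes h :: "complex ^ 'v::finite \<Rightarrow> complex"
  assumes "h \<in> polyfun S" and D: "derivation D" and S: "\<forall>c\<in>S. D c = 0"
  shows "D (h x) = (\<Sum>j\<in>UNIV. pderivative j h x * D (x $ j))"
  using assms(1)
proof induction
  case (add h k)
  then show ?case
    by (simp add: derivation_props[OF D] pderivative_add polyfun_sep_entire distrib_right sum.distrib)
next
  case (mult h k)
  then show ?case
    by (simp add: derivation_props[OF D] pderivative_mult polyfun_sep_entire distrib_right sum.distrib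
        sum_distrib_left sum_distrib_right distrib_left mult_ac)
qed (auto simp: S derivation_props[OF D] pderivative_const pderivative_coord if_distrib[of "\<lambda>x. x * _"] cong: if_cong)

definition generic :: "complex set \<Rightarrow> complex ^ 'v \<Rightarrow> bool" where
  "generic S X \<longleftrightarrow> (\<forall>h\<in>polyfun S. h X = 0 \<longrightarrow> (\<forall>Z. h Z = 0))"

text \<open>At a generic point a polynomial function is determined by its value, so
  \<open>h X \<mapsto> pderivative v h X\<close> is a well-defined derivation on the ring generated
  by \<open>S\<close> and the coordinates of \<open>X\<close>. It extends to all complex
  numbers.\<close>

lemma generic_derivation:
  fixes X :: "complex ^ 'v::finite"
  assumes gen: "generic S X"
  obtains D where "derivation D" "\<forall>c\<in>S. D c = 0"
    "\<And>w. D (X $ w) = (if w = v then 1 else 0)"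
proof -
  define G where "G = (\<lambda>h. Dual (h X) (pderivative v h X)) ` polyfun S"
  have G: "Dual a b \<in> G" if "h \<in> polyfun S" "a = h X" "b = pderivative v h X" for h a b
    using that by (auto simp: G_def)
  have "derivation_graph G"
    unfolding derivation_graph_def dual_subring_def
  proof (intro conjI ballI impI)
    show "1 \<in> G" unfolding one_dual_def
      by (rule G[OF polyfun_one]) (auto simp: pderivative_const)
    fix x y assume "x \<in> G" "y \<in> G"
    then obtain h k where hk: "h \<in> polyfun S" "k \<in> polyfun S"
      "x = Dual (h X) (pderivative v h X)" "y = Dual (k X) (pderivative v k X)"
      by (auto simp: G_def)
    show "x * y \<in> G" unfolding times_dual_def
      by (rule G[OF polyfun.mult[OF hk(1,2)]]) (auto simp: hk pderivative_mult[OF polyfun_sep_entire[OF hk(1)] polyfun_sep_entire[OF hk(2)]])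
    have "pderivative v (\<lambda>x. h x - k x) X = pderivative v h X - pderivative v k X"
      using pderivative_add[of h "\<lambda>x. - 1 * k x" v X] pderivative_mult[of "\<lambda>_. - 1" k v X] hk
        polyfun_sep_entire[OF polyfun.mult[OF polyfun.minus_one hk(2)]]
      by (simp add: polyfun_sep_entire pderivative_const sep_entire_const)
    then show "x - y \<in> G" unfolding minus_dual_def
      by (intro G[OF polyfun_diff[OF hk(1,2)]]) (auto simp: hk)
  next
    fix x assume "x \<in> G" "re x = 0"
    then obtain h where h: "h \<in> polyfun S" "x = Dual (h X) (pderivative v h X)" "h X = 0"
      by (auto simp: G_def)
    then have "h = (\<lambda>_. 0)" using gen by (auto simp: generic_def)
    then show "ep x = 0" using h by (simp add: pderivative_const)
  qed
  then obtain D where D: "derivation D" "\<And>x. x \<in> G \<Longrightarrow> D (re x) = ep x"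
    using extend_derivation by blast
  show ?thesis
  proof
    show "derivation D" by fact
    show "\<forall>c\<in>S. D c = 0"
      using D(2)[OF G[OF polyfun.const refl refl]] by (simp add: pderivative_const)
    show "D (X $ w) = (if w = v then 1 else 0)" for w
      using D(2)[OF G[OF polyfun.coord refl refl], of w] by (simp add: pderivative_coord)
  qed
qed

section \<open>Linear algebra over rings of functions\<close>

text \<open>Bilinear, without conjugation, so that polynomial arguments give polynomial
  values.\<close>

definition bdot :: "complex ^ 'n \<Rightarrow> complex ^ 'n \<Rightarrow> complex" where
  "bdot \<phi> v = (\<Sum>a\<in>UNIV. \<phi> $ a * v $ a)"

lemma bdot_simps:
  "bdot \<phi> (v + w) = bdot \<phi> v + bdot \<phi> w"
  "bdot \<phi> (v - w) = bdot \<phi> v - bdot \<phi> w"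
  "bdot \<phi> (c *s v) = c * bdot \<phi> v"
  "bdot \<phi> 0 = 0"
  by (simp_all add: bdot_def algebra_simps sum.distrib sum_subtractf sum_distrib_left)

lemma bdot_span_eq_0:
  assumes "v \<in> vec.span W" "\<And>w. w \<in> W \<Longrightarrow> bdot \<phi> w = 0"
  shows "bdot \<phi> v = 0"
  using assms(1) by (induction rule: vec.span_induct_alt) (auto simp: bdot_simps assms(2))

lemma generic_neq_0: "generic S X \<Longrightarrow> h \<in> polyfun S \<Longrightarrow> h Z \<noteq> 0 \<Longrightarrow> h X \<noteq> 0"
  by (auto simp: generic_def)

text \<open>Abstract because two rings occur: all of \<open>polyfun S\<close>, and the polynomial
  functions that are constant along certain changes of the point.\<close>

definition fun_ring :: "('z \<Rightarrow> complex) set \<Rightarrow> bool" where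
  "fun_ring R \<longleftrightarrow> (\<lambda>_. 0) \<in> R \<and> (\<lambda>_. 1) \<in> R \<and>
     (\<forall>h\<in>R. \<forall>k\<in>R. (\<lambda>z. h z + k z) \<in> R \<and> (\<lambda>z. h z - k z) \<in> R \<and> (\<lambda>z. h z * k z) \<in> R)"

lemma fun_ring_sum:
  "fun_ring R \<Longrightarrow> (\<And>i. i \<in> I \<Longrightarrow> h i \<in> R) \<Longrightarrow> (\<lambda>z. \<Sum>i\<in>I. h i z) \<in> R"
  by (induction I rule: infinite_finite_induct) (auto simp: fun_ring_def)

lemma fun_ring_bdot:
  assumes "fun_ring R" "\<And>a. (\<lambda>z. \<phi> z $ a) \<in> R" "\<And>a. (\<lambda>z. w z $ a) \<in> R"
  shows "(\<lambda>z. bdot (\<phi> z) (w z)) \<in> R"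
  unfolding bdot_def using assms by (intro fun_ring_sum) (auto simp: fun_ring_def)

lemma fun_ring_polyfun: "fun_ring (polyfun S)"
  by (auto simp: fun_ring_def intro: polyfun_zero polyfun_one polyfun.intros polyfun_diff)

text \<open>Elimination without division: the annihilating functional is built from the vectors themselves,
  so it stays in the ring \<open>R\<close> and annihilates them at every point.\<close>

lemma annihilator:
  fixes w :: "'i \<Rightarrow> 'z \<Rightarrow> complex ^ 'n"
  assumes R: "fun_ring R"
    and "finite I" "inj_on (\<lambda>i. w i x0) I" "vec.independent ((\<lambda>i. w i x0) ` I)"
    and "\<And>i a. i \<in> I \<Longrightarrow> (\<lambda>z. w i z $ a) \<in> R"
    and "v \<notin> vec.span ((\<lambda>i. w i x0) ` I)"
  shows "\<exists>\<phi>. (\<forall>a. (\<lambda>z. \<phi> z $ a) \<in> R) \<and> (\<forall>i\<in>I. \<forall>z. bdot (\<phi> z) (w i z) = 0) \<and> bdot (\<phi> x0) v \<noteq> 0"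
  using assms(2-)
proof (induction I arbitrary: v rule: finite_induct)
  case empty
  then have "v \<noteq> 0" by auto
  then obtain a where a: "v $ a \<noteq> 0" by (auto simp: vec_eq_iff)
  have "(\<lambda>z. axis a (1::complex) $ b) \<in> R" for b
    using R by (auto simp: axis_def fun_ring_def)
  moreover have "bdot (axis a 1) v = v $ a"
    by (simp add: bdot_def axis_def if_distrib[of "\<lambda>x. x * _"] cong: if_cong)
  ultimately show ?case using a by (intro exI[of _ "\<lambda>_. axis a 1"]) auto
next
  case (insert k I)
  let ?W = "(\<lambda>i. w i x0) ` I"
  have inj: "inj_on (\<lambda>i. w i x0) I" and notin: "w k x0 \<notin> ?W"
    using insert.prems(1) insert.hyps(2) by auto
  have ind: "vec.independent ?W" and k: "w k x0 \<notin> vec.span ?W"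
    using insert.prems(2) notin by (auto simp: vec.independent_insert)
  have IH: "\<exists>\<phi>. (\<forall>a. (\<lambda>z. \<phi> z $ a) \<in> R) \<and> (\<forall>i\<in>I. \<forall>z. bdot (\<phi> z) (w i z) = 0) \<and> bdot (\<phi> x0) u \<noteq> 0"
    if "u \<notin> vec.span ?W" for u
    by (rule insert.IH[OF inj ind _ that]) (use insert.prems(3) in simp)
  obtain \<psi> where \<psi>: "\<And>a. (\<lambda>z. \<psi> z $ a) \<in> R" "\<And>i z. i \<in> I \<Longrightarrow> bdot (\<psi> z) (w i z) = 0"
    "bdot (\<psi> x0) (w k x0) \<noteq> 0"
    using IH[OF k] by blast
  define t where "t = bdot (\<psi> x0) v / bdot (\<psi> x0) (w k x0)"
  have "v - t *s w k x0 \<notin> vec.span ?W"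
    using insert.prems(4) by (auto simp: vec.span_insert)
  then obtain \<phi>0 where \<phi>0: "\<And>a. (\<lambda>z. \<phi>0 z $ a) \<in> R" "\<And>i z. i \<in> I \<Longrightarrow> bdot (\<phi>0 z) (w i z) = 0"
    "bdot (\<phi>0 x0) (v - t *s w k x0) \<noteq> 0"
    using IH by blast
  \<comment> \<open>Cross-multiplication kills \<open>w k\<close> by antisymmetry and preserves the
    zeros on \<open>I\<close>. Its value on \<open>v\<close> at \<open>x0\<close> is
    \<open>bdot (\<psi> x0) (w k x0)\<close> times that of \<open>\<phi>0 x0\<close> on
    \<open>v - t *s w k x0\<close>, which explains \<open>t\<close>.\<close>
  define \<phi> where "\<phi> z = (\<chi> a. bdot (\<psi> z) (w k z) * \<phi>0 z $ a - bdot (\<phi>0 z) (w k z) * \<psi> z $ a)" for z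
  have \<phi>: "bdot (\<phi> z) u = bdot (\<psi> z) (w k z) * bdot (\<phi>0 z) u - bdot (\<phi>0 z) (w k z) * bdot (\<psi> z) u" for z u
    by (simp add: \<phi>_def bdot_def[of _ u] left_diff_distrib sum_subtractf sum_distrib_left mult.assoc)
  have "(\<lambda>z. bdot (\<psi> z) (w k z)) \<in> R" "(\<lambda>z. bdot (\<phi>0 z) (w k z)) \<in> R"
    by (rule fun_ring_bdot[OF R]; use \<psi>(1) \<phi>0(1) insert.prems(3) in simp)+
  then have "(\<lambda>z. \<phi> z $ a) \<in> R" for a
    using R \<psi>(1)[of a] \<phi>0(1)[of a] by (simp add: \<phi>_def fun_ring_def)
  moreover have "bdot (\<phi> z) (w i z) = 0" if "i \<in> insert k I" for i z
    using that \<psi>(2) \<phi>0(2) by (auto simp: \<phi>)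
  moreover have "bdot (\<phi> x0) v \<noteq> 0"
    using \<phi>0(3) \<psi>(3) by (simp add: \<phi> bdot_simps t_def field_simps)
  ultimately show ?case by blast
qed

lemma independent_subfamily:
  fixes w :: "'i \<Rightarrow> complex ^ 'n"
  assumes "finite I"
  obtains J where "J \<subseteq> I" "inj_on w J" "vec.independent (w ` J)" "vec.span (w ` J) = vec.span (w ` I)"
    "card J = vec.dim (w ` I)"
proof -
  obtain B where B: "B \<subseteq> w ` I" "vec.independent B" "w ` I \<subseteq> vec.span B" "card B = vec.dim (w ` I)"
    by (rule vec.basis_exists)
  obtain J where J: "J \<subseteq> I" "inj_on w J" "w ` J = B"
    using B(1) by (metis subset_image_inj)
  show ?thesis
  proof
    show "vec.span (w ` J) = vec.span (w ` I)"
      using B J by (metis vec.span_eq vec.span_superset subset_trans)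
    show "card J = vec.dim (w ` I)" using B(4) J by (metis card_image)
  qed (use B J in auto)
qed

text \<open>Independence at \<open>x0\<close> is certified by polynomial functionals, each killing
  all chosen vectors but one at every point and not killing that one at \<open>x0\<close>. A
  polynomial function nonzero at \<open>x0\<close> is nonzero at the generic point too.\<close>

lemma dim_le_generic:
  fixes w :: "'i \<Rightarrow> complex ^ 'v \<Rightarrow> complex ^ 'n"
  assumes I: "finite I" and w: "\<And>i a. i \<in> I \<Longrightarrow> (\<lambda>z. w i z $ a) \<in> polyfun S" and X: "generic S X"
  shows "vec.dim ((\<lambda>i. w i x0) ` I) \<le> vec.dim ((\<lambda>i. w i X) ` I)"
proof -
  obtain J where J: "J \<subseteq> I" "inj_on (\<lambda>i. w i x0) J" "vec.independent ((\<lambda>i. w i x0) ` J)"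
    "card J = vec.dim ((\<lambda>i. w i x0) ` I)"
    by (rule independent_subfamily[OF I, of "\<lambda>i. w i x0"])
  have finJ: "finite J" using J(1) I finite_subset by blast
  have indep: "w i X \<notin> vec.span ((\<lambda>i. w i X) ` (J - {i}))" if i: "i \<in> J" for i
  proof
    assume mem: "w i X \<in> vec.span ((\<lambda>i. w i X) ` (J - {i}))"
    have inj: "inj_on (\<lambda>i. w i x0) (J - {i})"
      and ind: "vec.independent ((\<lambda>i. w i x0) ` (J - {i}))"
      by (rule inj_on_subset[OF J(2)], blast) (rule vec.independent_mono[OF J(3)], blast)
    have "(\<lambda>i. w i x0) ` (J - {i}) = (\<lambda>i. w i x0) ` J - {w i x0}"
      using J(2) i by (auto simp: inj_on_def)
    then have "w i x0 \<notin> vec.span ((\<lambda>i. w i x0) ` (J - {i}))"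
      using J(3) i by (auto simp: vec.dependent_def)
    then have "\<exists>\<phi>. (\<forall>a. (\<lambda>z. \<phi> z $ a) \<in> polyfun S) \<and> (\<forall>k\<in>J - {i}. \<forall>z. bdot (\<phi> z) (w k z) = 0) \<and>
        bdot (\<phi> x0) (w i x0) \<noteq> 0"
      by (intro annihilator[where w = w, OF fun_ring_polyfun _ inj ind]) (use w J(1) finJ in auto)
    then obtain \<phi> where \<phi>: "\<And>a. (\<lambda>z. \<phi> z $ a) \<in> polyfun S"
      "\<And>k z. k \<in> J - {i} \<Longrightarrow> bdot (\<phi> z) (w k z) = 0" "bdot (\<phi> x0) (w i x0) \<noteq> 0"
      by blast
    have "(\<lambda>z. bdot (\<phi> z) (w i z)) \<in> polyfun S"
      by (rule fun_ring_bdot[OF fun_ring_polyfun \<phi>(1)]) (use w i J(1) in auto)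
    from generic_neq_0[OF X this \<phi>(3)] have "bdot (\<phi> X) (w i X) \<noteq> 0" .
    moreover have "bdot (\<phi> X) (w i X) = 0"
      by (rule bdot_span_eq_0[OF mem]) (use \<phi>(2) in blast)
    ultimately show False by simp
  qed
  have injX: "inj_on (\<lambda>i. w i X) J"
  proof (rule inj_onI)
    fix i k assume ik: "i \<in> J" "k \<in> J" "w i X = w k X"
    show "i = k"
    proof (rule ccontr)
      assume "i \<noteq> k"
      then have "w i X \<in> vec.span ((\<lambda>i. w i X) ` (J - {i}))"
        using ik by (intro vec.span_base) auto
      with indep ik show False by blast
    qed
  qed
  have indX: "vec.independent ((\<lambda>i. w i X) ` J)"
    unfolding vec.dependent_def
  proof
    assume "\<exists>a\<in>(\<lambda>i. w i X) ` J. a \<in> vec.span ((\<lambda>i. w i X) ` J - {a})"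
    then obtain i where i: "i \<in> J" "w i X \<in> vec.span ((\<lambda>i. w i X) ` J - {w i X})" by auto
    have "(\<lambda>i. w i X) ` J - {w i X} \<subseteq> (\<lambda>i. w i X) ` (J - {i})" by auto
    with i indep vec.span_mono show False by blast
  qed
  have "vec.dim ((\<lambda>i. w i x0) ` I) = card ((\<lambda>i. w i X) ` J)" using J(4) injX by (simp add: card_image)
  also have "\<dots> = vec.dim ((\<lambda>i. w i X) ` J)" using indX by (simp add: vec.dim_eq_card_independent)
  also have "\<dots> \<le> vec.dim ((\<lambda>i. w i X) ` I)" using J(1) by (intro vec.dim_subset) auto
  finally show ?thesis .
qed

text \<open>\<open>annihilator\<close> is applied over the ring of polynomial functions whose values
  on \<open>\<Z>\<close> agree with the value at \<open>X\<close>. The functional thus stays fixed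
  when a block of \<open>X\<close> on which the \<open>w i\<close> do not depend is moved.\<close>

lemma generic_annihilator:
  fixes w :: "'i \<Rightarrow> complex ^ 'v \<Rightarrow> complex ^ 'n"
  assumes I: "finite I" and w: "\<And>i a. i \<in> I \<Longrightarrow> (\<lambda>z. w i z $ a) \<in> polyfun S"
    and eq: "\<And>i Z. i \<in> I \<Longrightarrow> Z \<in> \<Z> \<Longrightarrow> w i Z = w i X"
    and v: "v \<notin> vec.span ((\<lambda>i. w i X) ` I)"
  obtains \<phi> where "\<And>a. (\<lambda>z. \<phi> z $ a) \<in> polyfun S" "\<And>Z. Z \<in> \<Z> \<Longrightarrow> \<phi> Z = \<phi> X"
    "\<And>u. u \<in> vec.span ((\<lambda>i. w i X) ` I) \<Longrightarrow> bdot (\<phi> X) u = 0" "bdot (\<phi> X) v \<noteq> 0"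
proof -
  let ?R = "{h \<in> polyfun S. \<forall>Z\<in>\<Z>. h Z = h X}"
  have R: "fun_ring ?R"
    using fun_ring_polyfun[of S] by (auto simp: fun_ring_def)
  obtain J where J: "J \<subseteq> I" "inj_on (\<lambda>i. w i X) J" "vec.independent ((\<lambda>i. w i X) ` J)"
    "vec.span ((\<lambda>i. w i X) ` J) = vec.span ((\<lambda>i. w i X) ` I)"
    by (rule independent_subfamily[OF I, of "\<lambda>i. w i X"])
  have "\<exists>\<phi>. (\<forall>a. (\<lambda>z. \<phi> z $ a) \<in> ?R) \<and> (\<forall>i\<in>J. \<forall>z. bdot (\<phi> z) (w i z) = 0) \<and> bdot (\<phi> X) v \<noteq> 0"
  proof (rule annihilator[where w = w, OF R _ J(2,3)])
    show "finite J" using J(1) I finite_subset by blast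
    show "(\<lambda>z. w i z $ a) \<in> ?R" if "i \<in> J" for i a
      using w eq that J(1) by auto
    show "v \<notin> vec.span ((\<lambda>i. w i X) ` J)" using v J(4) by simp
  qed
  then obtain \<phi> where \<phi>: "\<And>a. (\<lambda>z. \<phi> z $ a) \<in> ?R" "\<And>i z. i \<in> J \<Longrightarrow> bdot (\<phi> z) (w i z) = 0"
    "bdot (\<phi> X) v \<noteq> 0" by blast
  show ?thesis
  proof
    show "(\<lambda>z. \<phi> z $ a) \<in> polyfun S" for a using \<phi>(1) by blast
    show "\<phi> Z = \<phi> X" if "Z \<in> \<Z>" for Z using \<phi>(1) that by (auto simp: vec_eq_iff)
    show "bdot (\<phi> X) u = 0" if "u \<in> vec.span ((\<lambda>i. w i X) ` I)" for u
      by (rule bdot_span_eq_0[of u "(\<lambda>i. w i X) ` J"]) (use that \<phi>(2) J(4) in auto)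
  qed fact
qed

section \<open>Chain rule along lines and Wronskians\<close>

lemma polyfun_chain:
  fixes h :: "complex ^ 'v::finite \<Rightarrow> complex"
  assumes "h \<in> polyfun S" and c: "\<And>j. ((\<lambda>s. c s $ j) has_field_derivative c' j) (at s)"
  shows "((\<lambda>s. h (c s)) has_field_derivative (\<Sum>j\<in>UNIV. pderivative j h (c s) * c' j)) (at s)"
  using assms(1)
proof induction
  case (coord k)
  show ?case
    using c[of k] by (simp add: pderivative_coord if_distrib[of "\<lambda>x. x * _"] cong: if_cong)
next
  case (add h k)
  then show ?case
    by (auto intro!: derivative_eq_intros simp: pderivative_add polyfun_sep_entire distrib_right sum.distrib)
next
  case (mult h k)
  then show ?case
    by (auto intro!: derivative_eq_intros simp: pderivative_mult polyfun_sep_entire distrib_right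
        sum.distrib sum_distrib_left sum_distrib_right distrib_left mult_ac)
qed (auto intro!: derivative_eq_intros simp: pderivative_const)

lemma polyfun_line_derivative:
  fixes h :: "complex ^ 'v::finite \<Rightarrow> complex"
  assumes "h \<in> polyfun S"
  shows "((\<lambda>s. h (a + s *s b)) has_field_derivative (\<Sum>j\<in>UNIV. pderivative j h (a + s *s b) * b $ j)) (at s)"
  by (rule polyfun_chain[OF assms]) (auto intro!: derivative_eq_intros)

text \<open>On the line from \<open>x\<close> to \<open>x'\<close> the quotient of \<open>v\<close>
  by \<open>u\<close> has derivative zero near \<open>x\<close>, so \<open>v\<close> is a constant
  multiple of \<open>u\<close> there, and on the whole line by the identity theorem.\<close>

lemma wronskian_eq_0:
  fixes u v :: "complex ^ 'v::finite \<Rightarrow> complex"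
  assumes u: "u \<in> polyfun S" and v: "v \<in> polyfun S"
    and W: "\<And>j y. u y * pderivative j v y = v y * pderivative j u y"
    and nz: "u x \<noteq> 0"
  shows "v x' * u x = u x' * v x"
proof -
  define U where "U s = u (x + s *s (x' - x))" for s
  define V where "V s = v (x + s *s (x' - x))" for s
  define U' where "U' s = (\<Sum>j\<in>UNIV. pderivative j u (x + s *s (x' - x)) * (x' - x) $ j)" for s
  define V' where "V' s = (\<Sum>j\<in>UNIV. pderivative j v (x + s *s (x' - x)) * (x' - x) $ j)" for s
  have dU: "(U has_field_derivative U' s) (at s)" and dV: "(V has_field_derivative V' s) (at s)" for s
    unfolding U_def[abs_def] V_def[abs_def] U'_def V'_def
    by (rule polyfun_line_derivative u v)+
  have UV: "U s * V' s = V s * U' s" for s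
    unfolding U_def V_def U'_def V'_def sum_distrib_left
    by (simp add: W mult.assoc[symmetric] flip: U_def V_def)
  have hol: "U holomorphic_on UNIV" "V holomorphic_on UNIV"
    using dU dV by (auto simp: holomorphic_on_open)
  have "continuous (at 0) U" using dU DERIV_isCont by blast
  moreover have U0: "U 0 \<noteq> 0" using nz by (simp add: U_def)
  ultimately obtain e where e: "e > 0" "\<And>s. dist 0 s < e \<Longrightarrow> U s \<noteq> 0"
    using continuous_at_avoid[of 0 U 0] by metis
  have "\<exists>c. \<forall>s\<in>ball 0 e. V s / U s = c"
  proof (rule has_field_derivative_zero_constant[OF convex_ball])
    fix s :: complex assume "s \<in> ball 0 e"
    then have "U s \<noteq> 0" using e by simp
    then have "((\<lambda>s. V s / U s) has_field_derivative 0) (at s)"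
      using dU[of s] dV[of s] UV[of s]
      by (auto intro!: derivative_eq_intros simp: field_simps)
    then show "((\<lambda>s. V s / U s) has_field_derivative 0) (at s within ball 0 e)"
      by (rule has_field_derivative_at_within)
  qed
  then obtain c where c: "\<And>s. s \<in> ball 0 e \<Longrightarrow> V s / U s = c" by blast
  have eq: "V s - c * U s = 0" if "s \<in> ball 0 e" for s
    using c[OF that] e(2)[of s] that by (auto simp: field_simps)
  have all: "V s - c * U s = 0" for s
  proof (rule analytic_continuation[of "\<lambda>s. V s - c * U s" UNIV "ball 0 e" 0])
    show "(0::complex) islimpt ball 0 e" using e(1) by (simp add: islimpt_ball)
  qed (use eq hol in \<open>auto intro!: holomorphic_intros\<close>)
  from all[of 0] all[of 1] show ?thesis by (simp add: U_def V_def)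
qed

section \<open>Secants through generic points\<close>

definition slice :: "complex ^ ('r::finite \<times> 'l::finite) \<Rightarrow> 'r \<Rightarrow> complex ^ 'l" where
  "slice X i = (\<chi> j. X $ (i, j))"

definition set_slice :: "complex ^ ('r::finite \<times> 'l::finite) \<Rightarrow> 'r \<Rightarrow> complex ^ 'l \<Rightarrow> complex ^ ('r \<times> 'l)" where
  "set_slice X i y = (\<chi> rj. if fst rj = i then y $ snd rj else X $ rj)"

lemma slice_set_slice: "slice (set_slice X i y) k = (if k = i then y else slice X k)"
  by (simp add: slice_def set_slice_def vec_eq_iff)

lemma polyfun_slice: "h \<in> polyfun S \<Longrightarrow> (\<lambda>X. h (slice X i)) \<in> polyfun S"
  by (rule polyfun_compose) (auto simp: slice_def intro: polyfun.coord)

text \<open>\<open>None\<close> selects the value itself, so that \<open>tangent\<close> spans the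
  tangent space of the cone over the image, which does not change when the map is multiplied by a
  nonvanishing function.\<close>

definition vderiv :: "(complex ^ 'l \<Rightarrow> complex ^ 'n) \<Rightarrow> 'l option \<Rightarrow> complex ^ 'l \<Rightarrow> complex ^ 'n" where
  "vderiv \<rho> t x = (case t of None \<Rightarrow> \<rho> x | Some j \<Rightarrow> \<chi> a. pderivative j (\<lambda>x. \<rho> x $ a) x)"

definition tangent :: "(complex ^ 'l \<Rightarrow> complex ^ 'n) \<Rightarrow> complex ^ 'l \<Rightarrow> (complex ^ 'n) set" where
  "tangent \<rho> x = range (\<lambda>t. vderiv \<rho> t x)"

lemma vderiv_None [simp]: "vderiv \<rho> None x = \<rho> x"
  by (simp add: vderiv_def)

lemma vderiv_Some: "vderiv \<rho> (Some j) x $ a = pderivative j (\<lambda>x. \<rho> x $ a) x"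
  by (simp add: vderiv_def)

lemma polyfun_vderiv:
  assumes "\<And>a. (\<lambda>x. \<rho> x $ a) \<in> polyfun S"
  shows "(\<lambda>x. vderiv \<rho> t x $ a) \<in> polyfun S"
  using assms[of a] polyfun_pderivative[OF assms[of a]]
  by (cases t) (auto simp: vderiv_Some)

lemma polyfun_vderiv_slice:
  assumes "\<And>a. (\<lambda>x. \<rho> x $ a) \<in> polyfun S"
  shows "(\<lambda>X. vderiv \<rho> t (slice X i) $ a) \<in> polyfun S" "(\<lambda>X. \<rho> (slice X i) $ a) \<in> polyfun S"
  by (rule polyfun_slice[OF polyfun_vderiv[OF assms]], rule polyfun_slice[OF assms])

lemma tangent_dim_slice:
  fixes \<rho> :: "complex ^ 'l::finite \<Rightarrow> complex ^ 'n"
  assumes \<rho>: "\<And>a. (\<lambda>x. \<rho> x $ a) \<in> polyfun S"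
    and X: "generic S (X :: complex ^ ('r::finite \<times> 'l))"
  shows "vec.dim (tangent \<rho> x) \<le> vec.dim (tangent \<rho> (slice X i))"
proof -
  have "vec.dim ((\<lambda>t. vderiv \<rho> t (slice (set_slice X i x) i)) ` UNIV)
      \<le> vec.dim ((\<lambda>t. vderiv \<rho> t (slice X i)) ` UNIV)"
    by (rule dim_le_generic[OF _ _ X, where w = "\<lambda>t X. vderiv \<rho> t (slice X i)"])
      (simp_all add: polyfun_vderiv_slice[OF \<rho>])
  then show ?thesis by (simp add: tangent_def slice_set_slice)
qed

lemma derivation_vec:
  fixes \<rho> :: "complex ^ 'l::finite \<Rightarrow> complex ^ 'n"
  assumes \<rho>: "\<And>a. (\<lambda>x. \<rho> x $ a) \<in> polyfun S" and D: "derivation D" "\<forall>c\<in>S. D c = 0"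
  shows "(\<chi> a. D (\<rho> x $ a)) = (\<Sum>j\<in>UNIV. D (x $ j) *s vderiv \<rho> (Some j) x)"
  by (simp add: vec_eq_iff derivation_polyfun[OF \<rho> D] vderiv_Some mult.commute)

context
  fixes \<rho> :: "complex ^ 'l::finite \<Rightarrow> complex ^ 'n" and S :: "complex set" and e :: nat
    and X :: "complex ^ ('r::finite \<times> 'l)"
  assumes \<rho>: "\<And>a. (\<lambda>x. \<rho> x $ a) \<in> polyfun S"
    and X: "generic S X"
    and dim_tangent: "\<And>x. vec.dim (tangent \<rho> x) \<le> e"
    and e_attained: "\<exists>x. vec.dim (tangent \<rho> x) = e"
    and dim_range: "CARD('r) + e \<le> vec.dim (range \<rho>)"
begin

private abbreviation (input) "tan_family \<equiv> \<lambda>(i, t) Z. vderiv \<rho> t (slice Z i)"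

private definition tangents :: "'r set \<Rightarrow> (complex ^ 'n) set" where
  "tangents J = (\<Union>i\<in>J. tangent \<rho> (slice X i))"

lemma tangents_eq: "tangents J = (\<lambda>p. tan_family p X) ` (J \<times> UNIV)"
  by (force simp: tangents_def tangent_def)

lemma tangents_insert: "tangents (insert i J) = tangent \<rho> (slice X i) \<union> tangents J"
  by (simp add: tangents_def)

lemma tan_family_polyfun: "(\<lambda>Z. tan_family p Z $ a) \<in> polyfun S"
  by (cases p) (simp add: polyfun_vderiv_slice[OF \<rho>])

text \<open>The range does not fit into the span, so some polynomial functional killing the span at
  \<open>X\<close> is nonzero at some \<open>\<rho> y\<close>. Moving block \<open>i\<close> to
  \<open>y\<close> leaves this functional unchanged, so its pairing with the \<open>i\<close>-th
  point is a polynomial function that is not identically zero, hence nonzero at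
  \<open>X\<close>.\<close>

lemma generic_point_notin_span:
  assumes I: "finite I" and w: "\<And>p a. p \<in> I \<Longrightarrow> (\<lambda>z. w p z $ a) \<in> polyfun S"
    and eq: "\<And>p y. p \<in> I \<Longrightarrow> w p (set_slice X i y) = w p X"
    and dim: "vec.dim ((\<lambda>p. w p X) ` I) < vec.dim (range \<rho>)"
  shows "\<rho> (slice X i) \<notin> vec.span ((\<lambda>p. w p X) ` I)"
proof
  let ?W = "vec.span ((\<lambda>p. w p X) ` I)"
  assume mem: "\<rho> (slice X i) \<in> ?W"
  obtain y where y: "\<rho> y \<notin> ?W"
  proof (rule ccontr)
    assume "\<not> thesis"
    then have "range \<rho> \<subseteq> ?W" using that by blast
    with dim show False using vec.dim_mono[of "range \<rho>" "(\<lambda>p. w p X) ` I"] by simp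
  qed
  obtain \<phi> where \<phi>: "\<And>a. (\<lambda>z. \<phi> z $ a) \<in> polyfun S"
    "\<And>Z. Z \<in> range (set_slice X i) \<Longrightarrow> \<phi> Z = \<phi> X"
    "\<And>u. u \<in> ?W \<Longrightarrow> bdot (\<phi> X) u = 0" "bdot (\<phi> X) (\<rho> y) \<noteq> 0"
    by (rule generic_annihilator[OF I w _ y, where \<Z> = "range (set_slice X i)"]) (use eq in auto)
  have P: "(\<lambda>Z. bdot (\<phi> Z) (\<rho> (slice Z i))) \<in> polyfun S"
    by (rule fun_ring_bdot[OF fun_ring_polyfun]) (simp_all add: \<phi>(1) polyfun_vderiv_slice[OF \<rho>])
  have "bdot (\<phi> (set_slice X i y)) (\<rho> (slice (set_slice X i y) i)) \<noteq> 0"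
    using \<phi>(2)[of "set_slice X i y"] \<phi>(4) by (simp add: slice_set_slice)
  from generic_neq_0[OF X P this] \<phi>(3)[OF mem] show False by simp
qed

lemma tan_family_set_slice: "i \<notin> J \<Longrightarrow> p \<in> J \<times> UNIV \<Longrightarrow> tan_family p (set_slice X i y) = tan_family p X"
  by (auto simp: slice_set_slice)

lemma generic_point_notin_tangents:
  assumes "i \<notin> J" "vec.dim (tangents J) < vec.dim (range \<rho>)"
  shows "\<rho> (slice X i) \<notin> vec.span (tangents J)"
  unfolding tangents_eq
proof (rule generic_point_notin_span[where w = tan_family])
  show "tan_family p (set_slice X i y) = tan_family p X" if "p \<in> J \<times> UNIV" for p y
    by (rule tan_family_set_slice[OF assms(1) that])
  show "vec.dim ((\<lambda>p. tan_family p X) ` (J \<times> UNIV)) < vec.dim (range \<rho>)"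
    using assms(2) by (simp only: tangents_eq)
qed (simp_all only: tan_family_polyfun finite)

lemma generic_points_independent:
  "\<rho> (slice X i) \<notin> vec.span ((\<lambda>k. \<rho> (slice X k)) ` (- {i}))"
proof (rule generic_point_notin_span[where w = "\<lambda>k Z. \<rho> (slice Z k)"])
  have "vec.dim ((\<lambda>k. \<rho> (slice X k)) ` (- {i})) \<le> card (- {i})"
    by (meson card_image_le finite finite_imageI order_trans vec.dim_le_card')
  also have "\<dots> < CARD('r)" by (intro psubset_card_mono) auto
  finally show "vec.dim ((\<lambda>k. \<rho> (slice X k)) ` (- {i})) < vec.dim (range \<rho>)"
    using dim_range by simp
qed (auto simp: slice_set_slice polyfun_vderiv_slice[OF \<rho>])

text \<open>The first tangent space contributes \<open>e\<close>, and each further one at least its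
  own point, which lies outside the previous span as long as that is smaller than the span of the
  range.\<close>

lemma dim_tangents_ge:
  assumes "J \<noteq> {}" "vec.dim (tangents J) < vec.dim (range \<rho>)"
  shows "e + card J \<le> vec.dim (tangents J) + 1"
proof -
  have "finite J" by simp
  from this assms show ?thesis
  proof (induction J rule: finite_ne_induct)
    case (singleton i)
    obtain x where "vec.dim (tangent \<rho> x) = e" using e_attained by blast
    then have "e \<le> vec.dim (tangent \<rho> (slice X i))" using tangent_dim_slice[OF \<rho> X, of x i] by simp
    then show ?case using tangents_insert[of i "{}"] by (simp add: tangents_def)
  next
    case (insert i J)
    have sub: "tangents J \<subseteq> tangents (insert i J)" by (auto simp: tangents_insert)
    then have lt: "vec.dim (tangents J) < vec.dim (range \<rho>)"
      using vec.dim_subset[OF sub] insert.prems by simp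
    then have "e + card J \<le> vec.dim (tangents J) + 1" using insert.IH by simp
    moreover have "\<rho> (slice X i) \<in> tangent \<rho> (slice X i)"
      unfolding tangent_def by (rule range_eqI[of _ _ None]) simp
    then have "insert (\<rho> (slice X i)) (tangents J) \<subseteq> tangents (insert i J)"
      by (auto simp: tangents_insert)
    from vec.dim_subset[OF this] generic_point_notin_tangents[OF insert.hyps(3) lt]
    have "vec.dim (tangents J) + 1 \<le> vec.dim (tangents (insert i J))" by (simp add: vec.dim_insert)
    ultimately show ?case using insert.hyps by simp
  qed
qed

text \<open>Any two functionals vanishing on the subspace are proportional along \<open>\<rho>\<close>, because their Wronskian
  vanishes at a generic point and hence everywhere.\<close>

lemma dim_range_le_of_radial:
  assumes i: "i \<notin> J"
    and rad: "\<And>j. vderiv \<rho> (Some j) (slice X i) \<in> vec.span (insert (\<rho> (slice X i)) (tangents J))"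
    and lt: "vec.dim (tangents J) < vec.dim (range \<rho>)"
  shows "vec.dim (range \<rho>) \<le> vec.dim (tangents J) + 1"
proof -
  let ?W = "vec.span (tangents J)"
  obtain x where x: "\<rho> x \<notin> ?W"
  proof (rule ccontr)
    assume "\<not> thesis"
    then have "range \<rho> \<subseteq> ?W" using that by blast
    with lt show False using vec.dim_mono[of "range \<rho>" "tangents J"] by simp
  qed
  have "\<rho> x' \<in> vec.span (insert (\<rho> x) (tangents J))" for x'
  proof (rule ccontr)
    assume x': "\<rho> x' \<notin> vec.span (insert (\<rho> x) (tangents J))"
    have ann: "\<exists>\<phi>. (\<forall>a. (\<lambda>z. \<phi> z $ a) \<in> polyfun S) \<and> (\<forall>y. \<phi> (set_slice X i y) = \<phi> X) \<and>
        (\<forall>u\<in>?W. bdot (\<phi> X) u = 0) \<and> bdot (\<phi> X) v \<noteq> 0" if v: "v \<notin> ?W" for v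
    proof -
      show ?thesis
      proof (rule generic_annihilator[where w = tan_family and I = "J \<times> UNIV" and S = S
            and \<Z> = "range (set_slice X i)"])
        show "v \<notin> vec.span ((\<lambda>p. tan_family p X) ` (J \<times> UNIV))" using v unfolding tangents_eq .
        show "tan_family p Z = tan_family p X" if "p \<in> J \<times> UNIV" "Z \<in> range (set_slice X i)" for p Z
          using tan_family_set_slice[OF i that(1)] that(2) by blast
        show "(\<lambda>z. tan_family p z $ a) \<in> polyfun S" for p a by (rule tan_family_polyfun)
      next
        fix \<phi> assume "\<And>a. (\<lambda>z. \<phi> z $ a) \<in> polyfun S"
          "\<And>Z. Z \<in> range (set_slice X i) \<Longrightarrow> \<phi> Z = \<phi> X"
          "\<And>u. u \<in> vec.span ((\<lambda>p. tan_family p X) ` (J \<times> UNIV)) \<Longrightarrow> bdot (\<phi> X) u = 0"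
          "bdot (\<phi> X) v \<noteq> 0"
        then show ?thesis unfolding tangents_eq by (intro exI[of _ \<phi>]) blast
      qed simp
    qed
    obtain \<alpha> where \<alpha>: "\<And>a. (\<lambda>z. \<alpha> z $ a) \<in> polyfun S" "\<And>y. \<alpha> (set_slice X i y) = \<alpha> X"
      "\<And>u. u \<in> ?W \<Longrightarrow> bdot (\<alpha> X) u = 0" "bdot (\<alpha> X) (\<rho> x) \<noteq> 0"
      using ann[OF x] by blast
    \<comment> \<open>With this \<open>t\<close> the functional \<open>\<alpha> X\<close> vanishes
      on \<open>\<rho> x' - t *s \<rho> x\<close>, on which \<open>\<beta> X\<close> is chosen
      nonzero; proportionality of the two along \<open>\<rho>\<close> forbids this.\<close>
    define t where "t = bdot (\<alpha> X) (\<rho> x') / bdot (\<alpha> X) (\<rho> x)"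
    have "\<rho> x' - t *s \<rho> x \<notin> ?W" using x' by (auto simp: vec.span_insert)
    from ann[OF this] obtain \<beta> where \<beta>: "\<And>a. (\<lambda>z. \<beta> z $ a) \<in> polyfun S" "\<And>y. \<beta> (set_slice X i y) = \<beta> X"
      "\<And>u. u \<in> ?W \<Longrightarrow> bdot (\<beta> X) u = 0" "bdot (\<beta> X) (\<rho> x' - t *s \<rho> x) \<noteq> 0"
      by blast
    \<comment> \<open>The Wronskian is a polynomial in the whole point \<open>Z\<close>, functionals
      included, so that genericity of \<open>X\<close> applies. Afterwards only block
      \<open>i\<close> is moved, which leaves \<open>\<alpha>\<close> and \<open>\<beta>\<close>
      fixed.\<close>
    define h where "h j Z = bdot (\<alpha> Z) (\<rho> (slice Z i)) * bdot (\<beta> Z) (vderiv \<rho> (Some j) (slice Z i))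
        - bdot (\<beta> Z) (\<rho> (slice Z i)) * bdot (\<alpha> Z) (vderiv \<rho> (Some j) (slice Z i))" for j Z
    have P: "h j \<in> polyfun S" for j
      unfolding h_def[abs_def]
      by (intro polyfun_diff polyfun.mult fun_ring_bdot[OF fun_ring_polyfun])
        (simp_all add: polyfun_vderiv_slice[OF \<rho>] \<alpha>(1) \<beta>(1))
    have hX: "h j X = 0" for j
    proof -
      obtain k where "vderiv \<rho> (Some j) (slice X i) - k *s \<rho> (slice X i) \<in> ?W"
        using rad[of j] by (auto simp: vec.span_insert)
      from \<alpha>(3)[OF this] \<beta>(3)[OF this]
      have "bdot (\<alpha> X) (vderiv \<rho> (Some j) (slice X i)) = k * bdot (\<alpha> X) (\<rho> (slice X i))"
        "bdot (\<beta> X) (vderiv \<rho> (Some j) (slice X i)) = k * bdot (\<beta> X) (\<rho> (slice X i))"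
        by (simp_all add: bdot_simps)
      then show ?thesis by (simp add: h_def)
    qed
    have h0: "h j Z = 0" for j Z using X P[of j] hX[of j] unfolding generic_def by blast
    define u where "u y = bdot (\<alpha> X) (\<rho> y)" for y
    define v where "v y = bdot (\<beta> X) (\<rho> y)" for y
    have \<rho>': "(\<lambda>x. \<rho> x $ a) \<in> polyfun UNIV" for a by (rule polyfun_mono[OF \<rho>]) auto
    have P': "(\<lambda>y. bdot c (\<rho> y)) \<in> polyfun UNIV" for c
      by (rule fun_ring_bdot[OF fun_ring_polyfun]) (auto intro: polyfun.const \<rho>')
    have pd: "pderivative j (\<lambda>y. bdot c (\<rho> y)) y = bdot c (vderiv \<rho> (Some j) y)" for c j y
    proof -
      have "((\<lambda>t. bdot c (\<rho> (vec_upd y j t))) has_field_derivative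
          (\<Sum>a\<in>UNIV. c $ a * pderivative j (\<lambda>x. \<rho> x $ a) y)) (at (y $ j))"
        unfolding bdot_def
        by (intro DERIV_sum DERIV_cmult sep_entire_has_pderivative polyfun_sep_entire[OF \<rho>])
      then show ?thesis
        by (simp add: pderivative_def[of j "\<lambda>y. bdot c (\<rho> y)"] DERIV_imp_deriv bdot_def[of _ "vderiv _ _ _"] vderiv_Some)
    qed
    have "v x' * u x = u x' * v x"
    proof (rule wronskian_eq_0)
      show "u \<in> polyfun UNIV" "v \<in> polyfun UNIV" unfolding u_def[abs_def] v_def[abs_def] by (rule P')+
      show "u y * pderivative j v y = v y * pderivative j u y" for j y
        using h0[of j "set_slice X i y"]
        by (simp add: h_def slice_set_slice \<alpha>(2) \<beta>(2) u_def[abs_def] v_def[abs_def] pd)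
      show "u x \<noteq> 0" using \<alpha>(4) by (simp add: u_def)
    qed
    then have "bdot (\<beta> X) (\<rho> x' - t *s \<rho> x) = 0"
      using \<alpha>(4) by (simp add: bdot_simps t_def u_def v_def field_simps)
    with \<beta>(4) show False by simp
  qed
  then have "vec.dim (range \<rho>) \<le> vec.dim (insert (\<rho> x) (tangents J))"
    by (intro vec.dim_mono) auto
  also have "\<dots> \<le> vec.dim (tangents J) + 1" by (simp add: vec.dim_insert)
  finally show ?thesis .
qed

theorem generic_secant:
  assumes comb: "\<rho> x = (\<Sum>i\<in>UNIV. c i *s \<rho> (slice X i))" and nz: "\<rho> x \<noteq> 0"
  shows "\<exists>i. c i \<noteq> 0 \<and> (\<forall>k. k \<noteq> i \<longrightarrow> c k = 0)"
proof (rule ccontr)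
  assume no: "\<not> ?thesis"
  define I where "I = {i. c i \<noteq> 0}"
  have "I \<noteq> {}"
  proof
    assume "I = {}"
    then have "c i = 0" for i by (auto simp: I_def)
    then show False using comb nz by simp
  qed
  then obtain i0 where i0: "i0 \<in> I" by blast
  define J where "J = I - {i0}"
  have J: "J \<noteq> {}" "i0 \<notin> J" "I = insert i0 J" "J \<subseteq> I" using no i0 by (auto simp: J_def I_def)
  let ?P = "\<lambda>i. \<rho> (slice X i)"
  \<comment> \<open>The relation recovers the point of \<open>i0\<close> from
    \<open>\<rho> x\<close> and the points of \<open>J\<close>. Omitting it from the generators
    keeps the dimension at most \<open>e + card J\<close>.\<close>
  let ?L = "vec.span (tangent \<rho> x \<union> ?P ` J)"
  have \<rho>x: "\<rho> x \<in> tangent \<rho> x"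
    unfolding tangent_def by (rule range_eqI[of _ _ None]) simp
  have combI: "\<rho> x = c i0 *s ?P i0 + (\<Sum>i\<in>J. c i *s ?P i)"
  proof -
    have "\<rho> x = (\<Sum>i\<in>I. c i *s ?P i)"
      unfolding comb by (rule sum.mono_neutral_right) (auto simp: I_def)
    then show ?thesis using J by simp
  qed
  have PL: "?P i \<in> ?L" if "i \<in> I" for i
  proof (cases "i = i0")
    case True
    have "\<rho> x - (\<Sum>i\<in>J. c i *s ?P i) \<in> ?L"
      using \<rho>x by (intro vec.span_diff vec.span_sum vec.span_scale vec.span_base) auto
    then have "c i0 *s ?P i0 \<in> ?L" using combI by simp
    then have "(1 / c i0) *s (c i0 *s ?P i0) \<in> ?L" by (rule vec.span_scale)
    moreover have "(1 / c i0) *s (c i0 *s ?P i0) = ?P i0" using i0 by (simp add: I_def vec_eq_iff)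
    ultimately show ?thesis using True by metis
  next
    case False
    then show ?thesis using that by (intro vec.span_base) (auto simp: J_def)
  qed
  \<comment> \<open>The relation is differentiated with respect to coordinate \<open>(i, j)\<close>
    of \<open>X\<close>. The left side becomes a combination of tangent vectors at \<open>x\<close>,
    the \<open>D (c k)\<close> multiply points, and among the points only the \<open>i\<close>-th
    has a nonzero derivative.\<close>
  have TL: "vderiv \<rho> (Some j) (slice X i) \<in> ?L" if i: "i \<in> I" for i j
  proof -
    obtain D where D: "derivation D" "\<forall>c\<in>S. D c = 0"
      and DX: "\<And>w. D (X $ w) = (if w = (i, j) then 1 else 0)"
      using generic_derivation[OF X, of "(i, j)"] by metis
    have DP: "(\<chi> a. D (?P k $ a)) = (if k = i then vderiv \<rho> (Some j) (slice X i) else 0)" for k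
    proof -
      have "D (slice X k $ j') = (if k = i \<and> j' = j then 1 else 0)" for j' by (simp add: slice_def DX)
      then show ?thesis
        by (subst derivation_vec[OF \<rho> D]) (auto simp: if_distrib[of "\<lambda>b. b *s _"] cong: if_cong)
    qed
    have Dc: "D (c k) = 0" if "k \<notin> I" for k
      using that derivation_props(1)[OF D(1)] by (simp add: I_def)
    have "(\<chi> a. D (\<rho> x $ a)) = (\<Sum>k\<in>UNIV. D (c k) *s ?P k + c k *s (\<chi> a. D (?P k $ a)))"
      unfolding comb
      by (simp add: vec_eq_iff derivation_sum[OF D(1)] derivation_props[OF D(1)] sum.distrib add.commute)
    also have "\<dots> = (\<Sum>k\<in>UNIV. D (c k) *s ?P k) + c i *s vderiv \<rho> (Some j) (slice X i)"
      by (simp add: DP sum.distrib if_distrib[of "\<lambda>v. _ *s v"] cong: if_cong)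
    also have "(\<Sum>k\<in>UNIV. D (c k) *s ?P k) = (\<Sum>k\<in>I. D (c k) *s ?P k)"
      by (rule sum.mono_neutral_right) (auto simp: Dc)
    finally have "(\<chi> a. D (\<rho> x $ a))
        = (\<Sum>k\<in>I. D (c k) *s ?P k) + c i *s vderiv \<rho> (Some j) (slice X i)" .
    from trans[OF derivation_vec[OF \<rho> D, of x, symmetric] this]
    have "c i *s vderiv \<rho> (Some j) (slice X i)
        = (\<Sum>j\<in>UNIV. D (x $ j) *s vderiv \<rho> (Some j) x) - (\<Sum>k\<in>I. D (c k) *s ?P k)"
      by simp
    also have "\<dots> \<in> ?L"
    proof (intro vec.span_diff vec.span_sum vec.span_scale PL)
      show "vderiv \<rho> (Some j) x \<in> ?L" for j by (intro vec.span_base) (auto simp: tangent_def)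
    qed
    finally have "(1 / c i) *s (c i *s vderiv \<rho> (Some j) (slice X i)) \<in> ?L" by (rule vec.span_scale)
    moreover have "(1 / c i) *s (c i *s vderiv \<rho> (Some j) (slice X i)) = vderiv \<rho> (Some j) (slice X i)"
      using i by (simp add: I_def vec_eq_iff)
    ultimately show ?thesis by metis
  qed
  have subL: "tangents I \<subseteq> ?L"
  proof
    fix v assume "v \<in> tangents I"
    then obtain i t where it: "i \<in> I" "v = vderiv \<rho> t (slice X i)" by (auto simp: tangents_def tangent_def)
    then show "v \<in> ?L" using PL TL by (cases t) auto
  qed
  have "vec.dim (tangent \<rho> x \<union> ?P ` J) \<le> e + card J"
  proof -
    have "vec.dim (tangent \<rho> x \<union> ?P ` K) \<le> e + card K" for K
    proof (induction K rule: infinite_finite_induct)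
      case (insert k K)
      then show ?case by (simp add: vec.dim_insert)
    qed (use dim_tangent[of x] in simp_all)
    then show ?thesis .
  qed
  moreover have "vec.dim (tangents I) \<le> vec.dim (tangent \<rho> x \<union> ?P ` J)"
    by (rule vec.dim_mono[OF subL])
  ultimately have up: "vec.dim (tangents I) \<le> e + card J" by simp
  have "card J < CARD('r)"
    using J(2) by (intro psubset_card_mono) auto
  with up have ltI: "vec.dim (tangents I) < vec.dim (range \<rho>)" using dim_range by simp
  have subJ: "tangents J \<subseteq> tangents I" unfolding J(3) by (auto simp: tangents_insert)
  have ltJ: "vec.dim (tangents J) < vec.dim (range \<rho>)" using vec.dim_subset[OF subJ] ltI by simp
  \<comment> \<open>A squeeze: the tangent spaces of \<open>J\<close> together with the point of
    \<open>i0\<close> already reach the upper bound \<open>e + card J\<close> for all tangent spaces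
    of \<open>I\<close>. The two spans coincide, so the tangent vectors at \<open>i0\<close> are
    radial modulo those of \<open>J\<close>.\<close>
  have "e + card J \<le> vec.dim (tangents J) + 1" by (rule dim_tangents_ge[OF J(1) ltJ])
  also have "\<dots> = vec.dim (insert (?P i0) (tangents J))"
    using generic_point_notin_tangents[OF J(2) ltJ] by (simp add: vec.dim_insert)
  finally have ge: "vec.dim (tangents I) \<le> vec.dim (insert (?P i0) (tangents J))" using up by simp
  have "?P i0 \<in> tangent \<rho> (slice X i0)"
    unfolding tangent_def by (rule range_eqI[of _ _ None]) simp
  then have sub: "insert (?P i0) (tangents J) \<subseteq> tangents I" unfolding J(3) by (auto simp: tangents_insert)
  have "vec.span (insert (?P i0) (tangents J)) = vec.span (tangents I)"
    by (rule vec.dim_eq_span[OF sub ge])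
  then have "vderiv \<rho> (Some j) (slice X i0) \<in> vec.span (insert (?P i0) (tangents J))" for j
    using i0 by (auto simp: tangents_def tangent_def intro!: vec.span_base)
  from dim_range_le_of_radial[OF J(2) this ltJ]
  have "vec.dim (range \<rho>) \<le> vec.dim (insert (?P i0) (tangents J))"
    using generic_point_notin_tangents[OF J(2) ltJ] by (simp add: vec.dim_insert)
  also have "\<dots> \<le> vec.dim (tangents I)" by (rule vec.dim_subset[OF sub])
  finally show False using ltI by simp
qed

end

section \<open>Zero sets of separately entire functions\<close>

lemma to_complex_diff: "to_complex (x - y) = to_complex x - to_complex (y :: 'a::real_or_complex)"
  using to_complex_add[of "x - y" y] by simp

lemma bounded_linear_to_complex: "bounded_linear (to_complex :: 'a::real_or_complex \<Rightarrow> complex)"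
  by (rule bounded_linear_intro[where K = 1])
    (auto simp: to_complex_add to_complex_scaleR norm_to_complex)

lemma inj_to_complex: "inj (to_complex :: 'a::real_or_complex \<Rightarrow> complex)"
proof (rule injI)
  fix x y :: 'a assume "to_complex x = to_complex y"
  then have "norm (x - y) = 0" using norm_to_complex[of "x - y"] by (simp add: to_complex_diff)
  then show "x = y" by simp
qed

lemma to_complex_measurable [measurable]: "(to_complex :: 'a::real_or_complex \<Rightarrow> complex) \<in> borel_measurable borel"
  by (intro borel_measurable_continuous_onI linear_continuous_on bounded_linear_to_complex)

lemma vec_nth_measurable: "(\<lambda>z :: 'a::real_or_complex ^ 'n. z $ k) \<in> borel_measurable borel"
  by (intro borel_measurable_continuous_onI continuous_intros)

text \<open>Coordinates in \<open>A\<close> vary over the scalar field, the others are frozen at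
  \<open>a\<close>; inductions on \<open>A\<close> release one coordinate at a time.\<close>

definition mix :: "'n set \<Rightarrow> complex ^ 'n \<Rightarrow> 'a::real_or_complex ^ 'n \<Rightarrow> complex ^ 'n" where
  "mix A a z = (\<chi> i. if i \<in> A then to_complex (z $ i) else a $ i)"

lemma mix_insert: "mix (insert k A) a z = vec_upd (mix A a z) k (to_complex (z $ k))"
  and mix_vec_upd: "k \<notin> A \<Longrightarrow> mix A (vec_upd a k t) z = vec_upd (mix A a z) k t"
  and mix_UNIV: "mix UNIV a z = cvec z"
  by (auto simp: mix_def vec_upd_def cvec_def vec_eq_iff)

lemma sep_entire_continuous:
  "sep_entire H \<Longrightarrow> continuous_on UNIV (\<lambda>t. H (vec_upd x k t))"
  by (auto simp: sep_entire_def intro: holomorphic_on_imp_continuous_on)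

text \<open>Separate continuity suffices for measurability: discretise one variable after the other.\<close>

lemma sep_entire_measurable:
  fixes H :: "complex ^ 'n \<Rightarrow> complex"
  assumes H: "sep_entire H"
  shows "(\<lambda>z :: 'a::real_or_complex ^ 'n. H (mix A a z)) \<in> borel_measurable borel"
proof -
  have "finite A" by simp
  then show ?thesis
  proof (induction A arbitrary: a rule: finite_induct)
    case empty
    then show ?case by (simp add: mix_def)
  next
    case (insert k A)
    \<comment> \<open>A grid of mesh \<open>1 / real (Suc m)\<close>; \<open>g\<close> and
      \<open>h\<close> locate the grid point next to the \<open>k\<close>-th coordinate. For each
      fixed grid point the induction hypothesis applies with an updated \<open>a\<close>, and there
      are only countably many of them.\<close>
    define s :: "nat \<Rightarrow> int \<Rightarrow> int \<Rightarrow> complex" where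
      "s m i j = Complex (real_of_int i / real (Suc m)) (real_of_int j / real (Suc m))" for m i j
    define g :: "nat \<Rightarrow> 'a ^ 'n \<Rightarrow> int" where "g m z = \<lfloor>real (Suc m) * Re (to_complex (z $ k))\<rfloor>" for m z
    define h :: "nat \<Rightarrow> 'a ^ 'n \<Rightarrow> int" where "h m z = \<lfloor>real (Suc m) * Im (to_complex (z $ k))\<rfloor>" for m z
    have lim: "(\<lambda>m. real_of_int \<lfloor>real (Suc m) * x\<rfloor> / real (Suc m)) \<longlonglongrightarrow> x" for x :: real
    proof (rule LIMSEQ_I)
      fix r :: real assume "r > 0"
      then obtain N where N: "1 / real (Suc N) < r" using nat_approx_posE by blast
      have "norm (real_of_int \<lfloor>real (Suc m) * x\<rfloor> / real (Suc m) - x) < r" if "m \<ge> N" for m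
      proof -
        have "norm (real_of_int \<lfloor>real (Suc m) * x\<rfloor> / real (Suc m) - x)
            = \<bar>real_of_int \<lfloor>real (Suc m) * x\<rfloor> - real (Suc m) * x\<bar> / real (Suc m)"
        proof -
          have eq: "real_of_int \<lfloor>real (Suc m) * x\<rfloor> / real (Suc m) - x
              = (real_of_int \<lfloor>real (Suc m) * x\<rfloor> - real (Suc m) * x) / real (Suc m)"
            by (simp add: diff_divide_distrib del: of_nat_Suc)
          show ?thesis unfolding real_norm_def eq abs_divide by simp
        qed
        also have "\<dots> \<le> 1 / real (Suc m)"
          by (intro divide_right_mono) linarith+
        also have "\<dots> \<le> 1 / real (Suc N)" using that by (simp add: frac_le)
        finally show ?thesis using N by linarith
      qed
      then show "\<exists>N. \<forall>m\<ge>N. norm (real_of_int \<lfloor>real (Suc m) * x\<rfloor> / real (Suc m) - x) < r" by blast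
    qed
    show ?case
    proof (rule borel_measurable_LIMSEQ_metric)
      fix m
      have g: "g m \<in> measurable borel (count_space UNIV)" and h: "h m \<in> measurable borel (count_space UNIV)"
        unfolding g_def h_def using vec_nth_measurable[where 'a = 'a, of k] by measurable
      have "(\<lambda>z. H (mix A (vec_upd a k (s m i (h m z))) z)) \<in> borel_measurable borel" for i
        by (rule measurable_compose_countable[OF _ h, where f = "\<lambda>j z. H (mix A (vec_upd a k (s m i j)) z)"])
          (rule insert.IH)
      from measurable_compose_countable[OF this g]
      show "(\<lambda>z. H (mix A (vec_upd a k (s m (g m z) (h m z))) z)) \<in> borel_measurable borel" .
    next
      fix z :: "'a ^ 'n"
      have "(\<lambda>m. s m (g m z) (h m z)) \<longlonglongrightarrow> Complex (Re (to_complex (z $ k))) (Im (to_complex (z $ k)))"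
        unfolding s_def g_def h_def by (intro tendsto_Complex lim)
      then have "(\<lambda>m. s m (g m z) (h m z)) \<longlonglongrightarrow> to_complex (z $ k)" by simp
      then have "(\<lambda>m. H (vec_upd (mix A a z) k (s m (g m z) (h m z)))) \<longlonglongrightarrow> H (vec_upd (mix A a z) k (to_complex (z $ k)))"
        by (rule continuous_on_tendsto_compose[OF sep_entire_continuous[OF H]]) auto
      then show "(\<lambda>m. H (mix A (vec_upd a k (s m (g m z) (h m z))) z)) \<longlonglongrightarrow> H (mix (insert k A) a z)"
        using insert.hyps(2) by (simp add: mix_vec_upd mix_insert)
    qed
  qed
qed

text \<open>Tonelli is applied to the translates of the set along the \<open>k\<close>-th axis, so that no product
  decomposition of the space is needed.\<close>

lemma AE_lborel_lines:
  fixes P :: "'a::real_or_complex ^ 'n \<Rightarrow> bool"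
  assumes P: "{z. P z} \<in> sets borel"
    and lines: "AE z in lborel. AE t in lborel. P (z + axis k t)"
  shows "AE z in lborel. P z"
proof -
  have c: "(\<lambda>x :: ('a ^ 'n) \<times> 'a. fst x + axis k (snd x)) \<in> borel_measurable (lborel \<Otimes>\<^sub>M lborel)"
  proof -
    have "continuous_on UNIV (\<lambda>x :: ('a ^ 'n) \<times> 'a. (if i = k then snd x else 0))" for i
      by (cases "i = k") (auto intro!: continuous_intros)
    then have "continuous_on UNIV (\<lambda>x :: ('a ^ 'n) \<times> 'a. fst x + axis k (snd x))"
      unfolding axis_def by (intro continuous_intros continuous_on_vec_lambda)
    then have "(\<lambda>x :: ('a ^ 'n) \<times> 'a. fst x + axis k (snd x)) \<in> borel_measurable borel"
      by (rule borel_measurable_continuous_onI)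
    moreover have "sets (lborel \<Otimes>\<^sub>M lborel) = sets (borel :: (('a ^ 'n) \<times> 'a) measure)"
      unfolding borel_prod[symmetric] by (intro sets_pair_measure_cong) auto
    ultimately show ?thesis by (simp cong: measurable_cong_sets)
  qed
  have "AE t in lborel. AE z in lborel. P (z + axis k t)"
    using lines measurable_sets[OF c P]
    by (subst lborel_pair.AE_commute[symmetric]) (auto simp: vimage_def Int_def conj_commute)
  moreover have "\<not> (AE t in (lborel :: 'a measure). False)"
    by (simp add: eventually_False ae_filter_eq_bot_iff)
  \<comment> \<open>One good translate is enough, since Lebesgue measure is translation
    invariant.\<close>
  ultimately obtain t where t: "AE z in lborel. P (z + axis k t)"
    by (metis (mono_tags, lifting) eventually_mono)
  have "AE z in distr lborel borel ((+) (axis k t)). P z"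
    by (subst AE_distr_iff) (use P t in \<open>simp_all add: add.commute\<close>)
  then show ?thesis by (simp only: lborel_distr_plus)
qed

lemma entire_zeros_countable:
  assumes "f holomorphic_on UNIV" "f a \<noteq> 0"
  shows "countable {t. f t = 0}"
proof (cases "f constant_on UNIV")
  case True
  then obtain c where "\<And>t. f t = c" unfolding constant_on_def by blast
  then show ?thesis using assms(2) by simp
next
  case False
  have "fsigma (UNIV :: complex set)"
    using fsigma.intros[of "\<lambda>_. UNIV :: complex set"] by simp
  from holomorphic_countable_zeros[OF assms(1) open_UNIV connected_UNIV this False] show ?thesis by simp
qed

text \<open>For almost all \<open>z\<close> the entire function of the released coordinate is
  nonzero at \<open>a $ k\<close> by the induction hypothesis. Its zeros are countable, and
  countable sets are null on the real line as well as in the plane.\<close>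

lemma AE_sep_entire_mix:
  fixes H :: "complex ^ 'n \<Rightarrow> complex"
  assumes H: "sep_entire H" and a: "H a \<noteq> 0"
  shows "AE z :: 'a::real_or_complex ^ 'n in lborel. H (mix A a z) \<noteq> 0"
proof -
  have "finite A" by simp
  then show ?thesis
  proof (induction A rule: finite_induct)
    case empty
    have "mix {} a z = a" for z :: "'a ^ 'n" by (simp add: mix_def vec_eq_iff)
    then show ?case using a by simp
  next
    case (insert k A)
    show ?case
    proof (rule AE_lborel_lines[of _ k])
      show "{z :: 'a ^ 'n. H (mix (insert k A) a z) \<noteq> 0} \<in> sets borel"
        using measurable_sets[OF sep_entire_measurable[OF H, of "insert k A" a], of "- {0}"]
        by (simp add: vimage_def)
      show "AE z :: 'a ^ 'n in lborel. AE t in lborel. H (mix (insert k A) a (z + axis k t)) \<noteq> 0"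
        using insert.IH
      proof eventually_elim
        case (elim z)
        let ?f = "\<lambda>s. H (vec_upd (mix A a z) k s)"
        let ?u = "\<lambda>t. to_complex (z $ k + t)"
        have "?f holomorphic_on UNIV" using H by (auto simp: sep_entire_def)
        moreover have "vec_upd (mix A a z) k (a $ k) = mix A a z"
          using insert.hyps(2) by (auto simp: vec_upd_def mix_def vec_eq_iff)
        then have "?f (a $ k) \<noteq> 0" using elim by simp
        ultimately have "countable {s. ?f s = 0}" by (rule entire_zeros_countable)
        then have "countable (?u ` (?u -` {s. ?f s = 0}))" by (rule countable_subset[rotated]) auto
        moreover have "inj ?u" by (auto dest!: injD[OF inj_to_complex] intro!: injI)
        ultimately have "countable (?u -` {s. ?f s = 0})"
          using countable_image_inj_on inj_on_subset subset_UNIV by blast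
        then have "?u -` {s. ?f s = 0} \<in> null_sets lborel" by (rule countable_imp_null_set_lborel)
        then have "AE t in lborel. ?f (?u t) \<noteq> 0" by (rule AE_I') auto
        moreover have "mix (insert k A) a (z + axis k t) = vec_upd (mix A a z) k (?u t)" for t
          using insert.hyps(2) by (auto simp: mix_def vec_upd_def vec_eq_iff axis_def)
        ultimately show ?case by simp
      qed
    qed
  qed
qed

theorem AE_sep_entire_neq_0:
  fixes H :: "complex ^ 'n \<Rightarrow> complex"
  assumes "sep_entire H" "H a \<noteq> 0"
  shows "AE z :: 'a::real_or_complex ^ 'n in lebesgue. H (cvec z) \<noteq> 0"
  using AE_sep_entire_mix[OF assms, of UNIV] by (intro AE_completion) (simp add: mix_UNIV)

lemma cvec_complex [simp]: "cvec (z :: complex ^ 'n) = z"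
  by (simp add: cvec_def to_complex_complex_def vec_eq_iff)

lemma AE_lebesgue_nonempty:
  assumes "AE x in (lebesgue :: 'a::euclidean_space measure). P x"
  shows "\<exists>x. P x"
proof (rule ccontr)
  assume "\<not> ?thesis"
  then have "AE x in (lebesgue :: 'a measure). False" using assms by simp
  then show False by (simp add: eventually_False ae_filter_eq_bot_iff)
qed

lemma AE_generic:
  assumes "countable S"
  shows "AE x in (lebesgue :: (complex ^ 'v) measure). generic S x"
proof -
  have "AE x in (lebesgue :: (complex ^ 'v) measure). \<forall>h\<in>polyfun S. h x = 0 \<longrightarrow> (\<forall>Z. h Z = 0)"
  proof (rule AE_ball_countable'[OF _ countable_polyfun[OF assms]])
    fix h :: "complex ^ 'v \<Rightarrow> complex" assume h: "h \<in> polyfun S"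
    show "AE x in lebesgue. h x = 0 \<longrightarrow> (\<forall>Z. h Z = 0)"
    proof (cases "\<forall>Z. h Z = 0")
      case False
      then obtain Z where "h Z \<noteq> 0" by blast
      from AE_sep_entire_neq_0[OF polyfun_sep_entire[OF h] this, where 'a = complex]
      show ?thesis by eventually_elim simp
    qed simp
  qed
  then show ?thesis by (simp add: generic_def)
qed

text \<open>Zero sets are null, so two nonzero separately entire functions would be nonzero at a
  common point.\<close>

lemma sep_entire_mult_eq_0:
  assumes "sep_entire g" "sep_entire h" "\<And>x. g x * h x = 0" "g a \<noteq> 0"
  shows "h x = 0"
proof (rule ccontr)
  assume "h x \<noteq> 0"
  have "AE z in (lebesgue :: (complex ^ 'a) measure). g z * h z \<noteq> 0"
    using AE_sep_entire_neq_0[OF assms(1,4), where 'a = complex]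
      AE_sep_entire_neq_0[OF assms(2) \<open>h x \<noteq> 0\<close>, where 'a = complex]
    by eventually_elim simp
  from AE_lebesgue_nonempty[OF this] show False using assms(3) by auto
qed

section \<open>Genericity of images\<close>

text \<open>Makes results on separately entire functions available for a polynomial evaluated at
  quotients. One power of the product of all denominators serves every monomial.\<close>

lemma polyfun_clear_denominators:
  fixes h :: "complex ^ 'v::finite \<Rightarrow> complex" and num den :: "'v \<Rightarrow> complex ^ 'n \<Rightarrow> complex"
  assumes "h \<in> polyfun S" and num: "\<And>v. sep_entire (num v)" and den: "\<And>v. sep_entire (den v)"
  shows "\<exists>H m. sep_entire H \<and>
    (\<forall>w. (\<forall>v. den v w \<noteq> 0) \<longrightarrow> H w = h (\<chi> v. num v w / den v w) * (\<Prod>v\<in>UNIV. den v w) ^ m)"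
  using assms(1)
proof induction
  case (const c)
  show ?case by (intro exI[of _ "\<lambda>_. c"] exI[of _ 0]) (simp add: sep_entire_const)
next
  case minus_one
  show ?case by (intro exI[of _ "\<lambda>_. - 1"] exI[of _ 0]) (simp add: sep_entire_const)
next
  case (coord j)
  have "(\<Prod>v\<in>UNIV. den v w) = den j w * (\<Prod>v\<in>UNIV - {j}. den v w)" for w
    by (simp add: prod.remove[of UNIV j])
  then show ?case
    by (intro exI[of _ "\<lambda>w. num j w * (\<Prod>v\<in>UNIV - {j}. den v w)"] exI[of _ 1])
      (simp add: sep_entire_mult sep_entire_prod num den)
next
  case (add h k)
  then obtain H m K n where H: "sep_entire H" "sep_entire K"
    "\<And>w. (\<forall>v. den v w \<noteq> 0) \<Longrightarrow> H w = h (\<chi> v. num v w / den v w) * (\<Prod>v\<in>UNIV. den v w) ^ m"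
    "\<And>w. (\<forall>v. den v w \<noteq> 0) \<Longrightarrow> K w = k (\<chi> v. num v w / den v w) * (\<Prod>v\<in>UNIV. den v w) ^ n"
    by blast
  have "sep_entire (\<lambda>w. H w * (\<Prod>v\<in>UNIV. den v w) ^ n + K w * (\<Prod>v\<in>UNIV. den v w) ^ m)"
    by (intro sep_entire_add sep_entire_mult sep_entire_power sep_entire_prod H den)
  then show ?case
    by (intro exI[of _ "\<lambda>w. H w * (\<Prod>v\<in>UNIV. den v w) ^ n + K w * (\<Prod>v\<in>UNIV. den v w) ^ m"]
        exI[of _ "m + n"])
      (simp add: H(3,4) power_add algebra_simps)
next
  case (mult h k)
  then obtain H m K n where H: "sep_entire H" "sep_entire K"
    "\<And>w. (\<forall>v. den v w \<noteq> 0) \<Longrightarrow> H w = h (\<chi> v. num v w / den v w) * (\<Prod>v\<in>UNIV. den v w) ^ m"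
    "\<And>w. (\<forall>v. den v w \<noteq> 0) \<Longrightarrow> K w = k (\<chi> v. num v w / den v w) * (\<Prod>v\<in>UNIV. den v w) ^ n"
    by blast
  have "sep_entire (\<lambda>w. H w * K w)" by (intro sep_entire_mult H)
  then show ?case
    by (intro exI[of _ "\<lambda>w. H w * K w"] exI[of _ "m + n"])
      (simp add: H(3,4) power_add algebra_simps)
qed

text \<open>Degree is measured by vanishing of iterated derivatives, since polynomials are functions
  here; differentiation then lowers it by definition.\<close>

primrec degree_less :: "nat \<Rightarrow> (complex ^ 'v \<Rightarrow> complex) \<Rightarrow> bool" where
  "degree_less 0 h \<longleftrightarrow> (\<forall>x. h x = 0)"
| "degree_less (Suc m) h \<longleftrightarrow> (\<forall>j. degree_less m (pderivative j h))"

lemma degree_less_zero: "degree_less m (\<lambda>_. 0)"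
  by (induction m) (simp_all add: pderivative_const[abs_def])

lemma degree_less_Suc: "degree_less m h \<Longrightarrow> degree_less (Suc m) h"
proof (induction m arbitrary: h)
  case 0
  then have "h = (\<lambda>_. 0)" by auto
  then show ?case using degree_less_zero by blast
qed simp

lemma degree_less_mono: "m \<le> n \<Longrightarrow> degree_less m h \<Longrightarrow> degree_less n h"
  by (induction rule: dec_induct) (auto intro: degree_less_Suc simp del: degree_less.simps)

lemma degree_less_add:
  "h \<in> polyfun S \<Longrightarrow> k \<in> polyfun S \<Longrightarrow> degree_less m h \<Longrightarrow> degree_less m k \<Longrightarrow>
    degree_less m (\<lambda>x. h x + k x)"
proof (induction m arbitrary: h k)
  case (Suc m)
  have "pderivative j (\<lambda>x. h x + k x) = (\<lambda>x. pderivative j h x + pderivative j k x)" for j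
    using Suc.prems by (auto simp: pderivative_add polyfun_sep_entire)
  then show ?case using Suc.prems by (auto intro!: Suc.IH polyfun_pderivative)
qed simp

lemma degree_less_mult:
  "h \<in> polyfun S \<Longrightarrow> k \<in> polyfun S \<Longrightarrow> degree_less m h \<Longrightarrow> degree_less n k \<Longrightarrow>
    degree_less (m + n) (\<lambda>x. h x * k x)"
proof (induction "m + n" arbitrary: h k m n rule: less_induct)
  case less
  show ?case
  proof (cases "m = 0 \<or> n = 0")
    case True
    then have "(\<lambda>x. h x * k x) = (\<lambda>_. 0)" using less.prems by auto
    then show ?thesis by (simp add: degree_less_zero)
  next
    case False
    then obtain m' n' where mn: "m = Suc m'" "n = Suc n'" by (meson not0_implies_Suc)
    have "degree_less (m' + Suc n') (pderivative j (\<lambda>x. h x * k x))" for j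
    proof -
      have 1: "degree_less (m + n') (\<lambda>x. h x * pderivative j k x)"
        using less.prems mn by (intro less.hyps) (auto intro: polyfun_pderivative)
      have 2: "degree_less (m' + n) (\<lambda>x. pderivative j h x * k x)"
        using less.prems mn by (intro less.hyps) (auto intro: polyfun_pderivative)
      have "degree_less (m' + Suc n') (\<lambda>x. h x * pderivative j k x + pderivative j h x * k x)"
        by (rule degree_less_add[of _ S])
          (use 1 2 mn less.prems in \<open>auto intro: polyfun.mult polyfun_pderivative simp del: degree_less.simps\<close>)
      moreover have "pderivative j (\<lambda>x. h x * k x) = (\<lambda>x. h x * pderivative j k x + pderivative j h x * k x)"
        using less.prems by (auto simp: pderivative_mult polyfun_sep_entire)
      ultimately show ?thesis by simp
    qed
    then show ?thesis using mn by simp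
  qed
qed

lemma polyfun_degree_less: "h \<in> polyfun S \<Longrightarrow> \<exists>m. degree_less m h"
proof (induction rule: polyfun.induct)
  case (const c)
  show ?case by (intro exI[of _ 1]) (simp add: pderivative_const)
next
  case minus_one
  show ?case by (intro exI[of _ 1]) (simp add: pderivative_const)
next
  case (coord j)
  show ?case by (intro exI[of _ 2]) (simp add: numeral_2_eq_2 pderivative_coord[abs_def] pderivative_const)
next
  case (add h k)
  then obtain m n where mn: "degree_less m h" "degree_less n k" by blast
  have "degree_less (max m n) h" "degree_less (max m n) k"
    by (rule degree_less_mono[OF max.cobounded1 mn(1)], rule degree_less_mono[OF max.cobounded2 mn(2)])
  then show ?case using degree_less_add add.hyps by blast
next
  case (mult h k)
  then show ?case using degree_less_mult by blast
qed

lemma polyfun_constant: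
  assumes h: "h \<in> polyfun S" and 0: "\<And>j x. pderivative j h x = 0"
  shows "h x = h y"
proof -
  have "((\<lambda>s. h (x + s *s (y - x))) has_field_derivative 0) (at s)" for s
    using polyfun_line_derivative[OF h, of x "y - x" s] by (simp add: 0)
  then obtain c where c: "\<And>s. s \<in> UNIV \<Longrightarrow> h (x + s *s (y - x)) = c"
    using has_field_derivative_zero_constant[of UNIV "\<lambda>s. h (x + s *s (y - x))"]
    by (auto simp: has_field_derivative_at_within)
  from c[of 0] c[of 1] show ?thesis by simp
qed

context
  fixes fnum fden :: "'l::finite \<Rightarrow> complex ^ 'l \<Rightarrow> complex" and \<zeta>0 :: "complex ^ 'l"
  assumes num: "\<And>j. sep_entire (fnum j)" and den: "\<And>j. sep_entire (fden j)"
    and \<zeta>0: "\<And>j. fden j \<zeta>0 \<noteq> 0"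
    and det: "det (cjacobian (\<lambda>\<zeta>. \<chi> j. fnum j \<zeta> / fden j \<zeta>) \<zeta>0) \<noteq> 0"
begin

private definition quot :: "complex ^ 'l \<Rightarrow> complex ^ 'l" where
  "quot \<zeta> = (\<chi> j. fnum j \<zeta> / fden j \<zeta>)"

text \<open>Row \<open>i\<close> is \<open>(fden i \<zeta>)\<^sup>2\<close> times that of the
  Jacobian where the denominators do not vanish: invertibility is the same there, but the entries
  are separately entire.\<close>

private definition jac_num :: "complex ^ 'l \<Rightarrow> complex ^ 'l ^ 'l" where
  "jac_num \<zeta> = (\<chi> i j. pderivative j (fnum i) \<zeta> * fden i \<zeta> - fnum i \<zeta> * pderivative j (fden i) \<zeta>)"

lemma quot_derivative:
  assumes "\<And>i. fden i \<zeta> \<noteq> 0"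
  shows "((\<lambda>t. quot (vec_upd \<zeta> j t) $ i) has_field_derivative jac_num \<zeta> $ i $ j / (fden i \<zeta>)\<^sup>2) (at (\<zeta> $ j))"
  using assms[of i]
  by (auto intro!: derivative_eq_intros sep_entire_has_pderivative num den
      simp: quot_def jac_num_def power2_eq_square divide_simps)

lemma det_jac_num: "det (jac_num \<zeta>0) \<noteq> 0"
proof -
  have "jac_num \<zeta>0 = (\<chi> i. (fden i \<zeta>0)\<^sup>2 *s cjacobian (\<lambda>\<zeta>. \<chi> j. fnum j \<zeta> / fden j \<zeta>) \<zeta>0 $ i)"
    using DERIV_imp_deriv[OF quot_derivative[OF \<zeta>0]] \<zeta>0 unfolding quot_def
    by (simp add: vec_eq_iff cjacobian_def)
  then show ?thesis using det \<zeta>0 by (simp add: det_rows_mul)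
qed

lemma sep_entire_det_jac_num: "sep_entire (\<lambda>\<zeta>. det (jac_num \<zeta>))"
  unfolding det_def
  by (intro sep_entire_sum sep_entire_mult sep_entire_const sep_entire_prod)
    (simp add: jac_num_def sep_entire_diff sep_entire_mult sep_entire_pderivative num den)

text \<open>A nonzero polynomial of least degree vanishing on the image of the map would have a nonzero
  derivative vanishing there as well, because the Jacobian is generically invertible.\<close>

lemma polyfun_vanishing_on_image:
  assumes "g \<in> polyfun S" "\<And>\<zeta>. (\<forall>j. fden j \<zeta> \<noteq> 0) \<Longrightarrow> g (quot \<zeta>) = 0"
  shows "g y = 0"
proof -
  obtain m where "degree_less m g" using polyfun_degree_less[OF assms(1)] by blast
  then show ?thesis using assms
  proof (induction m arbitrary: g y)
    case (Suc m)
    have g: "g \<in> polyfun S" by fact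
    have vanish: "pderivative i g (quot \<zeta>) = 0" if \<zeta>: "\<forall>j. fden j \<zeta> \<noteq> 0" and dN: "det (jac_num \<zeta>) \<noteq> 0" for \<zeta> i
    proof -
      have "(\<Sum>i\<in>UNIV. pderivative i g (quot \<zeta>) * (jac_num \<zeta> $ i $ j / (fden i \<zeta>)\<^sup>2)) = 0" for j
      proof -
        have "((\<lambda>t. g (quot (vec_upd \<zeta> j t))) has_field_derivative
            (\<Sum>i\<in>UNIV. pderivative i g (quot (vec_upd \<zeta> j (\<zeta> $ j))) * (jac_num \<zeta> $ i $ j / (fden i \<zeta>)\<^sup>2)))
            (at (\<zeta> $ j))"
          by (rule polyfun_chain[OF g], rule quot_derivative) (use \<zeta> in blast)
        then have d: "((\<lambda>t. g (quot (vec_upd \<zeta> j t))) has_field_derivative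
            (\<Sum>i\<in>UNIV. pderivative i g (quot \<zeta>) * (jac_num \<zeta> $ i $ j / (fden i \<zeta>)\<^sup>2))) (at (\<zeta> $ j))"
          by simp
        \<comment> \<open>Denominators stay nonzero nearby, so \<open>g\<close> composed with the
          map vanishes in a neighbourhood and its derivative is zero.\<close>
        have "eventually (\<lambda>t. \<forall>i. fden i (vec_upd \<zeta> j t) \<noteq> 0) (nhds (\<zeta> $ j))"
        proof (rule eventually_all_finite)
          fix i
          have "isCont (\<lambda>t. fden i (vec_upd \<zeta> j t)) (\<zeta> $ j)"
            using sep_entire_has_pderivative[OF den] DERIV_isCont by blast
          then have "((\<lambda>t. fden i (vec_upd \<zeta> j t)) \<longlongrightarrow> fden i \<zeta>) (nhds (\<zeta> $ j))"
            using tendsto_at_iff_tendsto_nhds[of "\<lambda>t. fden i (vec_upd \<zeta> j t)" "\<zeta> $ j"]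
            by (simp add: isCont_def)
          then show "eventually (\<lambda>t. fden i (vec_upd \<zeta> j t) \<noteq> 0) (nhds (\<zeta> $ j))"
            using \<zeta> by (intro tendsto_imp_eventually_ne) auto
        qed
        then have "eventually (\<lambda>t. g (quot (vec_upd \<zeta> j t)) = 0) (nhds (\<zeta> $ j))"
          by eventually_elim (rule Suc.prems(3))
        then have "((\<lambda>t. g (quot (vec_upd \<zeta> j t))) has_field_derivative 0) (at (\<zeta> $ j))"
          using DERIV_cong_ev[OF refl _ refl, of "\<lambda>t. g (quot (vec_upd \<zeta> j t))" "\<lambda>_. 0" "\<zeta> $ j" 0] by simp
        with d show ?thesis using DERIV_unique by blast
      qed
      then have "transpose (jac_num \<zeta>) *v (\<chi> i. pderivative i g (quot \<zeta>) / (fden i \<zeta>)\<^sup>2) = 0"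
        by (simp add: vec_eq_iff matrix_vector_mult_def transpose_def mult_ac)
      moreover have "invertible (transpose (jac_num \<zeta>))" using dN by (simp add: invertible_det_nz)
      ultimately have "(\<chi> i. pderivative i g (quot \<zeta>) / (fden i \<zeta>)\<^sup>2) = 0"
        by (metis invertible_left_inverse matrix_left_invertible_ker)
      then show ?thesis using \<zeta> by (auto simp: vec_eq_iff)
    qed
    have "pderivative i g y = 0" for i y
    proof (rule Suc.IH)
      show "degree_less m (pderivative i g)" using Suc.prems(1) by simp
      show P: "pderivative i g \<in> polyfun S" by (rule polyfun_pderivative[OF g])
      obtain H n where H: "sep_entire H"
        "\<And>w. (\<forall>v. fden v w \<noteq> 0) \<Longrightarrow> H w = pderivative i g (quot w) * (\<Prod>v\<in>UNIV. fden v w) ^ n"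
        using polyfun_clear_denominators[where num = fnum and den = fden, OF P num den] unfolding quot_def by blast
      \<comment> \<open>So far the derivative vanishes only where the Jacobian is invertible.
        Multiplying by the determinant and the denominators covers every point, and these factors
        cancel because there are no zero divisors.\<close>
      have "H w = 0" for w
      proof (rule sep_entire_mult_eq_0[of "\<lambda>w. det (jac_num w) * (\<Prod>v\<in>UNIV. fden v w)" H \<zeta>0])
        show "sep_entire (\<lambda>w. det (jac_num w) * (\<Prod>v\<in>UNIV. fden v w))"
          by (intro sep_entire_mult sep_entire_det_jac_num sep_entire_prod den)
        show "det (jac_num w) * (\<Prod>v\<in>UNIV. fden v w) * H w = 0" for w
        proof (cases "(\<forall>v. fden v w \<noteq> 0) \<and> det (jac_num w) \<noteq> 0")
          case True
          then show ?thesis using H(2) vanish by simp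
        qed auto
        show "det (jac_num \<zeta>0) * (\<Prod>v\<in>UNIV. fden v \<zeta>0) \<noteq> 0" using det_jac_num \<zeta>0 by simp
      qed fact
      then show "pderivative i g (quot \<zeta>) = 0" if "\<forall>j. fden j \<zeta> \<noteq> 0" for \<zeta>
        using H(2)[OF that] that by simp
    qed
    then have "g y = g (quot \<zeta>0)" by (rule polyfun_constant[OF g])
    then show ?case using Suc.prems(3) \<zeta>0 by simp
  qed simp
qed

text \<open>Blocks of \<open>Z\<close> are replaced one at a time by points of the image. With the
  others fixed, \<open>h\<close> is a nonzero polynomial in the current block with arbitrary complex
  coefficients, so it does not vanish on the whole image.\<close>

lemma polyfun_blocks_neq_0:
  fixes h :: "complex ^ ('r::finite \<times> 'l) \<Rightarrow> complex"
  assumes h: "h \<in> polyfun S" and Z: "h Z \<noteq> 0"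
  shows "\<exists>\<zeta>. (\<forall>i j. fden j (\<zeta> i) \<noteq> 0) \<and> h (\<chi> p. fnum (snd p) (\<zeta> (fst p)) / fden (snd p) (\<zeta> (fst p))) \<noteq> 0"
proof -
  have hU: "h \<in> polyfun UNIV" by (rule polyfun_mono[OF h]) simp
  have "\<exists>Z. h Z \<noteq> 0 \<and> (\<forall>i\<in>I. \<exists>\<zeta>. (\<forall>j. fden j \<zeta> \<noteq> 0) \<and> slice Z i = quot \<zeta>)" for I :: "'r set"
  proof (induction I rule: infinite_finite_induct)
    case (insert i I)
    then obtain Z where Z: "h Z \<noteq> 0" "\<And>k. k \<in> I \<Longrightarrow> \<exists>\<zeta>. (\<forall>j. fden j \<zeta> \<noteq> 0) \<and> slice Z k = quot \<zeta>" by blast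
    have "(\<lambda>y. set_slice Z i y $ p) \<in> polyfun UNIV" for p
      by (cases "fst p = i") (auto simp: set_slice_def intro: polyfun.intros)
    then have "(\<lambda>y. h (set_slice Z i y)) \<in> polyfun UNIV" by (rule polyfun_compose[OF hU])
    moreover have "set_slice Z i (slice Z i) = Z" by (auto simp: set_slice_def slice_def vec_eq_iff)
    then have "h (set_slice Z i (slice Z i)) \<noteq> 0" using Z by simp
    ultimately obtain \<zeta> where "\<forall>j. fden j \<zeta> \<noteq> 0" "h (set_slice Z i (quot \<zeta>)) \<noteq> 0"
      using polyfun_vanishing_on_image by blast
    then show ?case using Z(2) insert.hyps
      by (intro exI[of _ "set_slice Z i (quot \<zeta>)"]) (auto simp: slice_set_slice)
  qed (use Z in auto)
  from this[of UNIV] obtain Z where "h Z \<noteq> 0" "\<forall>i. \<exists>\<zeta>. (\<forall>j. fden j \<zeta> \<noteq> 0) \<and> slice Z i = quot \<zeta>" by blast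
  then obtain \<zeta> where \<zeta>: "\<And>i j. fden j (\<zeta> i) \<noteq> 0" "\<And>i. slice Z i = quot (\<zeta> i)" by metis
  have "Z = (\<chi> p. fnum (snd p) (\<zeta> (fst p)) / fden (snd p) (\<zeta> (fst p)))"
    using \<zeta>(2) by (auto simp: vec_eq_iff slice_def quot_def)
  with \<open>h Z \<noteq> 0\<close> \<zeta>(1) show ?thesis by blast
qed

text \<open>For each of the countably many nonzero \<open>h\<close>, clearing denominators turns
  \<open>h\<close> of the image point into a separately entire function of \<open>z\<close>. It is
  not identically zero because the blocks use disjoint sets of entries and can be prescribed
  independently.\<close>

theorem AE_generic_image:
  fixes loc :: "'r::finite \<Rightarrow> 'l \<Rightarrow> 'n::finite"
  assumes loc: "inj (\<lambda>(r, k). loc r k)" and S: "countable S"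
  shows "AE z :: 'a::real_or_complex ^ 'n in lebesgue.
    (\<forall>r j. fden j (cvec (subvec loc z r)) \<noteq> 0) \<longrightarrow>
    generic S (\<chi> p. fnum (snd p) (cvec (subvec loc z (fst p))) / fden (snd p) (cvec (subvec loc z (fst p))))"
    (is "AE z in _. ?den z \<longrightarrow> generic S (?X z)")
proof -
  have loc_eq: "loc r k = loc r' k' \<longleftrightarrow> r = r' \<and> k = k'" for r k r' k'
    using injD[OF loc, of "(r, k)" "(r', k')"] by auto
  have sub: "cvec (subvec loc z r) = subvec loc (cvec z) r" for z :: "'a ^ 'n" and r
    by (simp add: cvec_def subvec_def vec_eq_iff)
  have sep: "sep_entire (\<lambda>w :: complex ^ 'n. g (subvec loc w r))" if g: "sep_entire g" for g r
    unfolding sep_entire_def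
  proof (intro allI)
    fix w :: "complex ^ 'n" and m
    show "(\<lambda>t. g (subvec loc (vec_upd w m t) r)) holomorphic_on UNIV"
    proof (cases "\<exists>k. m = loc r k")
      case True
      then obtain k where "m = loc r k" by blast
      then have "subvec loc (vec_upd w m t) r = vec_upd (subvec loc w r) k t" for t
        by (auto simp: subvec_def vec_upd_def vec_eq_iff loc_eq)
      then show ?thesis using g by (simp add: sep_entire_def)
    next
      case False
      then have "subvec loc (vec_upd w m t) r = subvec loc w r" for t
        by (auto simp: subvec_def vec_upd_def vec_eq_iff)
      then show ?thesis by simp
    qed
  qed
  have "AE z :: 'a ^ 'n in lebesgue. \<forall>h\<in>polyfun S. ?den z \<longrightarrow> h (?X z) = 0 \<longrightarrow> (\<forall>Z. h Z = 0)"
  proof (rule AE_ball_countable'[OF _ countable_polyfun[OF S]])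
    fix h :: "complex ^ ('r \<times> 'l) \<Rightarrow> complex" assume h: "h \<in> polyfun S"
    show "AE z :: 'a ^ 'n in lebesgue. ?den z \<longrightarrow> h (?X z) = 0 \<longrightarrow> (\<forall>Z. h Z = 0)"
    proof (cases "\<forall>Z. h Z = 0")
      case False
      then obtain Z where "h Z \<noteq> 0" by blast
      from polyfun_blocks_neq_0[OF h this] obtain \<zeta> where \<zeta>: "\<And>i j. fden j (\<zeta> i) \<noteq> 0"
        "h (\<chi> p. fnum (snd p) (\<zeta> (fst p)) / fden (snd p) (\<zeta> (fst p))) \<noteq> 0" by blast
      let ?num = "\<lambda>p w :: complex ^ 'n. fnum (snd p) (subvec loc w (fst p))"
      let ?den' = "\<lambda>p w :: complex ^ 'n. fden (snd p) (subvec loc w (fst p))"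
      have "\<exists>H m. sep_entire H \<and> (\<forall>w. (\<forall>v. ?den' v w \<noteq> 0) \<longrightarrow>
          H w = h (\<chi> v. ?num v w / ?den' v w) * (\<Prod>v\<in>UNIV. ?den' v w) ^ m)"
        by (rule polyfun_clear_denominators[OF h]) (auto intro: sep num den)
      then obtain H m where H: "sep_entire H" "\<And>w. (\<forall>v. ?den' v w \<noteq> 0) \<Longrightarrow>
          H w = h (\<chi> v. ?num v w / ?den' v w) * (\<Prod>v\<in>UNIV. ?den' v w) ^ m" by blast
      \<comment> \<open>The blocks \<open>\<zeta> r\<close> are glued along \<open>loc\<close>;
        entries outside its range receive whatever \<open>inv\<close> returns, which no block
        reads.\<close>
      define w where "w = (\<chi> n. case inv (\<lambda>(r, k). loc r k) n of (r, k) \<Rightarrow> \<zeta> r $ k)"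
      have w: "subvec loc w r = \<zeta> r" for r
        using inv_f_f[OF loc, of "(r, _)"] by (simp add: subvec_def w_def vec_eq_iff)
      have "H w \<noteq> 0"
        using H(2)[of w] \<zeta> by (simp add: w)
      from AE_sep_entire_neq_0[OF H(1) this, where 'a = 'a] show ?thesis
      proof eventually_elim
        case (elim z)
        then show ?case using H(2)[of "cvec z"] unfolding sub by auto
      qed
    qed simp
  qed
  then show ?thesis by eventually_elim (auto simp: generic_def)
qed

end

section \<open>Uniqueness of the factorization\<close>

text \<open>Expanding the rows in a basis of the row space expresses every column through the
  vectors of coefficients, as many as there are basis elements. This passes from
  \<open>rank\<close>, unfolded as row rank, to the columns that span tangent spaces.\<close>

lemma dim_columns_le_rank:
  fixes A :: "'a::field ^ 'n ^ 'm"
  shows "vec.dim (columns A) \<le> rank A"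
proof -
  obtain B where B: "B \<subseteq> rows A" "vec.independent B" "rows A \<subseteq> vec.span B" "card B = vec.dim (rows A)"
    by (rule vec.basis_exists)
  have fin: "finite B" using B(2) by (rule vec.finiteI_independent)
  have "\<exists>c. A $ i = (\<Sum>v\<in>B. c v *s v)" for i
  proof -
    have "A $ i \<in> rows A" by (auto simp: rows_def row_def)
    then have "A $ i \<in> vec.span B" using B(3) by blast
    then show ?thesis by (auto simp: vec.span_finite[OF fin])
  qed
  then obtain c where c: "\<And>i. A $ i = (\<Sum>v\<in>B. c i v *s v)" by metis
  let ?C = "(\<lambda>v. \<chi> i. c i v) ` B"
  have "columns A \<subseteq> vec.span ?C"
  proof
    fix x assume "x \<in> columns A"
    then obtain j where "x = column j A" by (auto simp: columns_def)
    then have "x = (\<Sum>v\<in>B. v $ j *s (\<chi> i. c i v))"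
      using c by (simp add: vec_eq_iff column_def mult.commute)
    then show "x \<in> vec.span ?C" by (simp add: vec.span_sum vec.span_scale vec.span_base)
  qed
  then have "vec.dim (columns A) \<le> card ?C" by (rule vec.dim_le_card) (simp add: fin)
  also have "\<dots> \<le> rank A" using card_image_le[OF fin] B(4) by (simp add: row_rank_def_gen)
  finally show ?thesis .
qed

lemma full_column_rank_left_inverse:
  fixes A :: "'a::field ^ 'n ^ 'm"
  assumes "rank A = CARD('n)"
  obtains L where "L ** A = mat 1"
proof -
  have "vec.dim (rows A) = vec.dimension TYPE('a) TYPE('n)"
    using assms by (simp add: row_rank_def_gen vec.dimension_def card_cart_basis)
  then show ?thesis
    using that matrix_left_invertible_span_rows_gen[of A] vec.dim_eq_full[of "rows A"] by auto
qed

lemma span_range_sum: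
  fixes b :: "'r::finite \<Rightarrow> 'a::field ^ 'n"
  assumes "v \<in> vec.span (range b)"
  obtains c where "v = (\<Sum>i\<in>UNIV. c i *s b i)"
proof -
  have "\<exists>c. v = (\<Sum>i\<in>UNIV. c i *s b i)"
    using assms
  proof (induction rule: vec.span_induct_alt)
    case base
    show ?case by (intro exI[of _ "\<lambda>_. 0"]) simp
  next
    case (step k x y)
    then obtain i c where "x = b i" "y = (\<Sum>i\<in>UNIV. c i *s b i)" by auto
    moreover have "k *s b i = (\<Sum>j\<in>UNIV. (if j = i then k else 0) *s b j)"
      by (simp add: if_distrib[of "\<lambda>k. k *s _"] cong: if_cong)
    ultimately have "k *s x + y = (\<Sum>j\<in>UNIV. ((if j = i then k else 0) + c j) *s b j)"
      by (simp add: vec.scale_left_distrib sum.distrib)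
    then show ?case by (rule exI[of _ "\<lambda>j. (if j = i then k else 0) + c j"])
  qed
  then show ?thesis using that by blast
qed

lemma sum_eq_0_coefficients:
  fixes b :: "'r::finite \<Rightarrow> 'a::field ^ 'n"
  assumes indep: "\<And>r. b r \<notin> vec.span (b ` (- {r}))" and 0: "(\<Sum>i\<in>UNIV. c i *s b i) = 0"
  shows "c r = 0"
proof (rule ccontr)
  assume c: "c r \<noteq> 0"
  have "c r *s b r + (\<Sum>i\<in>- {r}. c i *s b i) = 0"
    using 0 sum.remove[of UNIV r "\<lambda>i. c i *s b i"] by (simp add: Compl_eq_Diff_UNIV)
  then have "c r *s b r = - (\<Sum>i\<in>- {r}. c i *s b i)" by (simp add: eq_neg_iff_add_eq_0)
  also have "\<dots> \<in> vec.span (b ` (- {r}))"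
    by (intro vec.span_neg vec.span_sum vec.span_scale vec.span_base) auto
  finally have "(1 / c r) *s (c r *s b r) \<in> vec.span (b ` (- {r}))" by (rule vec.span_scale)
  moreover have "(1 / c r) *s (c r *s b r) = b r" using c by (simp add: vec_eq_iff)
  ultimately show False using indep[of r] by simp
qed

text \<open>A left inverse of \<open>A\<close> puts all \<open>b s\<close> into the span of the
  \<open>b' r\<close>. Counting dimensions, the spans agree and the \<open>b'\<close> are
  independent as well, so each \<open>b' r\<close> is a nonzero multiple of some
  \<open>b (\<sigma> r)\<close> with \<open>\<sigma>\<close> injective. Comparing coefficients then
  matches the columns of \<open>A\<close> and \<open>A'\<close>.\<close>

lemma unique_factorization:
  fixes A A' :: "complex ^ 'r ^ 'k" and b b' :: "'r \<Rightarrow> complex ^ 'n"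
  assumes rank: "rank A = CARD('r)"
    and indep: "\<And>r. b r \<notin> vec.span (b ` (- {r}))"
    and eq: "\<And>i. (\<Sum>r\<in>UNIV. A' $ i $ r *s b' r) = (\<Sum>r\<in>UNIV. A $ i $ r *s b r)"
    and mult: "\<And>r. b' r \<noteq> 0 \<Longrightarrow> b' r \<in> vec.span (range b) \<Longrightarrow> \<exists>i \<kappa>. b' r = \<kappa> *s b i"
  shows "\<exists>\<sigma>. bij \<sigma> \<and> (\<forall>r. outer (column r A') (b' r) = outer (column (\<sigma> r) A) (b (\<sigma> r)))"
proof -
  obtain L where L: "L ** A = mat 1" by (rule full_column_rank_left_inverse[OF rank])
  have "b s \<in> vec.span (range b')" for s
  proof -
    have "(\<Sum>i\<in>UNIV. L $ s $ i *s (\<Sum>r\<in>UNIV. A $ i $ r *s b r))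
        = (\<Sum>r\<in>UNIV. (L ** A) $ s $ r *s b r)"
    proof -
      have "(\<Sum>i\<in>UNIV. L $ s $ i *s (\<Sum>r\<in>UNIV. A $ i $ r *s b r))
          = (\<Sum>i\<in>UNIV. \<Sum>r\<in>UNIV. (L $ s $ i * A $ i $ r) *s b r)"
        by (simp add: vec.scale_sum_right)
      also have "\<dots> = (\<Sum>r\<in>UNIV. \<Sum>i\<in>UNIV. (L $ s $ i * A $ i $ r) *s b r)" by (rule sum.swap)
      finally show ?thesis by (simp add: matrix_matrix_mult_def vec.scale_sum_left)
    qed
    also have "\<dots> = b s" unfolding L by (simp add: mat_def if_distrib[of "\<lambda>k. k *s _"] cong: if_cong)
    finally have "b s = (\<Sum>i\<in>UNIV. L $ s $ i *s (\<Sum>r\<in>UNIV. A' $ i $ r *s b' r))" using eq by simp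
    then show ?thesis by (simp add: vec.span_sum vec.span_scale vec.span_base)
  qed
  then have sub: "range b \<subseteq> vec.span (range b')" by blast
  have inj_b: "inj b"
  proof (rule injI)
    fix r s assume rs: "b r = b s"
    show "r = s"
    proof (rule ccontr)
      assume "r \<noteq> s"
      then have "b r \<in> vec.span (b ` (- {r}))" using rs by (intro vec.span_base) auto
      with indep show False by blast
    qed
  qed
  have "vec.independent (range b)"
    unfolding vec.dependent_def
  proof
    assume "\<exists>a\<in>range b. a \<in> vec.span (range b - {a})"
    then obtain r where r: "b r \<in> vec.span (range b - {b r})" by blast
    have "range b - {b r} \<subseteq> b ` (- {r})" by auto
    with r indep[of r] vec.span_mono show False by blast
  qed
  then have dim_b: "vec.dim (range b) = CARD('r)"
    using card_image[OF inj_b] by (simp add: vec.dim_eq_card_independent)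
  have indep': "b' r \<notin> vec.span (b' ` (- {r}))" for r
  proof
    assume mem: "b' r \<in> vec.span (b' ` (- {r}))"
    have "insert (b' r) (b' ` (- {r})) = range b'" by auto
    then have "vec.span (range b') = vec.span (b' ` (- {r}))"
      using vec.span_redundant[OF mem] by simp
    then have "CARD('r) \<le> vec.dim (b' ` (- {r}))" using vec.dim_mono[of "range b" "b' ` (- {r})"] sub dim_b by simp
    also have "\<dots> \<le> card (- {r})"
      by (meson card_image_le finite finite_imageI order_trans vec.dim_le_card')
    also have "\<dots> < CARD('r)" by (intro psubset_card_mono) auto
    finally show False by simp
  qed
  have "vec.dim (range b') \<le> CARD('r)"
    by (meson card_image_le finite finite_imageI order_trans vec.dim_le_card')
  then have "vec.span (range b) = vec.span (vec.span (range b'))"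
    using dim_b by (intro vec.dim_eq_span[OF sub]) simp
  then have span_eq: "vec.span (range b) = vec.span (range b')" by simp
  have nz: "b' r \<noteq> 0" for r using indep'[of r] vec.span_zero by metis
  have "\<exists>i \<kappa>. b' r = \<kappa> *s b i" for r
    by (rule mult[OF nz]) (simp add: span_eq vec.span_base)
  then obtain \<sigma> \<kappa> where \<sigma>: "\<And>r. b' r = \<kappa> r *s b (\<sigma> r)" by metis
  have \<kappa>: "\<kappa> r \<noteq> 0" for r using nz[of r] \<sigma>[of r] by (metis vec.scale_zero_left)
  have "inj \<sigma>"
  proof (rule injI)
    fix r s assume rs: "\<sigma> r = \<sigma> s"
    show "r = s"
    proof (rule ccontr)
      assume "r \<noteq> s"
      have "b' r = (\<kappa> r / \<kappa> s) *s b' s" using \<kappa>[of s] unfolding \<sigma>[of r] \<sigma>[of s] rs by (simp add: vec_eq_iff)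
      moreover have "b' s \<in> vec.span (b' ` (- {r}))" using \<open>r \<noteq> s\<close> by (intro vec.span_base) auto
      ultimately show False using indep'[of r] vec.span_scale by metis
    qed
  qed
  then have bij: "bij \<sigma>" by (simp add: bij_def finite_UNIV_inj_surj)
  have coeff: "A $ i $ \<sigma> r = A' $ i $ r * \<kappa> r" for i r
  proof -
    have "(\<Sum>s\<in>UNIV. A $ i $ s *s b s) = (\<Sum>r\<in>UNIV. (A' $ i $ r * \<kappa> r) *s b (\<sigma> r))"
      using eq[of i] by (simp add: \<sigma>)
    also have "\<dots> = (\<Sum>r\<in>UNIV. (A' $ i $ inv \<sigma> (\<sigma> r) * \<kappa> (inv \<sigma> (\<sigma> r))) *s b (\<sigma> r))"
      using bij by (simp add: bij_is_inj)
    also have "\<dots> = (\<Sum>s\<in>UNIV. (A' $ i $ inv \<sigma> s * \<kappa> (inv \<sigma> s)) *s b s)"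
      by (rule sum.reindex_bij_betw[OF bij, of "\<lambda>s. (A' $ i $ inv \<sigma> s * \<kappa> (inv \<sigma> s)) *s b s"])
    finally have "(\<Sum>s\<in>UNIV. (A $ i $ s - A' $ i $ inv \<sigma> s * \<kappa> (inv \<sigma> s)) *s b s) = 0"
      by (simp add: vec.scale_left_diff_distrib sum_subtractf)
    from sum_eq_0_coefficients[OF indep this, of "\<sigma> r"] show ?thesis using bij by (simp add: bij_is_inj)
  qed
  show ?thesis
    by (intro exI[of _ \<sigma>] conjI bij allI) (simp add: outer_def column_def vec_eq_iff coeff \<sigma>)
qed

section \<open>The rational map with cleared denominators\<close>

definition coefficients :: "('n::finite \<Rightarrow> 'l cpoly) \<Rightarrow> ('n \<Rightarrow> 'l cpoly) \<Rightarrow> complex set" where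
  "coefficients p q = (\<Union>i. Poly_Mapping.lookup (p i) ` Poly_Mapping.keys (p i)
     \<union> Poly_Mapping.lookup (q i) ` Poly_Mapping.keys (q i))"

lemma countable_coefficients: "countable (coefficients p q)"
  unfolding coefficients_def by (intro countable_finite) auto

lemma polyfun_cpoly_eval:
  assumes "Poly_Mapping.lookup P ` Poly_Mapping.keys P \<subseteq> S"
  shows "cpoly_eval P \<in> polyfun S"
proof -
  have "(\<lambda>x. cpoly_eval P x) \<in> polyfun S"
    unfolding cpoly_eval_def using assms
    by (intro polyfun_sum polyfun.mult polyfun_prod polyfun_power polyfun.coord polyfun.const) auto
  then show ?thesis by simp
qed

context
  fixes p q :: "'n::finite \<Rightarrow> 'l::finite cpoly"
begin

private abbreviation (input) "S \<equiv> coefficients p q"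
private abbreviation (input) "P i \<equiv> cpoly_eval (p i)"
private abbreviation (input) "Q i \<equiv> cpoly_eval (q i)"
private abbreviation (input) "r \<equiv> rat_map p q"
private abbreviation (input) "J \<equiv> cjacobian (rat_map p q)"

definition common_den :: "complex ^ 'l \<Rightarrow> complex" where
  "common_den x = (\<Prod>i\<in>UNIV. cpoly_eval (q i) x)"

text \<open>A polynomial map equal to \<open>common_den x *s rat_map p q x\<close> away from the
  poles, hence with the same lines through the origin.\<close>

definition cleared :: "complex ^ 'l \<Rightarrow> complex ^ 'n" where
  "cleared x = (\<chi> i. cpoly_eval (p i) x * (\<Prod>k\<in>UNIV - {i}. cpoly_eval (q k) x))"

lemma polyfun_P: "P i \<in> polyfun S" and polyfun_Q: "Q i \<in> polyfun S"
  by (rule polyfun_cpoly_eval; force simp: coefficients_def)+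

lemma polyfun_common_den: "common_den \<in> polyfun S"
  using polyfun_prod[of UNIV Q S] polyfun_Q by (simp add: common_den_def[abs_def])

lemma polyfun_cleared: "(\<lambda>x. cleared x $ i) \<in> polyfun S"
  unfolding cleared_def by (simp, intro polyfun.mult polyfun_prod polyfun_P polyfun_Q)

lemma common_den_neq_0: "common_den x \<noteq> 0 \<longleftrightarrow> (\<forall>i. Q i x \<noteq> 0)"
  by (simp add: common_den_def)

lemma cleared_mult: "cleared x $ i * Q i x = common_den x * P i x"
  by (simp add: cleared_def common_den_def prod.remove[of UNIV i])

lemma cleared_eq: "common_den x \<noteq> 0 \<Longrightarrow> cleared x = common_den x *s r x"
  using cleared_mult[of x] by (simp add: vec_eq_iff rat_map_def common_den_neq_0 field_simps)

lemma vderiv_cleared: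
  assumes "common_den x \<noteq> 0"
  shows "vderiv cleared (Some j) x = pderivative j common_den x *s r x + common_den x *s column j (J x)"
proof -
  have Q: "Q i x \<noteq> 0" for i using assms by (simp add: common_den_neq_0)
  note d = polyfun_sep_entire[OF polyfun_P] polyfun_sep_entire[OF polyfun_Q]
    polyfun_sep_entire[OF polyfun_common_den] polyfun_sep_entire[OF polyfun_cleared]
  have J: "J x $ i $ j = (pderivative j (P i) x * Q i x - P i x * pderivative j (Q i) x) / (Q i x)\<^sup>2" for i
  proof -
    have "((\<lambda>t. P i (vec_upd x j t) / Q i (vec_upd x j t)) has_field_derivative
        (pderivative j (P i) x * Q i x - P i x * pderivative j (Q i) x) / (Q i x)\<^sup>2) (at (x $ j))"
      using Q[of i] by (auto intro!: derivative_eq_intros sep_entire_has_pderivative d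
          simp: power2_eq_square divide_simps)
    then show ?thesis by (simp add: cjacobian_def rat_map_def DERIV_imp_deriv)
  qed
  \<comment> \<open>Differentiating this polynomial identity avoids differentiating the product with
    factor \<open>i\<close> omitted.\<close>
  have "(\<lambda>x. cleared x $ i * Q i x) = (\<lambda>x. common_den x * P i x)" for i
    by (auto simp: cleared_mult)
  then have "pderivative j (\<lambda>x. cleared x $ i * Q i x) x = pderivative j (\<lambda>x. common_den x * P i x) x" for i
    by simp
  then have e: "cleared x $ i * pderivative j (Q i) x + pderivative j (\<lambda>x. cleared x $ i) x * Q i x
      = common_den x * pderivative j (P i) x + pderivative j common_den x * P i x" for i
    by (simp add: pderivative_mult d)
  have "vderiv cleared (Some j) x $ i = pderivative j common_den x * (r x $ i) + common_den x * (J x $ i $ j)" for i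
  proof -
    have c: "cleared x $ i = common_den x * P i x / Q i x"
      using cleared_mult[of x i] Q[of i] by (simp add: field_simps)
    have "pderivative j (\<lambda>x. cleared x $ i) x
        = (common_den x * pderivative j (P i) x + pderivative j common_den x * P i x
           - common_den x * P i x / Q i x * pderivative j (Q i) x) / Q i x"
      using e[of i] Q[of i] unfolding c by (simp add: eq_divide_eq algebra_simps)
    also have "\<dots> = pderivative j common_den x * (P i x / Q i x)
        + common_den x * ((pderivative j (P i) x * Q i x - P i x * pderivative j (Q i) x) / (Q i x)\<^sup>2)"
      using Q[of i] by (simp add: field_simps power2_eq_square)
    finally show ?thesis by (simp add: vderiv_Some J rat_map_def)
  qed
  then show ?thesis by (simp add: vec_eq_iff column_def)
qed

lemma derivation_rat_map:
  assumes den: "common_den x \<noteq> 0" and D: "derivation D" "\<forall>c\<in>S. D c = 0"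
  shows "(\<chi> i. D (r x $ i)) = (\<Sum>j\<in>UNIV. D (x $ j) *s column j (J x))"
proof -
  have "D (r x $ i) = (\<Sum>j\<in>UNIV. D (x $ j) * J x $ i $ j)" for i
  proof -
    have "cleared x $ i = common_den x * r x $ i" using cleared_eq[OF den] by simp
    then have "D (cleared x $ i) = common_den x * D (r x $ i) + D (common_den x) * r x $ i"
      by (simp add: derivation_props[OF D(1)])
    moreover have "D (cleared x $ i) = (\<Sum>j\<in>UNIV. vderiv cleared (Some j) x $ i * D (x $ j))"
      using derivation_polyfun[OF polyfun_cleared D] by (simp add: vderiv_Some)
    moreover have "\<dots> = D (common_den x) * r x $ i + common_den x * (\<Sum>j\<in>UNIV. D (x $ j) * J x $ i $ j)"
      unfolding derivation_polyfun[OF polyfun_common_den D] vderiv_cleared[OF den]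
      by (simp add: column_def sum_distrib_left sum_distrib_right sum.distrib algebra_simps)
    ultimately have "common_den x * D (r x $ i) = common_den x * (\<Sum>j\<in>UNIV. D (x $ j) * J x $ i $ j)"
      by auto
    then show ?thesis using den by simp
  qed
  then show ?thesis by (simp add: vec_eq_iff column_def)
qed

lemma tangent_cleared_subset:
  assumes "common_den x \<noteq> 0"
  shows "tangent cleared x \<subseteq> vec.span (insert (r x) (columns (J x)))"
proof
  fix v assume "v \<in> tangent cleared x"
  then obtain t where "v = vderiv cleared t x" by (auto simp: tangent_def)
  moreover have "column j (J x) \<in> columns (J x)" for j by (auto simp: columns_def)
  ultimately show "v \<in> vec.span (insert (r x) (columns (J x)))"
    using cleared_eq[OF assms] vderiv_cleared[OF assms]
    by (cases t) (auto intro!: vec.span_add vec.span_scale intro: vec.span_base)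
qed

lemma dim_range_cleared: "vec.dim (vec.span (rat_range p q)) \<le> vec.dim (range cleared)"
proof -
  have "rat_range p q \<subseteq> vec.span (range cleared)"
  proof
    fix v assume "v \<in> rat_range p q"
    then obtain x where x: "v = r x" "common_den x \<noteq> 0" by (auto simp: rat_range_def common_den_neq_0)
    have "v = (1 / common_den x) *s cleared x" using x by (simp add: cleared_eq vec_eq_iff)
    then show "v \<in> vec.span (range cleared)" by (simp add: vec.span_scale vec.span_base)
  qed
  then show ?thesis using vec.dim_mono by simp
qed

text \<open>The numerator of the quotient rule for \<open>cleared\<close> divided by
  \<open>common_den\<close>: a polynomial multiple of a Jacobian column, to which
  \<open>dim_le_generic\<close> applies.\<close>

definition cleared_jac :: "'l \<Rightarrow> complex ^ 'l \<Rightarrow> complex ^ 'n" where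
  "cleared_jac j x = common_den x *s vderiv cleared (Some j) x - pderivative j common_den x *s cleared x"

lemma cleared_jac_eq:
  assumes "common_den x \<noteq> 0"
  shows "cleared_jac j x = (common_den x)\<^sup>2 *s column j (J x)"
  unfolding cleared_jac_def vderiv_cleared[OF assms] cleared_eq[OF assms]
  by (simp add: vec_eq_iff algebra_simps power2_eq_square)

lemma polyfun_cleared_jac: "(\<lambda>x. cleared_jac j x $ i) \<in> polyfun S"
  using polyfun_diff[OF polyfun.mult[OF polyfun_common_den polyfun_vderiv[OF polyfun_cleared, of "Some j" i]]
      polyfun.mult[OF polyfun_pderivative[OF polyfun_common_den, of j] polyfun_cleared[of i]]]
  by (simp add: cleared_jac_def)

lemma span_cleared_jac:
  assumes "common_den x \<noteq> 0"
  shows "vec.span (range (\<lambda>j. cleared_jac j x)) = vec.span (columns (J x))"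
proof (rule vec.span_eq[THEN iffD2], intro conjI subsetI)
  fix v assume "v \<in> range (\<lambda>j. cleared_jac j x)"
  then show "v \<in> vec.span (columns (J x))"
    by (auto simp: cleared_jac_eq[OF assms] columns_def intro!: vec.span_scale intro: vec.span_base)
next
  fix v assume "v \<in> columns (J x)"
  then obtain j where j: "v = column j (J x)" by (auto simp: columns_def)
  have "v = (1 / (common_den x)\<^sup>2) *s cleared_jac j x"
    using assms by (simp add: j cleared_jac_eq vec_eq_iff)
  then show "v \<in> vec.span (range (\<lambda>j. cleared_jac j x))"
    by (simp add: vec.span_scale vec.span_base)
qed

text \<open>If the range is invariant under scaling, take \<open>\<lambda>\<close> algebraically independent of a generic \<open>u\<close>:
  the equation \<open>\<lambda> r(u) = r(y)\<close> can be differentiated with respect to both.\<close>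

lemma tangent_dim_bound:
  fixes l :: int
  assumes den: "common_den x0 \<noteq> 0"
    and jac: "AE x in (lebesgue :: (complex ^ 'l) measure). (\<forall>i. Q i x \<noteq> 0) \<longrightarrow> int (rank (J x)) \<le> l"
  shows "int (vec.dim (tangent cleared x)) \<le> (if scale_invariant (rat_range p q) then l else l + 1)"
proof -
  have "AE x in (lebesgue :: (complex ^ 'l) measure). generic S x \<and> ((\<forall>i. Q i x \<noteq> 0) \<longrightarrow> int (rank (J x)) \<le> l)"
    using AE_generic[OF countable_coefficients[of p q]] jac by eventually_elim blast
  from AE_lebesgue_nonempty[OF this] obtain x1 where x1: "generic S x1"
    and rk: "(\<forall>i. Q i x1 \<noteq> 0) \<longrightarrow> int (rank (J x1)) \<le> l" by blast
  have den1: "common_den x1 \<noteq> 0" by (rule generic_neq_0[OF x1 polyfun_common_den den])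
  have rk1: "int (vec.dim (columns (J x1))) \<le> l"
    using rk den1 dim_columns_le_rank[of "J x1"] by (simp add: common_den_neq_0)
  show ?thesis
  proof (cases "scale_invariant (rat_range p q)")
    case False
    have "vec.dim (tangent cleared x) \<le> vec.dim (tangent cleared x1)"
      unfolding tangent_def
      by (rule dim_le_generic[OF _ _ x1]) (auto intro: polyfun_vderiv polyfun_cleared)
    also have "\<dots> \<le> vec.dim (insert (r x1) (columns (J x1)))"
      by (rule vec.dim_mono[OF tangent_cleared_subset[OF den1]])
    also have "\<dots> \<le> vec.dim (columns (J x1)) + 1" by (simp add: vec.dim_insert)
    finally show ?thesis using rk1 False by simp
  next
    case True
    \<comment> \<open>The bound is extended to every point that is not a pole, since the point
      \<open>y\<close> obtained from scale invariance need not be generic.\<close>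
    have dimJ: "int (vec.dim (columns (J y))) \<le> l" if "common_den y \<noteq> 0" for y
    proof -
      have "vec.dim (columns (J y)) = vec.dim (range (\<lambda>j. cleared_jac j y))"
        using span_cleared_jac[OF that] by (metis vec.dim_span)
      also have "\<dots> \<le> vec.dim (range (\<lambda>j. cleared_jac j x1))"
        by (rule dim_le_generic[OF _ _ x1]) (auto intro: polyfun_cleared_jac)
      also have "\<dots> = vec.dim (columns (J x1))"
        using span_cleared_jac[OF den1] by (metis vec.dim_span)
      finally show ?thesis using rk1 by simp
    qed
    \<comment> \<open>The index \<open>None\<close> carries the scalar \<open>lam\<close> and the
      indices \<open>Some j\<close> carry \<open>u\<close>, so that all of them are algebraically
      independent together.\<close>
    obtain X :: "complex ^ 'l option" where X: "generic S X"
      using AE_lebesgue_nonempty[OF AE_generic[OF countable_coefficients[of p q]]] by blast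
    define \<pi> :: "complex ^ 'l option \<Rightarrow> complex ^ 'l" where "\<pi> X = (\<chi> j. X $ Some j)" for X
    define lam where "lam = X $ None"
    define u where "u = \<pi> X"
    have \<pi>: "(\<lambda>X. h (\<pi> X)) \<in> polyfun S" if "h \<in> polyfun S" for h
      by (rule polyfun_compose[OF that]) (auto simp: \<pi>_def intro: polyfun.coord)
    have lift: "\<pi> (\<chi> t. case t of None \<Rightarrow> 0 | Some j \<Rightarrow> x $ j) = x" for x
      by (simp add: \<pi>_def vec_eq_iff)
    have denu: "common_den u \<noteq> 0"
      unfolding u_def by (rule generic_neq_0[OF X \<pi>[OF polyfun_common_den]]) (subst lift, rule den)
    have lam: "lam \<noteq> 0"
      unfolding lam_def by (rule generic_neq_0[OF X polyfun.coord, of "\<chi> _. 1"]) simp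
    have "r u \<in> rat_range p q" using denu by (auto simp: rat_range_def common_den_neq_0)
    then have "lam *s r u \<in> rat_range p q" using True by (auto simp: scale_invariant_def)
    then obtain y where y: "lam *s r u = r y" "common_den y \<noteq> 0" by (auto simp: rat_range_def common_den_neq_0)
    have colspan: "(\<Sum>j\<in>UNIV. c j *s column j (J y)) \<in> vec.span (columns (J y))" for c
      by (intro vec.span_sum vec.span_scale vec.span_base) (auto simp: columns_def)
    have Dy: "(\<chi> i. lam * D (r u $ i) + D lam * r u $ i) \<in> vec.span (columns (J y))"
      if D: "derivation D" "\<forall>c\<in>S. D c = 0" for D
    proof -
      have "r y $ i = lam * r u $ i" for i using arg_cong[OF y(1), of "\<lambda>v. v $ i"] by simp
      then have "(\<chi> i. D (r y $ i)) = (\<chi> i. lam * D (r u $ i) + D lam * r u $ i)"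
        by (simp add: vec_eq_iff derivation_props[OF D(1)])
      then show ?thesis using colspan derivation_rat_map[OF y(2) D] by metis
    qed
    \<comment> \<open>Differentiating \<open>lam *s r u = r y\<close> in \<open>lam\<close> alone
      puts \<open>r u\<close> into the column space at \<open>y\<close>. Differentiating in a
      coordinate of \<open>u\<close> does the same for the columns at \<open>u\<close>, so the whole
      tangent space at \<open>u\<close> fits there.\<close>
    have r_mem: "r u \<in> vec.span (columns (J y))"
    proof -
      obtain D where D: "derivation D" "\<forall>c\<in>S. D c = 0"
        and DX: "\<And>w. D (X $ w) = (if w = None then 1 else 0)"
        using generic_derivation[OF X, of None] by metis
      have "(\<chi> i. D (r u $ i)) = 0"
        unfolding derivation_rat_map[OF denu D] by (simp add: u_def \<pi>_def DX)
      then have "D (r u $ i) = 0" for i by (simp add: vec_eq_iff)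
      then have "(\<chi> i. lam * D (r u $ i) + D lam * r u $ i) = r u" by (simp add: lam_def DX vec_eq_iff)
      with Dy[OF D] show ?thesis by simp
    qed
    have J_mem: "column j (J u) \<in> vec.span (columns (J y))" for j
    proof -
      obtain D where D: "derivation D" "\<forall>c\<in>S. D c = 0"
        and DX: "\<And>w. D (X $ w) = (if w = Some j then 1 else 0)"
        using generic_derivation[OF X, of "Some j"] by metis
      have "(\<chi> i. D (r u $ i)) = column j (J u)"
        unfolding derivation_rat_map[OF denu D]
        by (simp add: u_def \<pi>_def DX if_distrib[of "\<lambda>k. k *s _"] cong: if_cong)
      then have "D (r u $ i) = column j (J u) $ i" for i by (metis vec_lambda_beta)
      then have "(\<chi> i. lam * D (r u $ i) + D lam * r u $ i) = lam *s column j (J u)"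
        by (simp add: lam_def DX vec_eq_iff)
      with Dy[OF D] have "lam *s column j (J u) \<in> vec.span (columns (J y))" by simp
      then have "(1 / lam) *s (lam *s column j (J u)) \<in> vec.span (columns (J y))"
        by (rule vec.span_scale)
      moreover have "(1 / lam) *s (lam *s column j (J u)) = column j (J u)" using lam by (simp add: vec_eq_iff)
      ultimately show ?thesis by simp
    qed
    have "insert (r u) (columns (J u)) \<subseteq> vec.span (columns (J y))"
      using r_mem J_mem by (auto simp: columns_def)
    then have "tangent cleared u \<subseteq> vec.span (columns (J y))"
      using tangent_cleared_subset[OF denu] vec.span_minimal[OF _ vec.subspace_span] by blast
    then have "vec.dim (tangent cleared u) \<le> vec.dim (columns (J y))" by (rule vec.dim_mono)
    moreover have "vec.dim (range (\<lambda>t. vderiv cleared t (\<pi> (\<chi> t. case t of None \<Rightarrow> 0 | Some j \<Rightarrow> x $ j))))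
        \<le> vec.dim (range (\<lambda>t. vderiv cleared t (\<pi> X)))"
      by (rule dim_le_generic[OF _ _ X, where w = "\<lambda>t X. vderiv cleared t (\<pi> X)"])
        (auto intro: \<pi>[OF polyfun_vderiv[OF polyfun_cleared]])
    then have "vec.dim (tangent cleared x) \<le> vec.dim (tangent cleared u)"
      unfolding lift by (simp add: tangent_def u_def)
    ultimately show ?thesis using dimJ[OF y(2)] True by simp
  qed
qed

end

theorem theorem1:
  fixes \<mu> :: "('F::real_or_complex ^ 'n) measure"
    and \<Omega> :: "('F ^ 'n) set"
    and A :: "'F ^ 'n \<Rightarrow> complex ^ 'R ^ 'K"
    and p q :: "'N::finite \<Rightarrow> 'l::finite cpoly"
    and f :: "'F ^ 'l \<Rightarrow> 'F ^ 'l"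
    and fnum fden :: "'l \<Rightarrow> complex ^ 'l \<Rightarrow> complex"
    and loc :: "'R \<Rightarrow> 'l \<Rightarrow> 'n"
    and Nhat lhat :: int
  assumes mu_sets: "sets \<mu> = sets lebesgue"
    and mu_ac: "absolutely_continuous lebesgue \<mu>"
    and Omega_sets: "\<Omega> \<in> sets \<mu>"
    and Omega_pos: "emeasure \<mu> \<Omega> > 0"
    and loc_inj: "inj (\<lambda>(r, k). loc r k)"
    and q_nonzero: "\<And>i. q i \<noteq> 0"
    and f_defined: "\<And>z r j. z \<in> \<Omega> \<Longrightarrow> fden j (cvec (subvec loc z r)) \<noteq> 0"
    and b_defined: "\<And>z r i. z \<in> \<Omega> \<Longrightarrow> cpoly_eval (q i) (cvec (f (subvec loc z r))) \<noteq> 0"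
    and A_full_rank: "AE z in \<mu>. z \<in> \<Omega> \<longrightarrow> rank (A z) = CARD('R)"
    and f_analytic: "\<And>j. sep_entire (fnum j)" "\<And>j. sep_entire (fden j)"
    and fden_nonzero: "\<And>j. \<exists>\<zeta>. fden j \<zeta> \<noteq> 0"
    and f_rep: "\<And>\<zeta> j. fden j (cvec \<zeta>) \<noteq> 0 \<Longrightarrow>
                  to_complex (f \<zeta> $ j) = fnum j (cvec \<zeta>) / fden j (cvec \<zeta>)"
    and f_jacobian: "\<exists>\<zeta>0. (\<forall>j. fden j \<zeta>0 \<noteq> 0) \<and>
                       det (cjacobian (\<lambda>\<zeta>. \<chi> j. fnum j \<zeta> / fden j \<zeta>) \<zeta>0) \<noteq> 0"
    and span_dim: "int (vec.dim (vec.span (rat_range p q))) \<ge> Nhat"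
    and r_jacobian: "AE x in (lebesgue :: (complex ^ 'l) measure).
                       (\<forall>i. cpoly_eval (q i) x \<noteq> 0) \<longrightarrow>
                       int (rank (cjacobian (rat_map p q) x)) \<le> lhat"
    and R_bound: "if scale_invariant (rat_range p q)
                  then int CARD('R) \<le> Nhat - lhat
                  else int CARD('R) \<le> Nhat - lhat - 1"
  shows "AE z in \<mu>. z \<in> \<Omega> \<longrightarrow> unique_decomposition \<Omega> A (B_matrix p q f loc) z"
proof -
  \<comment> \<open>A point of \<open>\<Omega>\<close> supplies an argument at which no
    \<open>q i\<close> vanishes.\<close>
  obtain z0 where "z0 \<in> \<Omega>" using Omega_pos by fastforce
  from b_defined[OF this] have den0: "common_den q (cvec (f (subvec loc z0 undefined))) \<noteq> 0"
    by (simp add: common_den_neq_0)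
  let ?S = "coefficients p q"
  let ?\<rho> = "cleared p q"
  define e where "e = Max (range (\<lambda>x. vec.dim (tangent ?\<rho> x)))"
  have "range (\<lambda>x. vec.dim (tangent ?\<rho> x)) \<subseteq> {..CARD('N)}"
    using vec.dim_subset_UNIV by (auto simp: vec.dimension_def card_cart_basis)
  then have fin: "finite (range (\<lambda>x. vec.dim (tangent ?\<rho> x)))" by (rule finite_subset) simp
  have e_max: "vec.dim (tangent ?\<rho> x) \<le> e" for x unfolding e_def using fin by (intro Max_ge) auto
  have e_att: "\<exists>x. vec.dim (tangent ?\<rho> x) = e"
  proof -
    have "e \<in> range (\<lambda>x. vec.dim (tangent ?\<rho> x))" unfolding e_def using fin by (intro Max_in) auto
    then show ?thesis by auto
  qed
  \<comment> \<open>Both cases of \<open>R_bound\<close> match \<open>tangent_dim_bound\<close>: the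
    additional 1 without scale invariance pays for the direction of the point itself.\<close>
  have dim: "CARD('R) + e \<le> vec.dim (range ?\<rho>)"
  proof -
    obtain x where "vec.dim (tangent ?\<rho> x) = e" using e_att by blast
    with tangent_dim_bound[OF den0 r_jacobian, of x] span_dim R_bound dim_range_cleared[of p q]
    show ?thesis by (auto split: if_splits)
  qed
  obtain \<zeta>0 where \<zeta>0: "\<And>j. fden j \<zeta>0 \<noteq> 0"
    "det (cjacobian (\<lambda>\<zeta>. \<chi> j. fnum j \<zeta> / fden j \<zeta>) \<zeta>0) \<noteq> 0" using f_jacobian by blast
  define X where "X z = (\<chi> k. fnum (snd k) (cvec (subvec loc z (fst k))) / fden (snd k) (cvec (subvec loc z (fst k))))"
    for z :: "'F ^ 'n"
  have "AE z in \<mu>. (\<forall>r j. fden j (cvec (subvec loc z r)) \<noteq> 0) \<longrightarrow> generic ?S (X z)"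
    unfolding X_def
    by (rule absolutely_continuous_AE[OF mu_sets mu_ac
          AE_generic_image[OF f_analytic \<zeta>0 loc_inj countable_coefficients]])
  with A_full_rank show ?thesis
  proof eventually_elim
    case (elim z)
    show ?case
    proof
      assume z: "z \<in> \<Omega>"
      have gen: "generic ?S (X z)" using elim(2) f_defined[OF z] by blast
      define b where "b w r = rat_map p q (cvec (f (subvec loc w r)))" for w r
      define y where "y w r = cvec (f (subvec loc w r))" for w r
      have den: "common_den q (y w r) \<noteq> 0" if "w \<in> \<Omega>" for w r
        using b_defined[OF that] by (simp add: common_den_neq_0 y_def)
      have b: "?\<rho> (y w r) = common_den q (y w r) *s b w r" if "w \<in> \<Omega>" for w r
        using cleared_eq[OF den[OF that]] by (simp add: b_def y_def)
      have Xy: "slice (X z) r = y z r" for r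
        using f_rep[OF f_defined[OF z]] by (simp add: slice_def X_def y_def cvec_def vec_eq_iff)
      have b': "b w r = (1 / common_den q (y w r)) *s ?\<rho> (y w r)" if "w \<in> \<Omega>" for w r
        using b[OF that] den[OF that] by (simp add: vec_eq_iff)
      note key = polyfun_cleared gen e_max e_att dim
      have indep: "b z r \<notin> vec.span (b z ` (- {r}))" for r
      proof
        assume "b z r \<in> vec.span (b z ` (- {r}))"
        then have "?\<rho> (y z r) \<in> vec.span (b z ` (- {r}))" unfolding b[OF z] by (rule vec.span_scale)
        moreover have "b z ` (- {r}) \<subseteq> vec.span ((\<lambda>k. ?\<rho> (y z k)) ` (- {r}))"
        proof (rule image_subsetI)
          fix k assume "k \<in> - {r}"
          then show "b z k \<in> vec.span ((\<lambda>k. ?\<rho> (y z k)) ` (- {r}))"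
            unfolding b'[OF z] by (intro vec.span_scale vec.span_base) auto
        qed
        then have "vec.span (b z ` (- {r})) \<subseteq> vec.span ((\<lambda>k. ?\<rho> (y z k)) ` (- {r}))"
          by (rule vec.span_minimal) (rule vec.subspace_span)
        ultimately show False using generic_points_independent[OF key, of r] by (auto simp: Xy)
      qed
      show "unique_decomposition \<Omega> A (B_matrix p q f loc) z"
        unfolding unique_decomposition_def
      proof (intro ballI impI)
        fix z' assume z': "z' \<in> \<Omega>"
          and eq: "A z' ** transpose (B_matrix p q f loc z') = A z ** transpose (B_matrix p q f loc z)"
        have col: "column r (B_matrix p q f loc w) = b w r" for w r
          by (simp add: column_def B_matrix_def b_def vec_eq_iff)
        show "\<exists>\<sigma>. bij \<sigma> \<and> (\<forall>r. outer (column r (A z')) (column r (B_matrix p q f loc z')) =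
            outer (column (\<sigma> r) (A z)) (column (\<sigma> r) (B_matrix p q f loc z)))"
          unfolding col
        proof (rule unique_factorization)
          show "rank (A z) = CARD('R)" using elim(1) z by blast
          show "b z r \<notin> vec.span (b z ` (- {r}))" for r by (rule indep)
          have prod: "(A w ** transpose (B_matrix p q f loc w)) $ i = (\<Sum>r\<in>UNIV. A w $ i $ r *s b w r)" for w i
            by (simp add: vec_eq_iff matrix_matrix_mult_def transpose_def B_matrix_def b_def)
          show "(\<Sum>r\<in>UNIV. A z' $ i $ r *s b z' r) = (\<Sum>r\<in>UNIV. A z $ i $ r *s b z r)" for i
            unfolding prod[symmetric] eq ..
          show "\<exists>i \<kappa>. b z' r = \<kappa> *s b z i" if nz: "b z' r \<noteq> 0" and mem: "b z' r \<in> vec.span (range (b z))" for r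
          proof -
            obtain c where c: "b z' r = (\<Sum>i\<in>UNIV. c i *s b z i)" by (rule span_range_sum[OF mem])
            \<comment> \<open>Translates coefficients for \<open>b\<close> into coefficients for the
              cleared map. Only \<open>z\<close> has to be generic: \<open>y z' r\<close> plays the
              part of the arbitrary point \<open>x\<close> in \<open>generic_secant\<close>.\<close>
            define d where "d i = common_den q (y z' r) * c i / common_den q (y z i)" for i
            have "?\<rho> (y z' r) = (\<Sum>i\<in>UNIV. d i *s ?\<rho> (slice (X z) i))"
              using den[OF z] unfolding b[OF z'] Xy b[OF z] c
              by (simp add: d_def vec.scale_sum_right)
            moreover have "?\<rho> (y z' r) \<noteq> 0" using nz den[OF z'] by (simp add: b[OF z'])
            ultimately obtain i where i: "\<And>k. k \<noteq> i \<Longrightarrow> d k = 0"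
              using generic_secant[OF key] by blast
            have "c k = 0" if "k \<noteq> i" for k
              using i[OF that] den[OF z'] den[OF z] by (simp add: d_def)
            then have "b z' r = c i *s b z i"
              unfolding c by (subst sum.remove[of _ i]) auto
            then show ?thesis by blast
          qed
        qed
      qed
    qed
  qed
qed

end
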